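(* Let $q\in[2,+\infty)$ and let $(G_n)_{n\in\mathbb{N}}$ be a sequence of finite graphs, with vertex sets $V_n$, $|V_n|=n$, and degrees bounded by a constant $D$, having a local weak limit $\overline{\mathbb{P}}$ supported on the set of (isomorphism classes of) rooted trees. Assume that there exist $L,h_0>0$ such that for any $n\in\mathbb{N}$ there is an integer $h=h(n)\ge h_0$ with $$d_{\mathrm{TV}}\bigl(\overline{\mathbb{P}}^{(h)}_{G_n},\overline{\mathbb{P}}^{(h)}\bigr)\le L\,h^{-\frac q2}.$$ Let $I_1\subset\mathbb{R}$ be a bounded open set such that $$\sup_{\lambda\in I_1,\ \eta\in(0,1)}\mathbb{E}_{(T;o)\sim\overline{\mathbb{P}}}\left(\bigl(\Im R^T_{oo}(\lambda+i\eta)\bigr)^{\frac q2}+|R^T_{oo}(\lambda+i\eta)|^2\right)<+\infty,$$ and let $c_0>0$ be such that $\overline{\mu}$ has density $\ge c_0$ in $I_1$. Then there exist $C,C'>0$ (depending on $L,h_0,c_0$) such that for any $\Lambda>0$, any $n\in\mathbb{N}$ and any interval $I\subset I_1$ of length at least $C(\log h)/h$ (with $h=h(n)$), there holds $$\mathbb{P}_I\left(\|u\|_{L^q}\ge\Lambda C'n^{\frac1q-\frac12}\right)\le\Lambda^{-q},$$ where $u\sim\mathbb{P}_I$ is a random approximate eigenvector of the adjacency matrix of $G_n$.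
   Context: Local weak limit: for a rooted graph $(G;x)$ and $h\in\mathbb{N}$, $(G;x)_h$ is the rooted graph obtained by cutting $G$ at distance $h$ from $x$; $\simeq$ denotes rooted graph isomorphism. A probability measure $\overline{\mathbb{P}}$ on isomorphism classes of connected rooted graphs is the local weak (Benjamini–Schramm) limit of $(G_n)$ if for all $h$ and all rooted graphs $(H;o)$ of depth $h$, $$\lim_{n\to\infty}\frac{|\{x\in V_n:(G_n;x)_h\simeq(H;o)\}|}{|V_n|}=\overline{\mathbb{P}}(\{(G;x):(G;x)_h\simeq(H;o)\}).$$ For $h\in\mathbb{N}$, define the probability measures on the set of isomorphism classes of rooted graphs of depth $\le h$: $\overline{\mathbb{P}}^{(h)}_{G_n}=\frac1{|V_n|}\sum_{x\in V_n}\delta_{(G_n;x)_h}$ and $\overline{\mathbb{P}}^{(h)}(H;o)=\overline{\mathbb{P}}(\{(G;x):(G;x)_h\simeq(H;o)\})$. $d_{\mathrm{TV}}$ is the total variation distance. For a rooted graph $(T;o)$ with adjacency operator $A(T)$, $R^T_{oo}(z)=\langle\delta_o,(A(T)-z\,\mathrm{Id})^{-1}\delta_o\rangle$. The spectral measure $\mu^{[T;o]}$ is the probability measure on $\mathbb{R}$ with $R^T_{oo}(z)=\int\frac{1}{\lambda-z}d\mu^{[T;o]}(\lambda)$ for $\Im z>0$, and $\overline{\mu}=\int\mu^{[T;o]}\,d\overline{\mathbb{P}}([T;o])$. For $G_n$ with adjacency matrix $A(G_n)$, let $(\psi_{\lambda_k})_k$ be a real orthonormal eigenbasis with eigenvalues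 $\lambda_k$. For $I\subset\mathbb{R}$, $E_I=\mathrm{span}_{\mathbb{R}}\{\psi_{\lambda_k}:\lambda_k\in I\}\subset\mathbb{R}^{V_n}$, and $\mathbb{P}_I$ is the uniform probability measure on the Euclidean unit sphere of $E_I$. $\|u\|_{L^q}=(\sum_{x}|u(x)|^q)^{1/q}$.
   Formalization: The conclusion is stated only for n with h(n) ≠ 1: for h(n) = 1 the length threshold C(log h)/h is 0, so I may contain no eigenvalue (P_I undefined) or only a localized eigenvector, and the claim fails. *)

theory Defs
  imports "HOL-Probability.Probability"
begin

subsection \<open>Graphs and rooted graphs\<close>

record 'a graph =
  verts :: "'a set"
  edges :: "'a rel"

definition simple_graph :: "'a graph \<Rightarrow> bool" where
  "simple_graph G \<longleftrightarrow> edges G \<subseteq> verts G \<times> verts G \<and> sym (edges G) \<and> irrefl (edges G)"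

definition neighbours :: "'a graph \<Rightarrow> 'a \<Rightarrow> 'a set" where
  "neighbours G x = edges G `` {x}"

definition graph_ball :: "'a graph \<Rightarrow> 'a \<Rightarrow> nat \<Rightarrow> 'a set" where
  "graph_ball G x h = {y \<in> verts G. \<exists>k\<le>h. (x, y) \<in> edges G ^^ k}"

definition induced :: "'a graph \<Rightarrow> 'a set \<Rightarrow> 'a graph" where
  "induced G S = \<lparr>verts = verts G \<inter> S, edges = edges G \<inter> S \<times> S\<rparr>"

type_synonym 'a rooted = "'a graph \<times> 'a"

definition rooted_graph :: "'a rooted \<Rightarrow> bool" where
  "rooted_graph = (\<lambda>(G, x). simple_graph G \<and> x \<in> verts G \<and>
     (\<forall>y\<in>verts G. (x, y) \<in> (edges G)\<^sup>*) \<and> (\<forall>y\<in>verts G. finite (neighbours G y)))"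

definition cut :: "nat \<Rightarrow> 'a rooted \<Rightarrow> 'a rooted" where
  "cut h = (\<lambda>(G, x). (induced G (graph_ball G x h), x))"

definition depth_le :: "nat \<Rightarrow> 'a rooted \<Rightarrow> bool" where
  "depth_le h = (\<lambda>(G, x). verts G \<subseteq> graph_ball G x h)"

definition rooted_iso :: "'a rooted \<Rightarrow> 'b rooted \<Rightarrow> bool" (infix "\<simeq>\<^sub>r" 50) where
  "g \<simeq>\<^sub>r g' \<longleftrightarrow> (\<exists>f. bij_betw f (verts (fst g)) (verts (fst g')) \<and> f (snd g) = snd g' \<and>
     (\<forall>u\<in>verts (fst g). \<forall>v\<in>verts (fst g).
        (u, v) \<in> edges (fst g) \<longleftrightarrow> (f u, f v) \<in> edges (fst g')))"

definition rooted_tree :: "'a rooted \<Rightarrow> bool" where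
  "rooted_tree g \<longleftrightarrow> rooted_graph g \<and>
     \<not> (\<exists>c. 3 \<le> length c \<and> distinct c \<and> successively (\<lambda>u v. (u, v) \<in> edges (fst g)) c \<and>
            (last c, hd c) \<in> edges (fst g))"


subsection \<open>Isomorphism classes and random rooted graphs\<close>

text \<open>A connected locally finite graph is countable, so every isomorphism class has a
  representative whose vertices are natural numbers; the class is taken to be the set of all
  these representatives.\<close>

type_synonym rclass = "nat rooted set"

definition iso_class :: "'a rooted \<Rightarrow> rclass" where
  "iso_class g = {g'. rooted_graph g' \<and> g \<simeq>\<^sub>r g'}"

definition rooted_classes :: "rclass set" where
  "rooted_classes = iso_class ` {g :: nat rooted. rooted_graph g}"

definition representative :: "rclass \<Rightarrow> nat rooted" where
  "representative c = (SOME g. g \<in> c)"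

definition cylinder :: "nat \<Rightarrow> nat rooted \<Rightarrow> rclass set" where
  "cylinder h H = {c \<in> rooted_classes. \<exists>g\<in>c. cut h g \<simeq>\<^sub>r H}"

text \<open>The Borel \<open>\<sigma>\<close>-algebra of the local topology.\<close>

definition rooted_space :: "rclass measure" where
  "rooted_space = sigma rooted_classes {cylinder h H | h H. rooted_graph H}"

definition random_rooted_graph :: "rclass measure \<Rightarrow> bool" where
  "random_rooted_graph P \<longleftrightarrow> prob_space P \<and> sets P = sets rooted_space"

definition local_weak_limit :: "(nat \<Rightarrow> 'a graph) \<Rightarrow> rclass measure \<Rightarrow> bool" where
  "local_weak_limit G P \<longleftrightarrow> random_rooted_graph P \<and>
     (\<forall>h H. rooted_graph H \<and> depth_le h H \<longrightarrow>
        (\<lambda>n. real (card {x \<in> verts (G n). cut h (G n, x) \<simeq>\<^sub>r H}) / real (card (verts (G n))))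
          \<longlonglongrightarrow> measure P (cylinder h H))"

text \<open>There are only countably many classes of depth at most \<open>h\<close>, so the laws of the
  \<open>h\<close>-balls live on a discrete space.\<close>

definition depth_classes :: "nat \<Rightarrow> rclass set" where
  "depth_classes h = iso_class ` {g :: nat rooted. rooted_graph g \<and> depth_le h g}"

definition ball_law :: "nat \<Rightarrow> rclass measure \<Rightarrow> rclass measure" where
  "ball_law h P =
     distr P (count_space (depth_classes h)) (\<lambda>c. iso_class (cut h (representative c)))"

definition empirical_ball_law :: "nat \<Rightarrow> 'a graph \<Rightarrow> rclass measure" where
  "empirical_ball_law h G =
     distr (uniform_count_measure (verts G)) (count_space (depth_classes h))
       (\<lambda>x. iso_class (cut h (G, x)))"

definition dTV :: "'b measure \<Rightarrow> 'b measure \<Rightarrow> real" where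
  "dTV M N = (SUP A\<in>sets M. \<bar>measure M A - measure N A\<bar>)"


subsection \<open>Adjacency operator, resolvent and spectral measure\<close>

definition adj_op :: "'a graph \<Rightarrow> ('a \<Rightarrow> 'b :: comm_monoid_add) \<Rightarrow> 'a \<Rightarrow> 'b" where
  "adj_op G f x = (if x \<in> verts G then \<Sum>y\<in>neighbours G x. f y else 0)"

definition ell2 :: "'a set \<Rightarrow> ('a \<Rightarrow> complex) set" where
  "ell2 V = {f. (\<forall>x. x \<notin> V \<longrightarrow> f x = 0) \<and> (\<lambda>x. (cmod (f x))\<^sup>2) summable_on V}"

definition ell2_inner :: "'a set \<Rightarrow> ('a \<Rightarrow> complex) \<Rightarrow> ('a \<Rightarrow> complex) \<Rightarrow> complex" where
  "ell2_inner V f g = (\<Sum>\<^sub>\<infinity>x\<in>V. cnj (f x) * g x)"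

definition delta :: "'a \<Rightarrow> 'a \<Rightarrow> complex" where
  "delta a x = (if x = a then 1 else 0)"

definition resolvent :: "'a rooted \<Rightarrow> complex \<Rightarrow> complex" where
  "resolvent = (\<lambda>(T, a) z. ell2_inner (verts T) (delta a)
     (inv_into (ell2 (verts T)) (\<lambda>f x. adj_op T f x - z * f x) (delta a)))"

definition spectral_measure :: "'a rooted \<Rightarrow> real measure" where
  "spectral_measure g = (THE M. prob_space M \<and> sets M = sets borel \<and>
     (\<forall>z. Im z > 0 \<longrightarrow> resolvent g z = (LINT t|M. 1 / (complex_of_real t - z))))"

definition mean_spectral_measure :: "rclass measure \<Rightarrow> real measure" where
  "mean_spectral_measure P = measure_of UNIV (sets borel)
     (\<lambda>B. \<integral>\<^sup>+c. emeasure (spectral_measure (representative c)) B \<partial>P)"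

definition has_density_ge_on :: "real measure \<Rightarrow> real \<Rightarrow> real set \<Rightarrow> bool" where
  "has_density_ge_on M b S \<longleftrightarrow> (\<exists>f\<in>borel_measurable borel. (\<forall>t\<in>S. b \<le> f t) \<and>
     restrict_space M S = density (restrict_space lborel S) (\<lambda>t. ennreal (f t)))"


subsection \<open>Random approximate eigenvectors\<close>

definition eigenbasis :: "'a graph \<Rightarrow> (nat \<Rightarrow> 'a \<Rightarrow> real) \<Rightarrow> (nat \<Rightarrow> real) \<Rightarrow> bool" where
  "eigenbasis G \<psi> lam \<longleftrightarrow>
     (\<forall>j<card (verts G). \<forall>k<card (verts G).
        (\<Sum>x\<in>verts G. \<psi> j x * \<psi> k x) = (if j = k then 1 else 0)) \<and>
     (\<forall>k<card (verts G). \<forall>x\<in>verts G. adj_op G (\<psi> k) x = lam k * \<psi> k x)"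

definition spectral_indices :: "'a graph \<Rightarrow> (nat \<Rightarrow> real) \<Rightarrow> real set \<Rightarrow> nat set" where
  "spectral_indices G lam I = {k. k < card (verts G) \<and> lam k \<in> I}"

definition lin_comb ::
  "'a graph \<Rightarrow> (nat \<Rightarrow> 'a \<Rightarrow> real) \<Rightarrow> nat set \<Rightarrow> (nat \<Rightarrow> real) \<Rightarrow> 'a \<Rightarrow> real" where
  "lin_comb G \<psi> K c = (\<lambda>x\<in>verts G. \<Sum>k\<in>K. c k * \<psi> k x)"

definition spectral_subspace ::
  "'a graph \<Rightarrow> (nat \<Rightarrow> 'a \<Rightarrow> real) \<Rightarrow> (nat \<Rightarrow> real) \<Rightarrow> real set \<Rightarrow> ('a \<Rightarrow> real) set" where
  "spectral_subspace G \<psi> lam I = range (lin_comb G \<psi> (spectral_indices G lam I))"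

definition zero_vector :: "'a graph \<Rightarrow> 'a \<Rightarrow> real" where
  "zero_vector G = (\<lambda>x\<in>verts G. 0)"

definition Lq_norm :: "real \<Rightarrow> 'a set \<Rightarrow> ('a \<Rightarrow> real) \<Rightarrow> real" where
  "Lq_norm q V u = (\<Sum>x\<in>V. \<bar>u x\<bar> powr q) powr (1 / q)"

text \<open>Normalized surface measure of the unit sphere of \<open>\<real>\<^sup>K\<close>, as the radial projection of
  the normalized Lebesgue measure of the unit ball (polar coordinates). For empty \<open>K\<close> the
  sphere is empty and the value is meaningless.\<close>

definition sphere_measure :: "nat set \<Rightarrow> (nat \<Rightarrow> real) measure" where
  "sphere_measure K =
     distr (uniform_measure (PiM K (\<lambda>_. lborel)) {c \<in> PiE K (\<lambda>_. UNIV). L2_set c K \<le> 1})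
       (PiM K (\<lambda>_. borel)) (\<lambda>c. \<lambda>k\<in>K. c k / L2_set c K)"

text \<open>The uniform measure on the unit sphere of \<open>spectral_subspace G \<psi> lam I\<close>, of which the
  \<open>\<psi> k\<close> with \<open>lam k \<in> I\<close> form an orthonormal basis.\<close>

definition random_eigenvector ::
  "'a graph \<Rightarrow> (nat \<Rightarrow> 'a \<Rightarrow> real) \<Rightarrow> (nat \<Rightarrow> real) \<Rightarrow> real set \<Rightarrow> ('a \<Rightarrow> real) measure" where
  "random_eigenvector G \<psi> lam I =
     distr (sphere_measure (spectral_indices G lam I)) (PiM (verts G) (\<lambda>_. borel))
       (lin_comb G \<psi> (spectral_indices G lam I))"

end

(* A vector u chosen uniformly on the sphere of E_I has E |u(x)|^q <= gamma_q (Pi_I(x,x) / N_I)^(q/2),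
   where N_I = dim E_I and gamma_q is a Gaussian moment, so by Markov's inequality it suffices to bound
   N_I from below by c n |I| and the sum of Pi_I(x,x)^(q/2) from above by C n |I|^(q/2).

   Let a be the midpoint of I, eta = |I| / (2K) and p(t) = eta^2 / ((t-a)^2 + eta^2). On [-D,D] a polynomial
   of degree at most h/2, built from a Chebyshev polynomial, approximates p up to an error O(1/h), since
   eta is at least a large multiple of (log h)/h. Its value at A(G_n), and that of its square, at (x,x)
   only depend on the h-ball around x, so averages over G_n can be compared with averages over the limit
   tree through the total variation distance. On the tree, p integrates to eta Im R(a + i eta), whose
   moments are bounded: this gives the upper bound, as 1_I <= (1+K^2) p. For the lower bound,
   p^2 <= 1_I + p / K^2; the density of the mean spectral measure bounds the average of p^2 from below by a
   multiple of eta, and for large K the tail p / K^2 is absorbed by the upper bound.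

   The spectral measure of the infinite tree is constructed from the numbers of closed walks: the Bernstein
   basis polynomials of the operator are positive, so they define discrete probability measures, which
   converge weakly along a subsequence. It does not matter whether the resolvent and the spectral measure
   depend measurably on the tree, since they only enter through pointwise inequalities with functions of
   the h-ball. *)

theory Submission
  imports Defs
begin

section \<open>Moments of linear forms on the sphere\<close>

text \<open>The hypotheses fix the scales. The width \<eta> is at least of order (log h)/h because
  the residual exp(-m \<eta>/sqrt B) of a polynomial of degree about h/2 must fall below 1/h, itself
  a small fraction of \<eta>. The rate h^(-q/2) serves the upper bound: the truncated test function
  (mass/\<eta>)^(q/2) can be as large as (2/\<eta>)^(q/2), and 2/h \<le> \<eta> keeps its product
  with the total variation distance below L. The constants are not circular: the moment bound U
  holds at every admissible width \<eta> < 1 and its value does not involve K, so K is chosen after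
  U and C after K. On the sphere, the moment comes from writing a Gaussian vector as its norm times
  an independent uniform direction; Jensen's inequality bounds the moment of the norm from below.
  \<open>resolvent\<close> and \<open>spectral_measure\<close> rest on \<open>inv_into\<close> and
  \<open>THE\<close>, so they say nothing before existence and uniqueness are proved. The equation
  (A - z) f = \<delta> is solved by limits of polynomial vectors, the value at the root of any
  square summable solution is forced by duality, and Stieltjes inversion gives the uniqueness of the
  measure.\<close>

abbreviation lebesgue_prod :: "nat set \<Rightarrow> (nat \<Rightarrow> real) measure" where
  "lebesgue_prod K \<equiv> PiM K (\<lambda>_. lborel)"

section \<open>Scaling of Lebesgue measure and polar coordinates\<close>

lemma product_sigma_finite_lborel: "product_sigma_finite (\<lambda>_::nat. lborel :: real measure)"
  by standard

lemma emeasure_lborel_scale_vimage: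
  assumes "r > 0" "A \<in> sets borel"
  shows "ennreal r * emeasure lborel ((*) r -` A) = emeasure lborel (A :: real set)"
proof -
  have "emeasure lborel A = emeasure (density (distr lborel borel ((*) r)) (\<lambda>_. ennreal \<bar>r\<bar>)) A"
    using assms lborel_distr_mult'[of r] by simp
  also have "\<dots> = ennreal r * emeasure lborel ((*) r -` A)"
    using assms by (simp add: emeasure_density_const emeasure_distr)
  finally show ?thesis by simp
qed

lemma L2_set_measurable [measurable]:
  "finite K \<Longrightarrow> (\<lambda>c. L2_set c K) \<in> borel_measurable (lebesgue_prod K)"
  unfolding L2_set_def by measurable

text \<open>A measure on a finite product is determined by its values on boxes, and each of the
  \<open>card K\<close> sides of a box contributes one factor \<open>r\<close>.\<close>

lemma lebesgue_prod_scale: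
  assumes K: "finite K" and r: "r > 0"
  shows "lebesgue_prod K = density (distr (lebesgue_prod K) (lebesgue_prod K) (\<lambda>c. \<lambda>k\<in>K. r * c k))
           (\<lambda>_. ennreal (r ^ card K))"
proof -
  interpret product_sigma_finite "\<lambda>_::nat. lborel :: real measure"
    by (rule product_sigma_finite_lborel)
  let ?S = "\<lambda>c. \<lambda>k\<in>K. r * c k"
  have [measurable]: "?S \<in> measurable (lebesgue_prod K) (lebesgue_prod K)" by measurable
  show ?thesis
  proof (rule sym, rule PiM_eqI[OF K])
    show "sets (density (distr (lebesgue_prod K) (lebesgue_prod K) ?S) (\<lambda>_. ennreal (r ^ card K)))
        = sets (lebesgue_prod K)" by simp
    fix A :: "nat \<Rightarrow> real set" assume A: "\<And>i. i \<in> K \<Longrightarrow> A i \<in> sets lborel"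
    have PA: "Pi\<^sub>E K A \<in> sets (lebesgue_prod K)"
      using A K by (intro sets_PiM_I_finite) auto
    have vi: "?S -` Pi\<^sub>E K A \<inter> space (lebesgue_prod K) = Pi\<^sub>E K (\<lambda>i. (*) r -` A i)"
      by (auto simp: space_PiM PiE_iff)
    have m: "(*) r -` A i \<in> sets lborel" if "i \<in> K" for i
      using measurable_sets[of "(*) r" borel borel "A i"] A[OF that] by simp
    have "emeasure (density (distr (lebesgue_prod K) (lebesgue_prod K) ?S) (\<lambda>_. ennreal (r ^ card K))) (Pi\<^sub>E K A)
       = ennreal (r ^ card K) * emeasure (lebesgue_prod K) (Pi\<^sub>E K (\<lambda>i. (*) r -` A i))"
      using PA by (simp add: emeasure_density_const emeasure_distr vi)
    also have "emeasure (lebesgue_prod K) (Pi\<^sub>E K (\<lambda>i. (*) r -` A i)) = (\<Prod>i\<in>K. emeasure lborel ((*) r -` A i))"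
      using m K by (intro emeasure_PiM) auto
    also have "ennreal (r ^ card K) * (\<Prod>i\<in>K. emeasure lborel ((*) r -` A i))
        = (\<Prod>i\<in>K. ennreal r * emeasure lborel ((*) r -` A i))"
      using r by (simp add: ennreal_power prod.distrib)
    also have "\<dots> = (\<Prod>i\<in>K. emeasure lborel (A i))"
      using A r by (intro prod.cong refl emeasure_lborel_scale_vimage) auto
    finally show "emeasure (density (distr (lebesgue_prod K) (lebesgue_prod K) ?S) (\<lambda>_. ennreal (r ^ card K))) (Pi\<^sub>E K A)
      = (\<Prod>i\<in>K. emeasure lborel (A i))" .
  qed
qed

lemma L2_set_scale:
  assumes "r > 0" shows "L2_set (\<lambda>k\<in>K. r * c k) K = r * L2_set c K"
proof -
  have "L2_set (\<lambda>k\<in>K. r * c k) K = L2_set (\<lambda>k. r * c k) K" by (rule L2_set_cong) auto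
  also have "\<dots> = r * L2_set c K" using assms by (simp add: L2_set_right_distrib)
  finally show ?thesis .
qed

text \<open>Substituting \<open>r * c\<close> for \<open>c\<close> leaves \<open>F\<close> alone,
  because it is homogeneous of degree 0, and turns the ball of radius \<open>r\<close> into the unit
  ball; only the Jacobian remains.\<close>

lemma homogeneous_ball_integral_scale:
  assumes K: "finite K" and r: "r > 0"
    and F[measurable]: "F \<in> borel_measurable (lebesgue_prod K)"
    and hom: "\<And>r c. r > 0 \<Longrightarrow> F (\<lambda>k\<in>K. r * c k) = (F c :: ennreal)"
  shows "(\<integral>\<^sup>+c. F c * indicator {c. L2_set c K \<le> r} c \<partial>lebesgue_prod K)
    = ennreal (r ^ card K) * (\<integral>\<^sup>+c. F c * indicator {c. L2_set c K \<le> 1} c \<partial>lebesgue_prod K)"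
proof -
  note K[measurable]
  let ?S = "\<lambda>c. \<lambda>k\<in>K. r * c k"
  have [measurable]: "?S \<in> measurable (lebesgue_prod K) (lebesgue_prod K)" by measurable
  have "(\<integral>\<^sup>+c. F c * indicator {c. L2_set c K \<le> r} c \<partial>lebesgue_prod K)
    = (\<integral>\<^sup>+c. F c * indicator {c. L2_set c K \<le> r} c
        \<partial>density (distr (lebesgue_prod K) (lebesgue_prod K) ?S) (\<lambda>_. ennreal (r ^ card K)))"
    using lebesgue_prod_scale[OF K r] by simp
  also have "\<dots> = ennreal (r ^ card K) * (\<integral>\<^sup>+c. F (?S c) * indicator {c. L2_set c K \<le> r} (?S c) \<partial>lebesgue_prod K)"
    by (simp add: nn_integral_density nn_integral_distr nn_integral_cmult)
  also have "(\<integral>\<^sup>+c. F (?S c) * indicator {c. L2_set c K \<le> r} (?S c) \<partial>lebesgue_prod K)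
     = (\<integral>\<^sup>+c. F c * indicator {c. L2_set c K \<le> 1} c \<partial>lebesgue_prod K)"
    by (intro nn_integral_cong) (use r hom[OF r] in \<open>auto simp: L2_set_scale[OF r] indicator_def\<close>)
  finally show ?thesis .
qed

lemma abs_le_L2_set:
  assumes "finite K" "k \<in> K" shows "\<bar>c k\<bar> \<le> L2_set c K"
proof -
  have "(c k)\<^sup>2 \<le> (\<Sum>k\<in>K. (c k)\<^sup>2)" using assms by (intro member_le_sum) auto
  then show ?thesis unfolding L2_set_def by (metis real_sqrt_abs real_sqrt_le_iff)
qed

text \<open>The ball lies between the cubes with sides [0, 1/N] and [-1, 1], where N =
  \<open>card K\<close>: the side 1/N keeps the sum of the coordinates, hence the norm, at most 1.
  Positivity and finiteness allow the volume to be cancelled later.\<close>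

lemma emeasure_lebesgue_ball:
  assumes K: "finite K" "K \<noteq> {}"
  shows "emeasure (lebesgue_prod K) {c \<in> PiE K (\<lambda>_. UNIV). L2_set c K \<le> 1} \<noteq> 0"
    and "emeasure (lebesgue_prod K) {c \<in> PiE K (\<lambda>_. UNIV). L2_set c K \<le> 1} \<noteq> \<infinity>"
proof -
  interpret product_sigma_finite "\<lambda>_::nat. lborel :: real measure"
    by (rule product_sigma_finite_lborel)
  let ?B = "{c \<in> PiE K (\<lambda>_. UNIV). L2_set c K \<le> 1}"
  have sp: "space (lebesgue_prod K) = PiE K (\<lambda>_. UNIV)" by (simp add: space_PiM)
  note K(1)[measurable]
  have Bm: "?B \<in> sets (lebesgue_prod K)" unfolding sp[symmetric] using K by measurable
  define a where "a = 1 / real (card K)"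
  have a: "a > 0" "a * card K = 1" using K by (auto simp: a_def card_gt_0_iff)
  have s1: "PiE K (\<lambda>_. {0..a}) \<subseteq> ?B"
  proof (intro subsetI CollectI conjI)
    fix c assume c: "c \<in> PiE K (\<lambda>_. {0..a})"
    then show "c \<in> PiE K (\<lambda>_. UNIV)" by auto
    have "L2_set c K \<le> (\<Sum>k\<in>K. \<bar>c k\<bar>)" by (rule L2_set_le_sum_abs)
    also have "\<dots> \<le> (\<Sum>k\<in>K. a)" using c by (intro sum_mono) (fastforce simp: PiE_iff)
    also have "\<dots> = 1" using a by (simp add: mult.commute)
    finally show "L2_set c K \<le> 1" .
  qed
  have "0 < (\<Prod>i\<in>K. emeasure lborel {0..a})" using a K by (simp add: zero_less_power ennreal_power)
  also have "\<dots> = emeasure (lebesgue_prod K) (PiE K (\<lambda>_. {0..a}))"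
    using K by (intro emeasure_PiM[symmetric]) auto
  also have "\<dots> \<le> emeasure (lebesgue_prod K) ?B" using s1 Bm by (intro emeasure_mono)
  finally show "emeasure (lebesgue_prod K) ?B \<noteq> 0" by simp
  have s2: "?B \<subseteq> PiE K (\<lambda>_. {-1..1})"
  proof
    fix c assume c: "c \<in> ?B"
    have "\<bar>c k\<bar> \<le> 1" if "k \<in> K" for k
    proof -
      show ?thesis using abs_le_L2_set[OF K(1) that, of c] c by auto
    qed
    then have "c k \<in> {-1..1}" if "k \<in> K" for k using that by (fastforce simp: abs_le_iff)
    then show "c \<in> PiE K (\<lambda>_. {-1..1})" using c by (simp add: PiE_iff)
  qed
  have "emeasure (lebesgue_prod K) ?B \<le> emeasure (lebesgue_prod K) (PiE K (\<lambda>_. {-1..1}))"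
    using s2 K by (intro emeasure_mono) auto
  also have "\<dots> = (\<Prod>i\<in>K. emeasure lborel {-1..1::real})"
    using K by (intro emeasure_PiM) auto
  also have "\<dots> < \<infinity>" by (simp add: ennreal_power less_top[symmetric] power_eq_top_ennreal)
  finally show "emeasure (lebesgue_prod K) ?B \<noteq> \<infinity>" by simp
qed

text \<open>Polar coordinates: both sides, as functionals of \<open>\<phi>\<close>, are integrals over measures on the
  line, and homogeneity makes these agree on all half-lines.\<close>

lemma homogeneous_radial_integral:
  assumes K: "finite K" "K \<noteq> {}"
    and F[measurable]: "F \<in> borel_measurable (lebesgue_prod K)"
    and hom: "\<And>r c. r > 0 \<Longrightarrow> F (\<lambda>k\<in>K. r * c k) = (F c :: ennreal)"
    and fin: "(\<integral>\<^sup>+c. F c * indicator {c. L2_set c K \<le> 1} c \<partial>lebesgue_prod K) < \<infinity>"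
    and \<phi>[measurable]: "\<phi> \<in> borel_measurable borel"
  shows "(\<integral>\<^sup>+c. F c * \<phi> (L2_set c K) \<partial>lebesgue_prod K)
            * (\<integral>\<^sup>+c. indicator {c. L2_set c K \<le> 1} c \<partial>lebesgue_prod K)
    = (\<integral>\<^sup>+c. F c * indicator {c. L2_set c K \<le> 1} c \<partial>lebesgue_prod K)
            * (\<integral>\<^sup>+c. \<phi> (L2_set c K) \<partial>lebesgue_prod K)"
proof -
  note K(1)[measurable]
  let ?L = "lebesgue_prod K"
  define vF where "vF = (\<integral>\<^sup>+c. F c * indicator {c. L2_set c K \<le> 1} c \<partial>?L)"
  define v1 where "v1 = (\<integral>\<^sup>+c. indicator {c. L2_set c K \<le> 1} c \<partial>?L)"
  have sp: "space ?L = PiE K (\<lambda>_. UNIV)" by (simp add: space_PiM)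
  have v1': "v1 = emeasure ?L {c \<in> PiE K (\<lambda>_. UNIV). L2_set c K \<le> 1}"
    unfolding v1_def sp[symmetric]
    by (subst nn_integral_indicator[symmetric], measurable)
      (intro nn_integral_cong, auto simp: indicator_def)
  have v1: "v1 \<noteq> 0" "v1 \<noteq> \<infinity>" using emeasure_lebesgue_ball[OF K] by (simp_all add: v1')
  have vF: "vF \<noteq> \<infinity>" using fin by (simp add: vF_def)
  \<comment> \<open>The weights \<open>v1\<close> and \<open>vF\<close> are cross-multiplied instead
    of divided out, so that both push-forwards under the norm give the same mass
    \<open>v1 * vF * r ^ card K\<close> to the half-line up to \<open>r\<close>.\<close>
  define \<mu> where "\<mu> = distr (density ?L (\<lambda>c. F c * v1)) borel (\<lambda>c. L2_set c K)"
  define \<nu> where "\<nu> = distr (density ?L (\<lambda>c. vF)) borel (\<lambda>c. L2_set c K)"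
  have emu: "emeasure \<mu> {..r} = v1 * (\<integral>\<^sup>+c. F c * indicator {c. L2_set c K \<le> r} c \<partial>?L)" for r
  proof -
    have "emeasure \<mu> {..r} = (\<integral>\<^sup>+c. F c * v1 * indicator ((\<lambda>c. L2_set c K) -` {..r} \<inter> space ?L) c \<partial>?L)"
      unfolding \<mu>_def by (subst emeasure_distr) (auto simp: emeasure_density)
    also have "\<dots> = (\<integral>\<^sup>+c. v1 * (F c * indicator {c. L2_set c K \<le> r} c) \<partial>?L)"
      by (intro nn_integral_cong) (auto simp: indicator_def mult_ac)
    also have "\<dots> = v1 * (\<integral>\<^sup>+c. F c * indicator {c. L2_set c K \<le> r} c \<partial>?L)"
      by (subst nn_integral_cmult) auto
    finally show ?thesis .
  qed
  have enu: "emeasure \<nu> {..r} = vF * (\<integral>\<^sup>+c. indicator {c. L2_set c K \<le> r} c \<partial>?L)" for r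
  proof -
    have "emeasure \<nu> {..r} = (\<integral>\<^sup>+c. vF * indicator ((\<lambda>c. L2_set c K) -` {..r} \<inter> space ?L) c \<partial>?L)"
      unfolding \<nu>_def by (subst emeasure_distr) (auto simp: emeasure_density)
    also have "\<dots> = (\<integral>\<^sup>+c. vF * (indicator {c. L2_set c K \<le> r} c) \<partial>?L)"
      by (intro nn_integral_cong) (auto simp: indicator_def mult_ac)
    also have "\<dots> = vF * (\<integral>\<^sup>+c. indicator {c. L2_set c K \<le> r} c \<partial>?L)"
      by (subst nn_integral_cmult) auto
    finally show ?thesis .
  qed
  have pos: "emeasure \<mu> {..r} = v1 * vF * ennreal (r ^ card K)"
     "emeasure \<nu> {..r} = v1 * vF * ennreal (r ^ card K)" if "r > 0" for r
    using homogeneous_ball_integral_scale[OF K(1) that F hom]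
      homogeneous_ball_integral_scale[OF K(1) that, of "\<lambda>_. 1"]
    by (simp_all add: emu enu vF_def v1_def mult_ac)
  \<comment> \<open>For \<open>r \<le> 0\<close> the homogeneity formula says nothing. The mass is
    squeezed by that of \<open>{..t}\<close> as t decreases to 0, which tends to 0 because
    \<open>K\<close> is nonempty.\<close>
  have zero: "emeasure N {..r} = 0" if N: "\<And>r. r > 0 \<Longrightarrow> emeasure N {..r} = v1 * vF * ennreal (r ^ card K)"
    and r: "r \<le> 0" and s: "sets N = sets borel" for N r
  proof -
    define C where "C = enn2real (v1 * vF)"
    have C: "v1 * vF = ennreal C" using v1 vF by (simp add: C_def ennreal_enn2real_if ennreal_mult_eq_top_iff)
    have "((\<lambda>t. ennreal (C * t ^ card K)) \<longlongrightarrow> ennreal (C * 0 ^ card K)) (at_right 0)"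
      by (intro tendsto_ennrealI tendsto_intros)
    moreover have "\<forall>\<^sub>F t in at_right (0::real). emeasure N {..r} \<le> ennreal (C * t ^ card K)"
      unfolding eventually_at_right_field
    proof (intro exI[of _ 1] conjI allI impI)
      fix t :: real assume t: "0 < t" "t < 1"
      have "emeasure N {..r} \<le> emeasure N {..t}" using r t s by (intro emeasure_mono) auto
      also have "\<dots> = ennreal (C * t ^ card K)" 
        unfolding N[OF t(1)] C by (rule ennreal_mult'[symmetric]) (simp add: C_def)
      finally show "emeasure N {..r} \<le> ennreal (C * t ^ card K)" .
    qed simp
    ultimately have "emeasure N {..r} \<le> ennreal (C * 0 ^ card K)"
      by (rule tendsto_lowerbound) simp
    moreover have "(0::real) ^ card K = 0" using K by (simp add: card_gt_0_iff)
    ultimately show ?thesis by simp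
  qed
  have eq: "emeasure \<mu> {..r} = emeasure \<nu> {..r}" for r
    using pos[of r] zero[of \<mu> r, OF pos(1)] zero[of \<nu> r, OF pos(2)]
    by (cases "r > 0") (auto simp: \<mu>_def \<nu>_def)
  have "\<mu> = \<nu>"
  proof (rule measure_eqI_generator_eq[where E = "range (\<lambda>r. {..r})" and \<Omega> = UNIV and A = "\<lambda>n. {..real n + 1}"])
    show "Int_stable (range (\<lambda>r::real. {..r}))" by (auto simp: Int_stable_def)
    show "range (\<lambda>r::real. {..r}) \<subseteq> Pow UNIV" by auto
    show "sets \<mu> = sigma_sets UNIV (range (\<lambda>r::real. {..r}))"
      "sets \<nu> = sigma_sets UNIV (range (\<lambda>r::real. {..r}))"
      unfolding \<mu>_def \<nu>_def by (simp_all add: borel_eq_atMost)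
    show "range (\<lambda>n. {..real n + 1}) \<subseteq> range (\<lambda>r. {..r})" by auto
    show "(\<Union>n. {..real n + 1}) = UNIV"
    proof safe
      fix x :: real
      obtain n where "x \<le> real n" using real_arch_simple by blast
      then show "x \<in> (\<Union>n. {..real n + 1})" by (auto intro!: exI[of _ n])
    qed simp
    show "emeasure \<mu> {..real n + 1} \<noteq> \<infinity>" for n
      using pos(1)[of "real n + 1"] v1 vF by (simp add: ennreal_mult_eq_top_iff)
  qed (use eq in auto)
  then have "integral\<^sup>N \<mu> \<phi> = integral\<^sup>N \<nu> \<phi>" by simp
  moreover have "integral\<^sup>N \<mu> \<phi> = v1 * (\<integral>\<^sup>+c. F c * \<phi> (L2_set c K) \<partial>?L)"
    unfolding \<mu>_def by (simp add: nn_integral_distr nn_integral_density mult_ac nn_integral_cmult[symmetric])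
  moreover have "integral\<^sup>N \<nu> \<phi> = vF * (\<integral>\<^sup>+c. \<phi> (L2_set c K) \<partial>?L)"
    unfolding \<nu>_def by (simp add: nn_integral_distr nn_integral_density nn_integral_cmult)
  ultimately show ?thesis by (simp add: vF_def v1_def mult_ac)
qed

section \<open>Standard Gaussian vectors\<close>

definition gaussian_prod :: "nat set \<Rightarrow> (nat \<Rightarrow> real) measure" where
  "gaussian_prod K = PiM K (\<lambda>_. density lborel (\<lambda>t. ennreal (std_normal_density t)))"

lemma prob_space_std_normal: "prob_space (density lborel (\<lambda>t. ennreal (std_normal_density t)))"
  using prob_space_normal_density[of 1 0] by simp

lemma prob_space_gaussian_prod: "prob_space (gaussian_prod K)"
  unfolding gaussian_prod_def by (intro prob_space_PiM prob_space_std_normal)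

lemma sets_gaussian_prod [measurable_cong]: "sets (gaussian_prod K) = sets (PiM K (\<lambda>_. borel))"
  unfolding gaussian_prod_def by (intro sets_PiM_cong) auto

text \<open>The exponential turns the product of the one-dimensional densities into a function of
  the norm alone. This radial form is what makes polar coordinates applicable to Gaussian
  integrals.\<close>

lemma gaussian_prod_eq_density:
  assumes K: "finite K"
  shows "gaussian_prod K = density (lebesgue_prod K)
     (\<lambda>c. ennreal ((1 / sqrt (2 * pi)) ^ card K * exp (- (L2_set c K)\<^sup>2 / 2)))"
proof -
  interpret product_sigma_finite "\<lambda>_::nat. lborel :: real measure"
    by (rule product_sigma_finite_lborel)
  interpret N: prob_space "density lborel (\<lambda>t. ennreal (std_normal_density t))"
    by (rule prob_space_std_normal)
  interpret G: product_sigma_finite "\<lambda>_::nat. density lborel (\<lambda>t. ennreal (std_normal_density t))"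
    by standard
  have prod: "ennreal ((1 / sqrt (2 * pi)) ^ card K * exp (- (L2_set c K)\<^sup>2 / 2))
      = (\<Prod>k\<in>K. ennreal (std_normal_density (c k)))" for c
  proof -
    have "(L2_set c K)\<^sup>2 = (\<Sum>k\<in>K. (c k)\<^sup>2)" by (simp add: L2_set_def sum_nonneg)
    then have "(1 / sqrt (2 * pi)) ^ card K * exp (- (L2_set c K)\<^sup>2 / 2)
      = (\<Prod>k\<in>K. 1 / sqrt (2 * pi) * exp (- (c k)\<^sup>2 / 2))"
      using K by (simp only: prod.distrib prod_constant exp_sum[symmetric])
        (simp add: sum_divide_distrib sum_negf)
    also have "\<dots> = (\<Prod>k\<in>K. std_normal_density (c k))"
      by (simp add: std_normal_density_def)
    finally show ?thesis by (simp add: prod_ennreal)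
  qed
  show ?thesis unfolding gaussian_prod_def prod
  proof (rule sym, rule G.PiM_eqI[OF K])
    show "sets (density (lebesgue_prod K) (\<lambda>c. \<Prod>k\<in>K. ennreal (std_normal_density (c k))))
       = sets (PiM K (\<lambda>_. density lborel (\<lambda>t. ennreal (std_normal_density t))))"
      by (simp, intro sets_PiM_cong) auto
    fix A :: "nat \<Rightarrow> real set"
    assume A: "\<And>i. i \<in> K \<Longrightarrow> A i \<in> sets (density lborel (\<lambda>t. ennreal (std_normal_density t)))"
    have "Pi\<^sub>E K A \<in> sets (lebesgue_prod K)" using A K by (intro sets_PiM_I_finite) auto
    then have "emeasure (density (lebesgue_prod K) (\<lambda>c. \<Prod>k\<in>K. ennreal (std_normal_density (c k)))) (Pi\<^sub>E K A)
      = (\<integral>\<^sup>+c. (\<Prod>k\<in>K. ennreal (std_normal_density (c k))) * indicator (Pi\<^sub>E K A) c \<partial>lebesgue_prod K)"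
      using K by (simp add: emeasure_density)
    also have "\<dots> = (\<integral>\<^sup>+c. (\<Prod>k\<in>K. ennreal (std_normal_density (c k)) * indicator (A k) (c k)) \<partial>lebesgue_prod K)"
    proof (intro nn_integral_cong)
      fix c assume c: "c \<in> space (lebesgue_prod K)"
      have "indicator (Pi\<^sub>E K A) c = (\<Prod>k\<in>K. indicator (A k) (c k) :: ennreal)"
      proof (cases "c \<in> Pi\<^sub>E K A")
        case True then show ?thesis by (simp add: PiE_iff)
      next
        case False
        then obtain k where "k \<in> K" "c k \<notin> A k" using c by (auto simp: space_PiM PiE_iff)
        with K have "(\<Prod>k\<in>K. indicator (A k) (c k) :: ennreal) = 0" by (intro prod_zero) (auto intro!: bexI[of _ k])
        with False show ?thesis by simp
      qed
      then show "(\<Prod>k\<in>K. ennreal (std_normal_density (c k))) * indicator (Pi\<^sub>E K A) c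
         = (\<Prod>k\<in>K. ennreal (std_normal_density (c k)) * indicator (A k) (c k))"
        by (simp add: prod.distrib)
    qed
    also have "\<dots> = (\<Prod>k\<in>K. \<integral>\<^sup>+t. ennreal (std_normal_density t) * indicator (A k) t \<partial>lborel)"
      using K A by (intro product_nn_integral_prod) auto
    also have "\<dots> = (\<Prod>k\<in>K. emeasure (density lborel (\<lambda>t. ennreal (std_normal_density t))) (A k))"
      using A by (intro prod.cong refl) (simp add: emeasure_density)
    finally show "emeasure (density (lebesgue_prod K) (\<lambda>c. \<Prod>k\<in>K. ennreal (std_normal_density (c k)))) (Pi\<^sub>E K A)
      = (\<Prod>k\<in>K. emeasure (density lborel (\<lambda>t. ennreal (std_normal_density t))) (A k))" .
  qed
qed

lemma gaussian_prod_component: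
  assumes "k \<in> K" 
  shows "distr (gaussian_prod K) borel (\<lambda>c. c k) = density lborel (\<lambda>t. ennreal (std_normal_density t))"
proof -
  have "distr (gaussian_prod K) (density lborel (\<lambda>t. ennreal (std_normal_density t))) (\<lambda>c. c k)
    = density lborel (\<lambda>t. ennreal (std_normal_density t))"
    unfolding gaussian_prod_def using assms by (intro distr_PiM_component prob_space_std_normal) auto
  moreover have "distr (gaussian_prod K) (density lborel (\<lambda>t. ennreal (std_normal_density t))) (\<lambda>c. c k)
     = distr (gaussian_prod K) borel (\<lambda>c. c k)"
    by (intro distr_cong) auto
  ultimately show ?thesis by simp
qed

text \<open>The coordinates are independent standard normal variables, and the variances of
  independent normal variables add. A nonempty index set with nonzero coefficients keeps every
  variance positive.\<close>

lemma gaussian_prod_linear: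
  assumes K: "finite K" and v: "\<And>k. k \<in> J \<Longrightarrow> v k \<noteq> 0" and J: "J \<subseteq> K" "J \<noteq> {}"
  shows "distributed (gaussian_prod K) lborel (\<lambda>c. \<Sum>k\<in>J. c k * v k)
     (normal_density 0 (sqrt (\<Sum>k\<in>J. (v k)\<^sup>2)))"
proof -
  interpret prob_space "gaussian_prod K" by (rule prob_space_gaussian_prod)
  have comp[measurable]: "(\<lambda>c. c k) \<in> borel_measurable (gaussian_prod K)" if "k \<in> K" for k
    using that by (subst measurable_cong_sets[OF sets_gaussian_prod refl]) measurable
  have sp: "space (gaussian_prod K) = PiE K (\<lambda>_. UNIV)"
    using sets_eq_imp_space_eq[OF sets_gaussian_prod] by (simp add: space_PiM)
  have "K \<noteq> {}" using J by auto
  have "indep_vars (\<lambda>_. borel) (\<lambda>k c. c k) K"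
  proof (subst indep_vars_iff_distr_eq_PiM'[OF \<open>K \<noteq> {}\<close>])
    have "distr (gaussian_prod K) (PiM K (\<lambda>_. borel)) (\<lambda>x. \<lambda>i\<in>K. x i)
        = distr (gaussian_prod K) (gaussian_prod K) (\<lambda>x. x)"
      using K by (intro distr_cong) (auto simp: sets_gaussian_prod sp PiE_iff extensional_def fun_eq_iff)
    also have "\<dots> = gaussian_prod K" by (rule distr_id)
    also have "\<dots> = PiM K (\<lambda>i. distr (gaussian_prod K) borel (\<lambda>x. x i))"
      by (subst (1) gaussian_prod_def) (intro PiM_cong refl gaussian_prod_component[symmetric])
    finally show "distr (gaussian_prod K) (PiM K (\<lambda>_. borel)) (\<lambda>x. \<lambda>i\<in>K. x i)
        = PiM K (\<lambda>i. distr (gaussian_prod K) borel (\<lambda>x. x i))" .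
  qed (rule comp)
  then have "indep_vars (\<lambda>_. borel) (\<lambda>k c. c k) J" using J(1) by (rule indep_vars_subset)
  then have ind: "indep_vars (\<lambda>_. borel) (\<lambda>k c. c k * v k) J"
    by (rule indep_vars_compose2[where Y = "\<lambda>k t. t * v k"]) auto
  have D: "distributed (gaussian_prod K) lborel (\<lambda>c. c k * v k) (normal_density 0 \<bar>v k\<bar>)" if k: "k \<in> J" for k
  proof -
    have "distributed (gaussian_prod K) lborel (\<lambda>c. c k) (normal_density 0 1)"
      using k J gaussian_prod_component[of k K] comp[of k] unfolding distributed_def
      by (auto simp: distr_cong[OF refl sets_lborel[symmetric] refl])
    from normal_density_affine[OF this _ v[OF k], of 0] show ?thesis by (simp add: mult.commute)
  qed
  from sum_indep_normal[OF finite_subset[OF J(1) K] J(2) ind _ D] v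
  show ?thesis by simp
qed

text \<open>The constant gamma_q of the moment estimate; it enters the final constant
  \<open>C'\<close>.\<close>

definition normal_abs_moment :: "real \<Rightarrow> real" where
  "normal_abs_moment q = (\<integral>t. \<bar>t\<bar> powr q * std_normal_density t \<partial>lborel)"

lemma normal_abs_moment_finite:
  assumes "q \<ge> 0"
  shows "integrable lborel (\<lambda>t. \<bar>t\<bar> powr q * std_normal_density t)"
proof -
  obtain m where m: "q \<le> real m" using real_arch_simple by blast
  show ?thesis
  proof (rule Bochner_Integration.integrable_bound)
    show "integrable lborel (\<lambda>t. std_normal_density t * \<bar>t\<bar> ^ 0 + std_normal_density t * \<bar>t\<bar> ^ m)"
      by (intro Bochner_Integration.integrable_add integrable_std_normal_moment_abs)
    have "\<bar>t\<bar> powr q \<le> 1 + \<bar>t\<bar> ^ m" for t :: real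
    proof (cases "\<bar>t\<bar> \<le> 1")
      case True
      then have "\<bar>t\<bar> powr q \<le> 1" using assms by (intro powr_le1) auto
      then show ?thesis by (simp add: add_increasing2)
    next
      case False
      then have "\<bar>t\<bar> powr q \<le> \<bar>t\<bar> powr real m" using m by (intro powr_mono) auto
      also have "\<dots> = \<bar>t\<bar> ^ m" using False by (intro powr_realpow) auto
      finally show ?thesis by simp
    qed
    from mult_left_mono[OF this, of "std_normal_density _"]
    show "AE t in lborel. norm (\<bar>t\<bar> powr q * std_normal_density t)
       \<le> norm (std_normal_density t * \<bar>t\<bar> ^ 0 + std_normal_density t * \<bar>t\<bar> ^ m)"
      by (intro always_eventually allI)
        (simp add: abs_mult algebra_simps)
  qed measurable
qed

lemma normal_abs_moment_nonneg: "normal_abs_moment q \<ge> 0"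
  unfolding normal_abs_moment_def by (intro Bochner_Integration.integral_nonneg) auto

text \<open>After vanishing coefficients are dropped, the form divided by its standard deviation
  \<sigma> is standard normal, and homogeneity brings out the factor \<sigma>^q. If no coefficient
  is left, both sides are 0.\<close>

lemma gaussian_linear_moment:
  assumes K: "finite K" and q: "q > 0"
  shows "(\<integral>\<^sup>+c. ennreal (\<bar>\<Sum>k\<in>K. c k * v k\<bar> powr q) \<partial>gaussian_prod K)
    = ennreal (normal_abs_moment q * (\<Sum>k\<in>K. (v k)\<^sup>2) powr (q / 2))"
proof -
  interpret prob_space "gaussian_prod K" by (rule prob_space_gaussian_prod)
  define J where "J = {k\<in>K. v k \<noteq> 0}"
  have s1: "(\<Sum>k\<in>K. c k * v k) = (\<Sum>k\<in>J. c k * v k)" for c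
    unfolding J_def using K by (intro sum.mono_neutral_cong_right) auto
  have s2: "(\<Sum>k\<in>K. (v k)\<^sup>2) = (\<Sum>k\<in>J. (v k)\<^sup>2)"
    unfolding J_def using K by (intro sum.mono_neutral_cong_right) auto
  show ?thesis
  proof (cases "J = {}")
    case True then show ?thesis using q by (simp add: s1 s2)
  next
    case False
    define \<sigma> where "\<sigma> = sqrt (\<Sum>k\<in>J. (v k)\<^sup>2)"
    have "(\<Sum>k\<in>J. (v k)\<^sup>2) > 0"
      using False K by (intro sum_pos) (auto simp: J_def)
    then have \<sigma>: "\<sigma> > 0" "\<sigma>\<^sup>2 = (\<Sum>k\<in>J. (v k)\<^sup>2)" by (auto simp: \<sigma>_def)
    have D: "distributed (gaussian_prod K) lborel (\<lambda>c. \<Sum>k\<in>J. c k * v k) (normal_density 0 \<sigma>)"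
      unfolding \<sigma>_def using False by (intro gaussian_prod_linear[OF K]) (auto simp: J_def)
    have D1: "distributed (gaussian_prod K) lborel (\<lambda>c. (\<Sum>k\<in>J. c k * v k) / \<sigma>) std_normal_density"
      using D normal_standard_normal_convert[OF \<sigma>(1), of "\<lambda>c. \<Sum>k\<in>J. c k * v k" 0] by simp
    have "(\<integral>\<^sup>+c. ennreal (\<bar>\<Sum>k\<in>J. c k * v k\<bar> powr q) \<partial>gaussian_prod K)
      = (\<integral>\<^sup>+c. ennreal (\<sigma> powr q * \<bar>(\<Sum>k\<in>J. c k * v k) / \<sigma>\<bar> powr q) \<partial>gaussian_prod K)"
      using \<sigma> by (intro nn_integral_cong) (simp add: powr_mult[symmetric] abs_divide)
    also have "\<dots> = (\<integral>\<^sup>+t. ennreal (std_normal_density t) * ennreal (\<sigma> powr q * \<bar>t\<bar> powr q) \<partial>lborel)"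
      by (rule distributed_nn_integral[OF D1, symmetric]) simp
    also have "\<dots> = (\<integral>\<^sup>+t. ennreal (\<sigma> powr q * (\<bar>t\<bar> powr q * std_normal_density t)) \<partial>lborel)"
      by (intro nn_integral_cong) (simp add: ennreal_mult'[symmetric] mult_ac)
    also have "\<dots> = ennreal (\<sigma> powr q * normal_abs_moment q)"
      unfolding normal_abs_moment_def using q
      by (subst nn_integral_eq_integral) (auto intro!: integrable_mult_right normal_abs_moment_finite)
    also have "\<sigma> powr q = (\<sigma>\<^sup>2) powr (q / 2)"
      using \<sigma>(1) by (simp add: powr_powr flip: powr_numeral)
    finally show ?thesis by (simp add: s1 s2 \<sigma> mult.commute)
  qed
qed

text \<open>The graph of the convex function y^p lies above its tangent at \<open>a\<close>. The
  inequality is arranged without subtraction so that it can be integrated in \<open>ennreal\<close>;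
  the boundary point y = 0 is outside the open half-line of convexity and is treated apart.\<close>

lemma powr_tangent:
  fixes a p y :: real
  assumes "p \<ge> 1" "a > 0" "y \<ge> 0"
  shows "a powr p + p * a powr (p - 1) * y \<le> y powr p + p * a powr p"
proof (cases "y = 0")
  case True
  have "a powr p * 1 \<le> a powr p * p" using assms by (intro mult_left_mono) auto
  then show ?thesis using True assms by (simp add: mult.commute)
next
  case False
  have "((\<lambda>x. x powr p) has_real_derivative p * a powr (p - 1)) (at a within {0<..})"
    using assms by (auto intro!: derivative_eq_intros)
  then have "p * a powr (p - 1) * (y - a) \<le> y powr p - a powr p"
    using assms False powr_convex[OF assms(1)]
    by (intro convex_on_imp_above_tangent[where A = "{0<..}"]) (auto simp: interior_open)
  moreover have "a powr (p - 1) * a = a powr p" using assms by (simp add: powr_mult_base powr_diff)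
  then have "p * a powr (p - 1) * a = p * a powr p" by simp
  ultimately show ?thesis by (simp add: right_diff_distrib)
qed

text \<open>Jensen's inequality for y^(q/2) and the squared norm, whose mean is N =
  \<open>card K\<close>: the tangent inequality at N is integrated and the common finite term
  cancels.\<close>

lemma gaussian_norm_moment:
  assumes K: "finite K" "K \<noteq> {}" and q: "q \<ge> 2"
  shows "ennreal (real (card K) powr (q / 2)) \<le> (\<integral>\<^sup>+c. ennreal (L2_set c K powr q) \<partial>gaussian_prod K)"
proof -
  interpret prob_space "gaussian_prod K" by (rule prob_space_gaussian_prod)
  define N p where "N = real (card K)" and "p = q / 2"
  have N: "N > 0" using K by (simp add: N_def card_gt_0_iff)
  have p: "p \<ge> 1" using q by (simp add: p_def)
  note K(1)[measurable]
  have comp[measurable]: "(\<lambda>c. c k) \<in> borel_measurable (gaussian_prod K)" if "k \<in> K" for k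
    using that by (subst measurable_cong_sets[OF sets_gaussian_prod refl]) measurable
  have L2m[measurable]: "(\<lambda>c. L2_set c K) \<in> borel_measurable (gaussian_prod K)"
    unfolding L2_set_def by measurable
  have sq: "(\<integral>\<^sup>+c. ennreal ((c k)\<^sup>2) \<partial>gaussian_prod K) = 1" if k: "k \<in> K" for k
  proof -
    have "(\<integral>\<^sup>+c. ennreal ((c k)\<^sup>2) \<partial>gaussian_prod K) = (\<integral>\<^sup>+t. ennreal (t\<^sup>2) \<partial>distr (gaussian_prod K) borel (\<lambda>c. c k))"
      using k by (simp add: nn_integral_distr)
    also have "\<dots> = (\<integral>\<^sup>+t. ennreal (std_normal_density t * t\<^sup>2) \<partial>lborel)"
      unfolding gaussian_prod_component[OF k] by (simp add: nn_integral_density ennreal_mult')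
    also have "\<dots> = ennreal (\<integral>t. std_normal_density t * t\<^sup>2 \<partial>lborel)"
      by (intro nn_integral_eq_integral integrable_std_normal_moment) auto
    also have "\<dots> = 1" using integral_std_normal_moment_even[of 1] by simp
    finally show ?thesis .
  qed
  have e2: "(\<integral>\<^sup>+c. ennreal ((L2_set c K)\<^sup>2) \<partial>gaussian_prod K) = ennreal N"
  proof -
    have "(\<integral>\<^sup>+c. ennreal ((L2_set c K)\<^sup>2) \<partial>gaussian_prod K) = (\<integral>\<^sup>+c. (\<Sum>k\<in>K. ennreal ((c k)\<^sup>2)) \<partial>gaussian_prod K)"
      by (intro nn_integral_cong) (simp add: L2_set_def sum_nonneg)
    also have "\<dots> = (\<Sum>k\<in>K. \<integral>\<^sup>+c. ennreal ((c k)\<^sup>2) \<partial>gaussian_prod K)"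
      by (intro nn_integral_sum) auto
    finally show ?thesis using sq by (simp add: N_def ennreal_of_nat_eq_real_of_nat)
  qed
  have "ennreal (N powr p) + ennreal (p * N powr p)
    = (\<integral>\<^sup>+c. ennreal (N powr p) + ennreal (p * N powr (p - 1)) * ennreal ((L2_set c K)\<^sup>2) \<partial>gaussian_prod K)"
  proof -
    have "N powr (p - 1) * N = N powr p" using N by (simp add: powr_diff)
    then have "p * N powr p = p * N powr (p - 1) * N" by simp
    then have "ennreal (p * N powr p) = ennreal (p * N powr (p - 1)) * ennreal N"
      using p N by (simp add: ennreal_mult'[symmetric])
    then show ?thesis using p N
      by (subst nn_integral_add) (auto simp: nn_integral_cmult e2 emeasure_space_1)
  qed
  also have "\<dots> \<le> (\<integral>\<^sup>+c. ennreal (L2_set c K powr q) + ennreal (p * N powr p) \<partial>gaussian_prod K)"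
  proof (intro nn_integral_mono)
    fix c
    have "((L2_set c K)\<^sup>2) powr p = L2_set c K powr q"
      by (cases "L2_set c K = 0") (simp_all add: powr_powr p_def L2_set_nonneg flip: powr_numeral)
    then show "ennreal (N powr p) + ennreal (p * N powr (p - 1)) * ennreal ((L2_set c K)\<^sup>2)
      \<le> ennreal (L2_set c K powr q) + ennreal (p * N powr p)"
      using powr_tangent[OF p N, of "(L2_set c K)\<^sup>2"] p
      by (simp add: ennreal_mult'[symmetric] ennreal_plus[symmetric] del: ennreal_plus)
  qed
  also have "\<dots> = (\<integral>\<^sup>+c. ennreal (L2_set c K powr q) \<partial>gaussian_prod K) + ennreal (p * N powr p)"
    by (simp add: nn_integral_add emeasure_space_1)
  finally have "ennreal (N powr p) + ennreal (p * N powr p)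
     \<le> (\<integral>\<^sup>+c. ennreal (L2_set c K powr q) \<partial>gaussian_prod K) + ennreal (p * N powr p)" .
  then have "ennreal (N powr p) \<le> (\<integral>\<^sup>+c. ennreal (L2_set c K powr q) \<partial>gaussian_prod K)"
    unfolding add.commute[of _ "ennreal (p * N powr p)"] by (simp only: ennreal_add_left_cancel_le) simp
  then show ?thesis by (simp add: N_def p_def)
qed

text \<open>With g Gaussian and \<theta> uniform on the sphere, polar coordinates give E|<g,v>|^q =
  E|<\<theta>,v>|^q E|g|^q. The left side is known exactly and E|g|^q is at least N^(q/2), which
  yields the bound on the middle factor.\<close>

lemma sphere_linear_moment:
  assumes K: "finite K" "K \<noteq> {}" and q: "q \<ge> 2"
  shows "(\<integral>\<^sup>+c. ennreal (\<bar>\<Sum>k\<in>K. c k * v k\<bar> powr q) \<partial>sphere_measure K)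
    \<le> ennreal (normal_abs_moment q * ((\<Sum>k\<in>K. (v k)\<^sup>2) / real (card K)) powr (q / 2))"
proof -
  note K(1)[measurable]
  let ?L = "lebesgue_prod K"
  let ?B = "{c \<in> PiE K (\<lambda>_. UNIV). L2_set c K \<le> 1}"
  \<comment> \<open>The power of the form at the direction of \<open>c\<close>, homogeneous of
    degree 0. At c = 0 division by zero makes it vanish, which agrees with the Gaussian integrand
    there.\<close>
  define F where "F c = ennreal (\<bar>\<Sum>k\<in>K. (c k / L2_set c K) * v k\<bar> powr q)" for c
  have [measurable]: "F \<in> borel_measurable ?L" unfolding F_def by measurable
  have sp: "space ?L = PiE K (\<lambda>_. UNIV)" by (simp add: space_PiM)
  have Bm: "?B \<in> sets ?L" unfolding sp[symmetric] by measurable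
  have hom: "F (\<lambda>k\<in>K. r * c k) = F c" if "r > 0" for r c
  proof -
    have "(\<Sum>k\<in>K. ((\<lambda>k\<in>K. r * c k) k / (r * L2_set c K)) * v k) = (\<Sum>k\<in>K. (c k / L2_set c K) * v k)"
      using that by (intro sum.cong) auto
    then show ?thesis unfolding F_def L2_set_scale[OF that] by simp
  qed
  have Fle: "F c \<le> ennreal ((\<Sum>k\<in>K. \<bar>v k\<bar>) powr q)" for c
  proof -
    have "\<bar>c k / L2_set c K\<bar> \<le> 1" if "k \<in> K" for k
      using abs_le_L2_set[OF K(1) that, of c] by (auto simp: divide_le_eq_1 abs_divide abs_of_nonneg[OF L2_set_nonneg] order_less_le L2_set_nonneg)
    then have "\<bar>(c k / L2_set c K) * v k\<bar> \<le> \<bar>v k\<bar>" if "k \<in> K" for k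
      unfolding abs_mult using that by (intro mult_left_le_one_le) auto
    then have "\<bar>\<Sum>k\<in>K. (c k / L2_set c K) * v k\<bar> \<le> (\<Sum>k\<in>K. \<bar>v k\<bar>)"
      by (intro order_trans[OF sum_abs] sum_mono)
    then show ?thesis unfolding F_def using q by (intro ennreal_leI powr_mono2) auto
  qed
  define vF where "vF = (\<integral>\<^sup>+c. F c * indicator {c. L2_set c K \<le> 1} c \<partial>?L)"
  define v1 where "v1 = (\<integral>\<^sup>+c. indicator {c. L2_set c K \<le> 1} c \<partial>?L)"
  have v1': "v1 = emeasure ?L ?B"
    unfolding v1_def sp[symmetric]
    by (subst nn_integral_indicator[symmetric], measurable)
      (intro nn_integral_cong, auto simp: indicator_def)
  have v1: "v1 \<noteq> 0" "v1 \<noteq> \<infinity>" using emeasure_lebesgue_ball[OF K] by (simp_all add: v1')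
  have "vF \<le> (\<integral>\<^sup>+c. ennreal ((\<Sum>k\<in>K. \<bar>v k\<bar>) powr q) * indicator {c. L2_set c K \<le> 1} c \<partial>?L)"
    unfolding vF_def by (intro nn_integral_mono mult_right_mono Fle) auto
  also have "\<dots> = ennreal ((\<Sum>k\<in>K. \<bar>v k\<bar>) powr q) * v1"
    unfolding v1_def by (intro nn_integral_cmult) measurable
  also have "\<dots> < \<infinity>" using v1 by (simp add: ennreal_mult_less_top top.not_eq_extremum)
  finally have vF: "vF < \<infinity>" .
  let ?I = "\<integral>\<^sup>+c. ennreal (\<bar>\<Sum>k\<in>K. c k * v k\<bar> powr q) \<partial>sphere_measure K"
  have I: "?I = vF / v1"
  proof -
    have "?I = (\<integral>\<^sup>+c. ennreal (\<bar>\<Sum>k\<in>K. (\<lambda>k\<in>K. c k / L2_set c K) k * v k\<bar> powr q) \<partial>uniform_measure ?L ?B)"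
      unfolding sphere_measure_def by (subst nn_integral_distr) auto
    also have "\<dots> = (\<integral>\<^sup>+c. F c \<partial>uniform_measure ?L ?B)"
      by (intro nn_integral_cong) (auto simp: F_def)
    also have "\<dots> = (\<integral>\<^sup>+c. F c * indicator ?B c \<partial>?L) / emeasure ?L ?B"
      using Bm by (intro nn_integral_uniform_measure) auto
    also have "(\<integral>\<^sup>+c. F c * indicator ?B c \<partial>?L) = vF"
      unfolding vF_def by (intro nn_integral_cong) (auto simp: indicator_def sp)
    finally show ?thesis by (simp add: v1')
  qed
  define g where "g r = ennreal ((1 / sqrt (2 * pi)) ^ card K * exp (- r\<^sup>2 / 2))" for r :: real
  \<comment> \<open>The Gaussian density times r^q: integrated together with \<open>F\<close> it
    gives the Gaussian moment of the form, integrated alone that of the norm.\<close>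
  define \<phi> where "\<phi> r = g r * ennreal (r powr q)" for r
  have [measurable]: "g \<in> borel_measurable borel" "\<phi> \<in> borel_measurable borel"
    unfolding \<phi>_def g_def by measurable
  have dens: "gaussian_prod K = density ?L (\<lambda>c. g (L2_set c K))"
    unfolding g_def by (rule gaussian_prod_eq_density[OF K(1)])
  have eq1: "(\<integral>\<^sup>+c. \<phi> (L2_set c K) \<partial>?L) = (\<integral>\<^sup>+c. ennreal (L2_set c K powr q) \<partial>gaussian_prod K)"
    unfolding dens \<phi>_def by (subst nn_integral_density) auto
  have eq2: "(\<integral>\<^sup>+c. F c * \<phi> (L2_set c K) \<partial>?L) = (\<integral>\<^sup>+c. ennreal (\<bar>\<Sum>k\<in>K. c k * v k\<bar> powr q) \<partial>gaussian_prod K)"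
  proof -
    have *: "F c * ennreal (L2_set c K powr q) = ennreal (\<bar>\<Sum>k\<in>K. c k * v k\<bar> powr q)" for c
    proof (cases "L2_set c K = 0")
      case True
      then have "c k = 0" if "k \<in> K" for k using that K by (simp add: L2_set_eq_0_iff)
      then show ?thesis using q by (simp add: F_def)
    next
      case False
      then have pos: "L2_set c K > 0" using L2_set_nonneg[of c K] by linarith
      have "(\<Sum>k\<in>K. (c k / L2_set c K) * v k) = (\<Sum>k\<in>K. c k * v k) / L2_set c K"
        by (simp add: sum_divide_distrib)
      then show ?thesis using pos unfolding F_def
        by (simp add: ennreal_mult'[symmetric] powr_divide abs_divide)
    qed
    show ?thesis unfolding dens
      by (subst nn_integral_density) (auto intro!: nn_integral_cong simp: \<phi>_def *[symmetric] mult_ac)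
  qed
  have key: "(\<integral>\<^sup>+c. ennreal (\<bar>\<Sum>k\<in>K. c k * v k\<bar> powr q) \<partial>gaussian_prod K) * v1
      = vF * (\<integral>\<^sup>+c. ennreal (L2_set c K powr q) \<partial>gaussian_prod K)"
    using homogeneous_radial_integral[OF K _ hom, of \<phi>] vF
    unfolding vF_def[symmetric] v1_def[symmetric] eq1 eq2 by simp
  define N p A where "N = real (card K)" and "p = q / 2" and "A = normal_abs_moment q * (\<Sum>k\<in>K. (v k)\<^sup>2) powr p"
  have N: "N > 0" using K by (simp add: N_def card_gt_0_iff)
  have A: "(\<integral>\<^sup>+c. ennreal (\<bar>\<Sum>k\<in>K. c k * v k\<bar> powr q) \<partial>gaussian_prod K) = ennreal A"
    unfolding A_def p_def using q by (intro gaussian_linear_moment[OF K(1)]) auto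
  have A0: "A \<ge> 0" unfolding A_def using normal_abs_moment_nonneg[of q] by (simp add: less_imp_le)
  have "vF * ennreal (N powr p) \<le> vF * (\<integral>\<^sup>+c. ennreal (L2_set c K powr q) \<partial>gaussian_prod K)"
    unfolding N_def p_def by (intro mult_left_mono gaussian_norm_moment[OF K q]) auto
  also have "\<dots> = ennreal A * v1" using key A by simp
  finally have le: "vF * ennreal (N powr p) \<le> ennreal A * v1" .
  obtain a b where ab: "vF = ennreal a" "v1 = ennreal b" "a \<ge> 0" "b > 0"
    using vF v1 by (cases vF; cases v1) (auto simp: less_le)
  have "a * N powr p \<le> A * b" using le ab A0 by (simp add: ennreal_mult'[symmetric] ennreal_mult[symmetric])
  then have "a / b \<le> A / N powr p" using ab N by (simp add: divide_simps mult.commute)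
  also have "A / N powr p = normal_abs_moment q * ((\<Sum>k\<in>K. (v k)\<^sup>2) / real (card K)) powr (q / 2)"
    using N unfolding A_def by (simp add: powr_divide sum_nonneg N_def p_def)
  finally show ?thesis unfolding I ab using ab by (simp add: divide_ennreal ennreal_leI)
qed

section \<open>Polynomial approximation of the Poisson kernel\<close>

fun chebyshev_poly :: "nat \<Rightarrow> real poly" where
  "chebyshev_poly 0 = 1"
| "chebyshev_poly (Suc 0) = [:0, 1:]"
| "chebyshev_poly (Suc (Suc n)) = [:0, 2:] * chebyshev_poly (Suc n) - chebyshev_poly n"

lemma degree_chebyshev_poly: "degree (chebyshev_poly n) \<le> n"
proof (induction n rule: chebyshev_poly.induct)
  case (3 n)
  have "degree ([:0, 2:] * chebyshev_poly (Suc n)) \<le> Suc (Suc n)"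
    using degree_mult_le[of "[:0, 2:]" "chebyshev_poly (Suc n)"] 3 by simp
  then show ?case using 3 by (auto intro!: degree_diff_le)
qed auto

lemma chebyshev_poly_cos: "poly (chebyshev_poly n) (cos t) = cos (real n * t)"
proof (induction n rule: chebyshev_poly.induct)
  case (3 n)
  have "cos (real (Suc (Suc n)) * t) + cos (real n * t) = 2 * cos t * cos (real (Suc n) * t)"
    using cos_times_cos[of t "real (Suc n) * t"] cos_minus[of "real n * t"]
    by (simp add: algebra_simps)
  then show ?case using 3 by simp
qed auto

text \<open>To the right of 1 the growth is exponential in \<open>n\<close>. Dividing by such a
  value is what makes the residual of the approximation exponentially small.\<close>

lemma chebyshev_poly_cosh: "poly (chebyshev_poly n) (cosh t) = cosh (real n * t)"
proof (induction n rule: chebyshev_poly.induct)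
  case (3 n)
  have "cosh (real (Suc (Suc n)) * t) = cosh (real (Suc n) * t + t)"
    "cosh (real n * t) = cosh (real (Suc n) * t - t)"
    by (simp_all add: algebra_simps)
  then have "cosh (real (Suc (Suc n)) * t) + cosh (real n * t) = 2 * cosh t * cosh (real (Suc n) * t)"
    by (simp only: cosh_add cosh_diff) simp
  then show ?case using 3 by simp
qed auto

lemma abs_chebyshev_poly_le:
  assumes "\<bar>x\<bar> \<le> 1" shows "\<bar>poly (chebyshev_poly n) x\<bar> \<le> 1"
  using chebyshev_poly_cos[of n "arccos x"] assms by (simp add: cos_arccos_abs)

text \<open>With s^2 = \<delta> this gives \<open>cosh s - 2 * w \<le> 1\<close> for all
  \<open>w \<ge> \<delta>\<close>, so the shifted argument of the Chebyshev polynomial stays in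
  [-1, 1].\<close>

lemma cosh_le_quadratic:
  fixes s :: real assumes "0 \<le> s" "s \<le> 1" shows "cosh s \<le> 1 + s\<^sup>2"
proof -
  have "exp s \<le> 1 + s + s\<^sup>2" using assms by (rule exp_bound)
  moreover have "exp (- s) \<le> 1 - s + s\<^sup>2"
  proof -
    have "1 \<le> (1 - s + s\<^sup>2) * (1 + s)" using assms
      by (simp add: algebra_simps power2_eq_square)
    also have "\<dots> \<le> (1 - s + s\<^sup>2) * exp s"
      using assms by (intro mult_left_mono) auto
    finally show ?thesis by (simp add: exp_minus field_simps)
  qed
  ultimately show ?thesis by (simp add: cosh_field_def)
qed

text \<open>The residual of the approximation is a Chebyshev polynomial in
  \<open>w = ((t - a)\<^sup>2 + \<eta>\<^sup>2) / B\<close>, shifted so that \<open>[\<eta>\<^sup>2 / B, 1]\<close> lands in \<open>[-1, 1]\<close> and \<open>0\<close> outside.\<close>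

lemma poisson_kernel_approx:
  fixes a \<eta> B :: real
  assumes \<eta>: "\<eta> > 0" "\<eta> \<le> sqrt B" and m: "m \<ge> 1"
  obtains Q :: "real poly" where "degree Q \<le> 2 * (m - 1)"
    "\<And>t. (t - a)\<^sup>2 + \<eta>\<^sup>2 \<le> B \<Longrightarrow>
       \<bar>\<eta>\<^sup>2 / ((t - a)\<^sup>2 + \<eta>\<^sup>2) - poly Q t\<bar> \<le> 2 * exp (- (real m * \<eta> / sqrt B))"
proof -
  have B: "B > 0" using \<eta> by (metis less_le_trans real_sqrt_gt_0_iff)
  define s \<delta> where "s = \<eta> / sqrt B" and "\<delta> = \<eta>\<^sup>2 / B"
  have s: "0 < s" "s \<le> 1" "s\<^sup>2 = \<delta>" using \<eta> B by (auto simp: s_def \<delta>_def power_divide)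
  have \<delta>: "\<delta> > 0" using s by auto
  \<comment> \<open>Normalized so that r(0) = 1. Then 1 - r is divisible by w, the quotient q
    approximates 1/w, and the error of \<delta> q against the Poisson kernel \<delta>/w is exactly
    (\<delta>/w) r(w), where \<delta>/w is at most 1.\<close>
  define r where "r = smult (1 / cosh (real m * s)) (chebyshev_poly m \<circ>\<^sub>p [:cosh s, -2:])"
  have deg_r: "degree r \<le> m"
    unfolding r_def using degree_chebyshev_poly[of m]
    by (simp add: degree_pcompose)
  have ch: "cosh (real m * s) > 0" by (rule cosh_real_pos)
  have "poly r 0 = 1" using ch by (simp add: r_def poly_pcompose chebyshev_poly_cosh)
  then have "poly (1 - r) 0 = 0" by simp
  then obtain q where q: "1 - r = [:0, 1:] * q" by (metis poly_eq_0_iff_dvd dvdE minus_zero)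
  have deg_q: "degree q \<le> m - 1"
  proof (cases "q = 0")
    case False
    have "Suc (degree q) = degree (1 - r)" unfolding q using False by (simp add: degree_mult_eq)
    also have "\<dots> \<le> m" using deg_r by (intro degree_diff_le) auto
    finally show ?thesis by simp
  qed simp
  define W where "W = [: (a\<^sup>2 + \<eta>\<^sup>2) / B, - 2 * a / B, 1 / B :]"
  have W: "poly W t = ((t - a)\<^sup>2 + \<eta>\<^sup>2) / B" for t
    using B by (simp add: W_def field_simps power2_eq_square)
  define Q where "Q = smult \<delta> (q \<circ>\<^sub>p W)"
  have "degree Q \<le> degree q * degree W" unfolding Q_def by (simp add: degree_pcompose)
  also have "\<dots> \<le> (m - 1) * 2" using deg_q unfolding W_def by (intro mult_mono) auto
  finally have "degree Q \<le> 2 * (m - 1)" by simp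
  moreover have "\<bar>\<eta>\<^sup>2 / ((t - a)\<^sup>2 + \<eta>\<^sup>2) - poly Q t\<bar> \<le> 2 * exp (- (real m * \<eta> / sqrt B))"
    if t: "(t - a)\<^sup>2 + \<eta>\<^sup>2 \<le> B" for t
  proof -
    define w where "w = ((t - a)\<^sup>2 + \<eta>\<^sup>2) / B"
    have w: "\<delta> \<le> w" "w \<le> 1" using t B by (auto simp: w_def \<delta>_def divide_simps)
    have "poly (1 - r) w = w * poly q w" unfolding q by simp
    then have qw: "poly q w = (1 - poly r w) / w" using w \<delta> by (simp add: field_simps)
    have "\<eta>\<^sup>2 / ((t - a)\<^sup>2 + \<eta>\<^sup>2) = \<delta> / w" using B by (simp add: \<delta>_def w_def)
    moreover have "poly Q t = \<delta> * poly q w" by (simp add: Q_def poly_pcompose W w_def)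
    ultimately have "\<eta>\<^sup>2 / ((t - a)\<^sup>2 + \<eta>\<^sup>2) - poly Q t = \<delta> / w * poly r w"
      using w \<delta> by (simp add: qw field_simps)
    also have "\<bar>\<dots>\<bar> \<le> 1 * \<bar>poly r w\<bar>"
      unfolding abs_mult using w \<delta> by (intro mult_right_mono) auto
    also have "\<bar>poly r w\<bar> = \<bar>poly (chebyshev_poly m) (cosh s - 2 * w)\<bar> / cosh (real m * s)"
      using ch by (simp add: r_def poly_pcompose algebra_simps abs_divide)
    also have "\<dots> \<le> 1 / cosh (real m * s)"
    proof (intro divide_right_mono abs_chebyshev_poly_le)
      show "\<bar>cosh s - 2 * w\<bar> \<le> 1"
        using cosh_le_quadratic[of s] s w \<delta> cosh_real_ge_1[of s] by (auto simp: abs_le_iff)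
    qed (use ch in auto)
    also have "\<dots> \<le> 2 * exp (- (real m * s))"
    proof -
      have "exp (real m * s) \<le> 2 * cosh (real m * s)" by (simp add: cosh_field_def)
      then show ?thesis using ch by (simp add: exp_minus field_simps)
    qed
    finally show ?thesis by (simp add: s_def)
  qed
  ultimately show thesis by (rule that)
qed

section \<open>Rooted graphs\<close>

definition locally_finite :: "'a graph \<Rightarrow> bool" where
  "locally_finite G \<longleftrightarrow> (\<forall>y\<in>verts G. finite (neighbours G y))"

lemma rooted_iso_refl: "g \<simeq>\<^sub>r g"
  unfolding rooted_iso_def by (intro exI[of _ id]) auto

lemma rooted_iso_sym:
  assumes "g \<simeq>\<^sub>r g'" and root: "snd g \<in> verts (fst g)" shows "g' \<simeq>\<^sub>r g"
proof -
  obtain f where f: "bij_betw f (verts (fst g)) (verts (fst g'))" "f (snd g) = snd g'"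
     and e: "\<And>u v. u \<in> verts (fst g) \<Longrightarrow> v \<in> verts (fst g) \<Longrightarrow>
        (u, v) \<in> edges (fst g) \<longleftrightarrow> (f u, f v) \<in> edges (fst g')"
    using assms(1) unfolding rooted_iso_def by blast
  define i where "i = inv_into (verts (fst g)) f"
  have i: "bij_betw i (verts (fst g')) (verts (fst g))" unfolding i_def by (rule bij_betw_inv_into[OF f(1)])
  have fi: "f (i u) = u" if "u \<in> verts (fst g')" for u
    unfolding i_def using that f(1) by (rule bij_betw_inv_into_right[rotated])
  have "i (snd g') = snd g"
    unfolding i_def f(2)[symmetric] by (rule bij_betw_inv_into_left[OF f(1) root])
  moreover have "(u, v) \<in> edges (fst g') \<longleftrightarrow> (i u, i v) \<in> edges (fst g)"
    if "u \<in> verts (fst g')" "v \<in> verts (fst g')" for u v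
    using e[of "i u" "i v"] fi that bij_betwE[OF i] by simp
  ultimately show ?thesis unfolding rooted_iso_def using i by blast
qed

lemma rooted_iso_trans:
  assumes "g \<simeq>\<^sub>r g'" "g' \<simeq>\<^sub>r g''" shows "g \<simeq>\<^sub>r g''"
proof -
  obtain f where f: "bij_betw f (verts (fst g)) (verts (fst g'))" "f (snd g) = snd g'"
     and e: "\<And>u v. u \<in> verts (fst g) \<Longrightarrow> v \<in> verts (fst g) \<Longrightarrow>
        (u, v) \<in> edges (fst g) \<longleftrightarrow> (f u, f v) \<in> edges (fst g')"
    using assms(1) unfolding rooted_iso_def by blast
  obtain f' where f': "bij_betw f' (verts (fst g')) (verts (fst g''))" "f' (snd g') = snd g''"
     and e': "\<And>u v. u \<in> verts (fst g') \<Longrightarrow> v \<in> verts (fst g') \<Longrightarrow>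
        (u, v) \<in> edges (fst g') \<longleftrightarrow> (f' u, f' v) \<in> edges (fst g'')"
    using assms(2) unfolding rooted_iso_def by blast
  show ?thesis unfolding rooted_iso_def
    using bij_betw_trans[OF f(1) f'(1)] f(2) f'(2) e e' bij_betwE[OF f(1)]
    by (intro exI[of _ "f' \<circ> f"]) auto
qed

lemma neighbours_image:
  assumes G: "simple_graph G" and G': "simple_graph G'"
    and f: "bij_betw f (verts G) (verts G')"
    and e: "\<And>u v. u \<in> verts G \<Longrightarrow> v \<in> verts G \<Longrightarrow> (u, v) \<in> edges G \<longleftrightarrow> (f u, f v) \<in> edges G'"
    and y: "y \<in> verts G"
  shows "neighbours G' (f y) = f ` neighbours G y"
proof -
  have "z \<in> f ` neighbours G y" if "(f y, z) \<in> edges G'" for z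
  proof -
    have "z \<in> verts G'" using that G' by (auto simp: simple_graph_def)
    then obtain u where "u \<in> verts G" "z = f u" using f by (auto simp: bij_betw_def)
    then show ?thesis using that e y by (auto simp: neighbours_def)
  qed
  moreover have "f z \<in> neighbours G' (f y)" if "(y, z) \<in> edges G" for z
    using that e[OF y, of z] G by (auto simp: neighbours_def simple_graph_def)
  ultimately show ?thesis by (auto simp: neighbours_def)
qed

lemma neighbours_subset: "simple_graph G \<Longrightarrow> neighbours G y \<subseteq> verts G"
  by (auto simp: neighbours_def simple_graph_def)

lemma relpow_image:
  assumes G: "simple_graph G" and G': "simple_graph G'"
    and f: "bij_betw f (verts G) (verts G')"
    and e: "\<And>u v. u \<in> verts G \<Longrightarrow> v \<in> verts G \<Longrightarrow> (u, v) \<in> edges G \<longleftrightarrow> (f u, f v) \<in> edges G'"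
    and x: "x \<in> verts G" and y: "y \<in> verts G"
  shows "(x, y) \<in> edges G ^^ k \<longleftrightarrow> (f x, f y) \<in> edges G' ^^ k"
  using y
proof (induction k arbitrary: y)
  case 0
  then show ?case using f x by (auto simp: bij_betw_def inj_on_def)
next
  case (Suc k)
  show ?case
  proof
    assume "(x, y) \<in> edges G ^^ Suc k"
    then obtain z where z: "(x, z) \<in> edges G ^^ k" "(z, y) \<in> edges G" by auto
    moreover have "z \<in> verts G" using z G by (auto simp: simple_graph_def)
    ultimately show "(f x, f y) \<in> edges G' ^^ Suc k" using Suc e by auto
  next
    assume "(f x, f y) \<in> edges G' ^^ Suc k"
    then obtain w where w: "(f x, w) \<in> edges G' ^^ k" "(w, f y) \<in> edges G'" by auto
    then obtain z where z: "z \<in> verts G" "w = f z" using f G' by (auto simp: bij_betw_def simple_graph_def)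
    then show "(x, y) \<in> edges G ^^ Suc k" using w Suc e by auto
  qed
qed

text \<open>An isomorphism preserves the existence of walks of given length from the root, so it
  restricts to a bijection between the balls.\<close>

lemma cut_rooted_iso:
  assumes iso: "g \<simeq>\<^sub>r g'" and G: "simple_graph (fst g)" "simple_graph (fst g')" and root: "snd g \<in> verts (fst g)"
  shows "cut h g \<simeq>\<^sub>r cut h g'"
proof -
  obtain f where f: "bij_betw f (verts (fst g)) (verts (fst g'))" "f (snd g) = snd g'"
     and e: "\<And>u v. u \<in> verts (fst g) \<Longrightarrow> v \<in> verts (fst g) \<Longrightarrow>
        (u, v) \<in> edges (fst g) \<longleftrightarrow> (f u, f v) \<in> edges (fst g')"
    using iso unfolding rooted_iso_def by blast
  let ?B = "graph_ball (fst g) (snd g) h" and ?B' = "graph_ball (fst g') (snd g') h"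
  have mem: "f y \<in> ?B' \<longleftrightarrow> y \<in> ?B" if "y \<in> verts (fst g)" for y
    using relpow_image[OF G f(1) e root that] f bij_betwE[OF f(1)] that
    by (auto simp: graph_ball_def)
  have "bij_betw f (verts (fst g) \<inter> ?B) (verts (fst g') \<inter> ?B')"
    unfolding bij_betw_def
  proof
    show "inj_on f (verts (fst g) \<inter> ?B)" using f(1) by (auto simp: bij_betw_def intro: inj_on_subset)
    show "f ` (verts (fst g) \<inter> ?B) = verts (fst g') \<inter> ?B'"
    proof (intro equalityI subsetI)
      show "z \<in> verts (fst g') \<inter> ?B'" if "z \<in> f ` (verts (fst g) \<inter> ?B)" for z
        using that mem bij_betwE[OF f(1)] by auto
      fix z assume z: "z \<in> verts (fst g') \<inter> ?B'"
      then obtain u where "u \<in> verts (fst g)" "z = f u" using f(1) by (auto simp: bij_betw_def)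
      then show "z \<in> f ` (verts (fst g) \<inter> ?B)" using mem z by auto
    qed
  qed
  then show ?thesis unfolding rooted_iso_def cut_def induced_def
    using f e mem by (intro exI[of _ f]) (auto split: prod.splits)
qed

lemma graph_ball_root: "x \<in> verts G \<Longrightarrow> x \<in> graph_ball G x h"
  by (auto simp: graph_ball_def intro!: exI[of _ 0])

text \<open>Every vertex visited by a walk of length at most \<open>h\<close> from \<open>x\<close>
  is itself in the ball, so the walk survives the cut. This makes the cut connected and of depth at
  most \<open>h\<close>.\<close>

lemma relpow_induced_ball:
  assumes G: "simple_graph G" and x: "x \<in> verts G" and k: "k \<le> h" "(x, y) \<in> edges G ^^ k"
  shows "(x, y) \<in> edges (induced G (graph_ball G x h)) ^^ k"
  using k
proof (induction k arbitrary: y)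
  case (Suc k)
  then obtain z where z: "(x, z) \<in> edges G ^^ k" "(z, y) \<in> edges G" by auto
  have V: "z \<in> verts G" "y \<in> verts G" using z G by (auto simp: simple_graph_def)
  have "z \<in> graph_ball G x h" using V Suc.prems z by (auto simp: graph_ball_def intro!: exI[of _ k])
  moreover have "y \<in> graph_ball G x h" using V Suc.prems unfolding graph_ball_def by blast
  ultimately show ?case using Suc.IH[OF _ z(1)] Suc.prems z by (auto simp: induced_def)
qed simp

lemma neighbours_induced: "neighbours (induced G S) y \<subseteq> neighbours G y"
  by (auto simp: neighbours_def induced_def)

lemma rooted_graph_cut:
  assumes G: "simple_graph G" "locally_finite G" and x: "x \<in> verts G"
  shows "rooted_graph (cut h (G, x))" "depth_le h (cut h (G, x))"
proof -
  let ?B = "graph_ball G x h"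
  have sub: "?B \<subseteq> verts G" by (auto simp: graph_ball_def)
  have simple: "simple_graph (induced G ?B)"
    using G sub by (auto simp: simple_graph_def induced_def sym_def irrefl_def)
  have walk: "\<exists>k\<le>h. (x, y) \<in> edges (induced G ?B) ^^ k" if "y \<in> ?B" for y
  proof -
    obtain k where "k \<le> h" "(x, y) \<in> edges G ^^ k" using \<open>y \<in> ?B\<close> by (auto simp: graph_ball_def)
    then show ?thesis using relpow_induced_ball[OF G(1) x] by metis
  qed
  then have reach: "(x, y) \<in> (edges (induced G ?B))\<^sup>*" if "y \<in> ?B" for y
    using that by (meson relpow_imp_rtrancl)
  have fin: "finite (neighbours (induced G ?B) y)" if "y \<in> ?B" for y
    using G sub that by (intro finite_subset[OF neighbours_induced]) (auto simp: locally_finite_def)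
  show "rooted_graph (cut h (G, x))"
    using simple reach fin graph_ball_root[OF x] x
    unfolding rooted_graph_def cut_def by (auto simp: induced_def)
  show "depth_le h (cut h (G, x))"
    unfolding depth_le_def cut_def using walk sub by (auto simp: induced_def graph_ball_def[of "\<lparr>verts = _, edges = _\<rparr>"])
qed

lemma finite_graph_ball:
  assumes G: "simple_graph G" "locally_finite G" and x: "x \<in> verts G"
  shows "finite (graph_ball G x h)"
proof -
  have "finite {y. (x, y) \<in> edges G ^^ k}" for k
  proof (induction k)
    case (Suc k)
    have "{y. (x, y) \<in> edges G ^^ Suc k} \<subseteq> (\<Union>z\<in>{y. (x, y) \<in> edges G ^^ k} \<inter> verts G. neighbours G z)"
      using G by (fastforce simp: neighbours_def simple_graph_def)
    moreover have "finite \<dots>" using Suc G by (auto simp: locally_finite_def)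
    ultimately show ?case by (rule finite_subset)
  qed simp
  moreover have "graph_ball G x h \<subseteq> (\<Union>k\<le>h. {y. (x, y) \<in> edges G ^^ k})"
    by (auto simp: graph_ball_def)
  ultimately show ?thesis by (meson finite_UN_I finite_atMost finite_subset)
qed

lemma rooted_graph_locally_finite: "rooted_graph g \<Longrightarrow> locally_finite (fst g)"
  by (auto simp: rooted_graph_def locally_finite_def)

lemma rooted_graph_simple: "rooted_graph g \<Longrightarrow> simple_graph (fst g)"
  by (auto simp: rooted_graph_def)

lemma rooted_graph_root: "rooted_graph g \<Longrightarrow> snd g \<in> verts (fst g)"
  by (auto simp: rooted_graph_def)

section \<open>Countability, isomorphism classes and measurability\<close>

lemma countable_finite_graphs:
  "countable {g :: nat rooted. rooted_graph g \<and> finite (verts (fst g))}"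
proof (rule countable_subset)
  let ?S = "(\<lambda>(V, E, x). (\<lparr>verts = V, edges = E\<rparr>, x)) `
     (Collect finite \<times> Collect finite \<times> (UNIV :: nat set)) :: nat rooted set"
  show "countable ?S" by (intro countable_image countable_SIGMA countable_Collect_finite) auto
  show "{g :: nat rooted. rooted_graph g \<and> finite (verts (fst g))} \<subseteq> ?S"
  proof
    fix g :: "nat rooted" assume g: "g \<in> {g. rooted_graph g \<and> finite (verts (fst g))}"
    obtain G x where gx: "g = (G, x)" by (cases g)
    have "edges G \<subseteq> verts G \<times> verts G" using g gx by (auto simp: rooted_graph_def simple_graph_def)
    then have "finite (edges G)" using g gx finite_subset by fastforce
    then show "g \<in> ?S" using g unfolding gx by (intro image_eqI[of _ _ "(verts G, edges G, x)"]) auto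
  qed
qed

lemma finite_verts_of_depth_le:
  assumes "rooted_graph g" "depth_le h g" shows "finite (verts (fst g))"
  using finite_graph_ball[of "fst g" "snd g" h] rooted_graph_simple[OF assms(1)] rooted_graph_root[OF assms(1)]
    rooted_graph_locally_finite[OF assms(1)] assms(2)
  by (auto simp: depth_le_def intro: finite_subset split: prod.splits)

lemma countable_depth_classes: "countable (depth_classes h)"
  unfolding depth_classes_def
  by (intro countable_image countable_subset[OF _ countable_finite_graphs]) (auto dest: finite_verts_of_depth_le)

lemma iso_class_cong:
  assumes "g \<simeq>\<^sub>r g'" "snd g \<in> verts (fst g)" shows "iso_class g = iso_class g'"
  unfolding iso_class_def
  using rooted_iso_trans[OF assms(1)] rooted_iso_trans[OF rooted_iso_sym[OF assms]] by blast

text \<open>The graph is transported along an enumeration of its vertices. Classes consist of graphs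
  on the natural numbers only, so this is what gives the choice in \<open>representative\<close> a
  meaning for a graph on another vertex type.\<close>

lemma iso_class_nonempty:
  fixes g :: "'a rooted"
  assumes g: "rooted_graph g" and c: "countable (verts (fst g))"
  shows "\<exists>g'::nat rooted. rooted_graph g' \<and> g \<simeq>\<^sub>r g'"
proof -
  obtain G x where gx: "g = (G, x)" by (cases g)
  define f where "f = to_nat_on (verts G)"
  have inj: "inj_on f (verts G)" unfolding f_def using c gx by auto
  define G' where "G' = \<lparr>verts = f ` verts G, edges = (\<lambda>(u, v). (f u, f v)) ` edges G\<rparr>"
  have bij: "bij_betw f (verts G) (verts G')" using inj by (simp add: G'_def bij_betw_def)
  have E: "edges G \<subseteq> verts G \<times> verts G" and S: "simple_graph G" and x: "x \<in> verts G"
    using g gx by (auto simp: rooted_graph_def simple_graph_def)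
  have e: "(u, v) \<in> edges G \<longleftrightarrow> (f u, f v) \<in> edges G'" if "u \<in> verts G" "v \<in> verts G" for u v
  proof
    assume "(f u, f v) \<in> edges G'"
    then obtain a b where ab: "(a, b) \<in> edges G" "f u = f a" "f v = f b" by (auto simp: G'_def)
    then have "u = a" "v = b" using that E inj by (auto dest: inj_onD)
    then show "(u, v) \<in> edges G" using ab by simp
  qed (force simp: G'_def)
  have S': "simple_graph G'"
    unfolding simple_graph_def
  proof (intro conjI)
    show "edges G' \<subseteq> verts G' \<times> verts G'" using E by (auto simp: G'_def)
    show "sym (edges G')" using S by (auto simp: G'_def simple_graph_def sym_def)
    show "irrefl (edges G')"
    proof (rule irreflI)
      fix a show "(a, a) \<notin> edges G'"
      proof
        assume "(a, a) \<in> edges G'"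
        then obtain u v where uv: "(u, v) \<in> edges G" "a = f u" "a = f v" by (auto simp: G'_def)
        then have "u = v" using inj E by (metis inj_onD mem_Sigma_iff subsetD)
        then show False using uv S by (auto simp: simple_graph_def irrefl_def)
      qed
    qed
  qed
  have "rooted_graph (G', f x)"
    unfolding rooted_graph_def prod.case
  proof (intro conjI ballI)
    show "f x \<in> verts G'" using x by (simp add: G'_def)
    fix y assume "y \<in> verts G'"
    then obtain u where u: "u \<in> verts G" "y = f u" by (auto simp: G'_def)
    then have "(x, u) \<in> (edges G)\<^sup>*" using g gx by (auto simp: rooted_graph_def)
    then obtain k where "(x, u) \<in> edges G ^^ k" using rtrancl_imp_relpow by blast
    then show "(f x, y) \<in> (edges G')\<^sup>*"
      using relpow_image[OF S S' bij e x u(1)] u by (auto intro: relpow_imp_rtrancl)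
    have "finite (neighbours G u)" using g gx u by (auto simp: rooted_graph_def)
    then show "finite (neighbours G' y)" using neighbours_image[OF S S' bij e u(1)] u by simp
  qed (rule S')
  moreover have "g \<simeq>\<^sub>r (G', f x)" unfolding rooted_iso_def gx using bij e by auto
  ultimately show ?thesis by blast
qed

lemma representative_iso_class:
  fixes g :: "'a rooted"
  assumes "rooted_graph g" "countable (verts (fst g))"
  shows "rooted_graph (representative (iso_class g))" "g \<simeq>\<^sub>r representative (iso_class g)"
proof -
  have "representative (iso_class g) \<in> iso_class g"
  proof -
    obtain g' :: "nat rooted" where "rooted_graph g'" "g \<simeq>\<^sub>r g'" using iso_class_nonempty[OF assms] by blast
    then have "g' \<in> iso_class g" by (simp add: iso_class_def)
    then show ?thesis unfolding representative_def by (rule someI)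
  qed
  then show "rooted_graph (representative (iso_class g))" "g \<simeq>\<^sub>r representative (iso_class g)"
    by (auto simp: iso_class_def)
qed

lemma depth_le_iso:
  assumes "g \<simeq>\<^sub>r g'" "rooted_graph g" "rooted_graph g'" "depth_le h g" shows "depth_le h g'"
proof -
  obtain f where f: "bij_betw f (verts (fst g)) (verts (fst g'))" "f (snd g) = snd g'"
     and e: "\<And>u v. u \<in> verts (fst g) \<Longrightarrow> v \<in> verts (fst g) \<Longrightarrow>
        (u, v) \<in> edges (fst g) \<longleftrightarrow> (f u, f v) \<in> edges (fst g')"
    using assms(1) unfolding rooted_iso_def by blast
  have "y \<in> graph_ball (fst g') (snd g') h" if "y \<in> verts (fst g')" for y
  proof -
    have "y \<in> f ` verts (fst g)" using f(1) that by (simp add: bij_betw_def)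
    then obtain u where u: "u \<in> verts (fst g)" "y = f u" by blast
    then obtain k where "k \<le> h" "(snd g, u) \<in> edges (fst g) ^^ k"
      using assms(4) by (auto simp: depth_le_def graph_ball_def split: prod.splits)
    then show ?thesis
      using relpow_image[OF rooted_graph_simple[OF assms(2)] rooted_graph_simple[OF assms(3)] f(1) e
          rooted_graph_root[OF assms(2)] u(1)] f(2) u that
      by (auto simp: graph_ball_def)
  qed
  then show ?thesis by (auto simp: depth_le_def split: prod.splits)
qed

text \<open>\<open>depth_classes\<close> only ranges over classes of graphs on the natural numbers,
  so the class of the cut is rewritten as the class of its representative.\<close>

lemma iso_class_cut_in_depth_classes:
  fixes G :: "'a graph"
  assumes G: "simple_graph G" "locally_finite G" and x: "x \<in> verts G"
  shows "iso_class (cut h (G, x)) \<in> depth_classes h"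
proof -
  note r = rooted_graph_cut[OF assms]
  have c: "countable (verts (fst (cut h (G, x))))"
    using finite_verts_of_depth_le[OF r] by (rule countable_finite)
  note rep = representative_iso_class[OF r(1) c]
  have "iso_class (cut h (G, x)) = iso_class (representative (iso_class (cut h (G, x))))"
    using rep(2) rooted_graph_root[OF r(1)] by (rule iso_class_cong)
  moreover have "depth_le h (representative (iso_class (cut h (G, x))))"
    using depth_le_iso[OF rep(2) r(1) rep(1) r(2)] .
  ultimately show ?thesis unfolding depth_classes_def using rep(1) by blast
qed

lemma rooted_classes_representative:
  assumes "c \<in> rooted_classes"
  shows "representative c \<in> c" "rooted_graph (representative c)" "c = iso_class (representative c)"
proof -
  obtain g :: "nat rooted" where g: "rooted_graph g" "c = iso_class g" using assms by (auto simp: rooted_classes_def)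
  note r = representative_iso_class[OF g(1) countableI_type]
  show "rooted_graph (representative c)" using r g by simp
  show "representative c \<in> c" using r g by (simp add: iso_class_def)
  show "c = iso_class (representative c)" using iso_class_cong[OF r(2)] rooted_graph_root[OF g(1)] g by simp
qed

text \<open>Isomorphic rooted graphs have isomorphic cuts, so membership in a cylinder can be tested
  on the chosen representative.\<close>

lemma cylinder_iff:
  assumes c: "c \<in> rooted_classes"
  shows "c \<in> cylinder h H \<longleftrightarrow> cut h (representative c) \<simeq>\<^sub>r H"
proof
  note r = rooted_classes_representative[OF c]
  show "c \<in> cylinder h H" if "cut h (representative c) \<simeq>\<^sub>r H"
    using that c r by (auto simp: cylinder_def)
  assume "c \<in> cylinder h H"
  then obtain g where g: "g \<in> c" "cut h g \<simeq>\<^sub>r H" by (auto simp: cylinder_def)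
  then have "rooted_graph g" "representative c \<simeq>\<^sub>r g" using r(3) by (auto simp: iso_class_def)
  then have "cut h (representative c) \<simeq>\<^sub>r cut h g"
    using r(2) by (intro cut_rooted_iso rooted_graph_simple rooted_graph_root)
  then show "cut h (representative c) \<simeq>\<^sub>r H" using g(2) by (rule rooted_iso_trans)
qed

lemma space_rooted_space: "space rooted_space = rooted_classes"
  unfolding rooted_space_def by (intro space_measure_of) (auto simp: cylinder_def)

lemma random_rooted_graph_space:
  assumes "random_rooted_graph P" shows "space P = rooted_classes"
  using assms sets_eq_imp_space_eq[of P rooted_space] by (simp add: random_rooted_graph_def space_rooted_space)

lemma cylinder_in_sets:
  assumes "random_rooted_graph P" "rooted_graph H" shows "cylinder h H \<in> sets P"
proof -
  have "cylinder h H \<in> sets rooted_space"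
    unfolding rooted_space_def using assms(2)
  proof (subst sets_measure_of)
    show "{cylinder h H |h H. rooted_graph H} \<subseteq> Pow rooted_classes" by (auto simp: cylinder_def)
  qed (blast intro: sigma_sets.Basic)
  then show ?thesis using assms(1) by (simp add: random_rooted_graph_def)
qed

text \<open>The target is countable and discrete, so preimages of points suffice, and these are
  cylinders. This is the only measurability in the random tree that the comparison of averages
  uses.\<close>

lemma ball_class_measurable:
  assumes P: "random_rooted_graph P"
  shows "(\<lambda>c. iso_class (cut h (representative c))) \<in> measurable P (count_space (depth_classes h))"
    (is "?f \<in> _")
proof -
  have mem: "iso_class (cut h (representative c)) \<in> depth_classes h" if "c \<in> rooted_classes" for c
    using iso_class_cut_in_depth_classes[of "fst (representative c)" "snd (representative c)"]
      rooted_classes_representative(2)[OF that]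
    by (simp add: rooted_graph_simple rooted_graph_locally_finite rooted_graph_root)
  then have maps: "?f \<in> space P \<rightarrow> depth_classes h"
    by (simp add: random_rooted_graph_space[OF P])
  have vimage: "?f -` {d} \<inter> space P \<in> sets P" if "d \<in> depth_classes h" for d
  proof -
  from that obtain H :: "nat rooted" where H: "rooted_graph H" "d = iso_class H" by (auto simp: depth_classes_def)
  have "iso_class (cut h (representative c)) = d \<longleftrightarrow> c \<in> cylinder h H" if c: "c \<in> rooted_classes" for c
  proof -
    note r = rooted_classes_representative(2)[OF c]
    have rg: "rooted_graph (cut h (representative c))"
      using rooted_graph_cut(1)[of "fst (representative c)" "snd (representative c)"] r
      by (simp add: rooted_graph_simple rooted_graph_locally_finite rooted_graph_root)
    have "iso_class (cut h (representative c)) = d \<longleftrightarrow> cut h (representative c) \<simeq>\<^sub>r H"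
    proof
      assume "iso_class (cut h (representative c)) = d"
      moreover have "H \<in> d" using H by (auto simp: iso_class_def rooted_iso_refl)
      ultimately show "cut h (representative c) \<simeq>\<^sub>r H" by (auto simp: iso_class_def)
    qed (use H iso_class_cong rooted_graph_root[OF rg] in blast)
    then show ?thesis using cylinder_iff[OF c] by simp
  qed
  then have "(\<lambda>c. iso_class (cut h (representative c))) -` {d} \<inter> space P = cylinder h H"
    unfolding random_rooted_graph_space[OF P] by (auto simp: cylinder_def)
  then show ?thesis
    using cylinder_in_sets[OF P H(1)] by simp
  qed
  have "?f -` A \<inter> space P \<in> sets P" if A: "A \<subseteq> depth_classes h" for A
  proof -
    have "?f -` A \<inter> space P = (\<Union>d\<in>A. ?f -` {d} \<inter> space P)" by auto
    also have "\<dots> \<in> sets P"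
      using vimage A by (intro sets.countable_UN'' countable_subset[OF A countable_depth_classes]) auto
    finally show ?thesis .
  qed
  with maps show ?thesis by (auto intro!: measurableI)
qed

text \<open>A finite rooted graph with a vertex of degree above \<open>D\<close> is never a ball of
  some \<open>G n\<close> with n at least 1, so its cylinder has limiting frequency 0. There are
  countably many such graphs, and any limit graph violating the bound lies in one of their
  cylinders.\<close>

lemma local_weak_limit_degree_bound:
  fixes G :: "nat \<Rightarrow> 'a graph"
  assumes lim: "local_weak_limit G P"
    and G: "\<And>n. n \<ge> 1 \<Longrightarrow> simple_graph (G n) \<and> finite (verts (G n)) \<and>
              (\<forall>x\<in>verts (G n). card (neighbours (G n) x) \<le> D)"
  shows "AE c in P. \<forall>y\<in>verts (fst (representative c)). card (neighbours (fst (representative c)) y) \<le> D"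
proof -
  have P: "random_rooted_graph P" using lim by (simp add: local_weak_limit_def)
  then interpret prob_space P by (simp add: random_rooted_graph_def)
  define bad where "bad = {H :: nat rooted. (rooted_graph H \<and> finite (verts (fst H))) \<and>
     (\<exists>y\<in>verts (fst H). card (neighbours (fst H) y) > D)}"
  have null: "cylinder h H \<in> null_sets P" if H: "H \<in> bad" "depth_le h H" for h H
  proof -
    have rH: "rooted_graph H" using H by (auto simp: bad_def)
    obtain y where y: "y \<in> verts (fst H)" "card (neighbours (fst H) y) > D" using H by (auto simp: bad_def)
    have "{x \<in> verts (G n). cut h (G n, x) \<simeq>\<^sub>r H} = {}" if n: "n \<ge> 1" for n
    proof (rule ccontr)
      assume "{x \<in> verts (G n). cut h (G n, x) \<simeq>\<^sub>r H} \<noteq> {}"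
      then obtain x where x: "x \<in> verts (G n)" "cut h (G n, x) \<simeq>\<^sub>r H" by auto
      have fin: "finite (neighbours (G n) u)" for u
        using G[OF n] neighbours_subset finite_subset by metis
      then have lf: "locally_finite (G n)" by (simp add: locally_finite_def)
      note rc = rooted_graph_cut[OF _ lf x(1), of h]
      have sG: "simple_graph (G n)" using G[OF n] by simp
      obtain f where f: "bij_betw f (verts (fst (cut h (G n, x)))) (verts (fst H))"
         and e: "\<And>u v. u \<in> verts (fst (cut h (G n, x))) \<Longrightarrow> v \<in> verts (fst (cut h (G n, x))) \<Longrightarrow>
            (u, v) \<in> edges (fst (cut h (G n, x))) \<longleftrightarrow> (f u, f v) \<in> edges (fst H)"
        using x(2) unfolding rooted_iso_def by blast
      obtain u where u: "u \<in> verts (fst (cut h (G n, x)))" "y = f u"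
        using f y by (auto simp: bij_betw_def)
      have "neighbours (fst H) y = f ` neighbours (fst (cut h (G n, x))) u"
        unfolding u(2) using rc(1)[OF sG] rH f e u(1)
        by (intro neighbours_image rooted_graph_simple)
      moreover have sub: "neighbours (fst (cut h (G n, x))) u \<subseteq> neighbours (G n) u"
        unfolding cut_def by (simp add: neighbours_induced)
      ultimately have "card (neighbours (fst H) y) \<le> card (neighbours (G n) u)"
        using fin[of u] by (metis card_image_le card_mono finite_subset le_trans)
      moreover have "u \<in> verts (G n)" using u by (auto simp: cut_def induced_def)
      ultimately show False using G[OF n] y(2) by fastforce
    qed
    then have "real (card {x \<in> verts (G n). cut h (G n, x) \<simeq>\<^sub>r H}) / real (card (verts (G n))) = 0" if "n \<ge> 1" for n
      by (simp only: that card.empty)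
    then have "\<forall>\<^sub>F n in sequentially. real (card {x \<in> verts (G n). cut h (G n, x) \<simeq>\<^sub>r H}) / real (card (verts (G n))) = 0"
      by (rule eventually_sequentiallyI)
    then have "(\<lambda>n. real (card {x \<in> verts (G n). cut h (G n, x) \<simeq>\<^sub>r H}) / real (card (verts (G n)))) \<longlonglongrightarrow> 0"
      by (rule tendsto_eventually)
    moreover have "(\<lambda>n. real (card {x \<in> verts (G n). cut h (G n, x) \<simeq>\<^sub>r H}) / real (card (verts (G n))))
       \<longlonglongrightarrow> measure P (cylinder h H)"
      using lim H rH unfolding local_weak_limit_def by blast
    ultimately have "measure P (cylinder h H) = 0" by (rule LIMSEQ_unique[symmetric])
    then show ?thesis using cylinder_in_sets[OF P rH] by (simp add: emeasure_eq_measure null_sets_def)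
  qed
  have "countable bad" unfolding bad_def by (rule countable_subset[OF _ countable_finite_graphs]) auto
  then have "(\<Union>(h, H) \<in> {(h, H). H \<in> bad \<and> depth_le h H}. cylinder h H) \<in> null_sets P"
    using null by (intro null_sets_UN' countable_subset[of "{(h, H). H \<in> bad \<and> depth_le h H}" "UNIV \<times> bad"]) auto
  then show ?thesis
  proof (rule AE_I')
    show "{c \<in> space P. \<not> (\<forall>y\<in>verts (fst (representative c)). card (neighbours (fst (representative c)) y) \<le> D)}
      \<subseteq> (\<Union>(h, H) \<in> {(h, H). H \<in> bad \<and> depth_le h H}. cylinder h H)"
    proof
      fix c assume "c \<in> {c \<in> space P. \<not> (\<forall>y\<in>verts (fst (representative c)). card (neighbours (fst (representative c)) y) \<le> D)}"
      then obtain y where c: "c \<in> rooted_classes" and y: "y \<in> verts (fst (representative c))"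
          "card (neighbours (fst (representative c)) y) > D"
        by (auto simp: random_rooted_graph_space[OF P])
      obtain T a where T: "representative c = (T, a)" by (cases "representative c")
      note r = rooted_classes_representative[OF c, unfolded T]
      have s: "simple_graph T" and lf: "locally_finite T" and a: "a \<in> verts T"
        using rooted_graph_simple[OF r(2)] rooted_graph_locally_finite[OF r(2)] rooted_graph_root[OF r(2)] by simp_all
      have "(a, y) \<in> (edges T)\<^sup>*" using r(2) y T by (auto simp: rooted_graph_def)
      then obtain k where k: "(a, y) \<in> edges T ^^ k" using rtrancl_imp_relpow by blast
      \<comment> \<open>Radius k + 1 for a vertex reached in k steps: all its neighbours survive the
        cut, so its full degree is still visible.\<close>
      let ?H = "cut (Suc k) (T, a)"
      have yB: "y \<in> graph_ball T a (Suc k)" using y T k by (auto simp: graph_ball_def intro!: exI[of _ k])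
      have "z \<in> graph_ball T a (Suc k)" if "(y, z) \<in> edges T" for z
        using that s k by (auto simp: graph_ball_def simple_graph_def intro!: exI[of _ "Suc k"])
      then have "neighbours T y = neighbours (fst ?H) y"
        using yB by (auto simp: cut_def induced_def neighbours_def)
      moreover have "y \<in> verts (fst ?H)" using yB y T by (auto simp: cut_def induced_def)
      moreover note rc = rooted_graph_cut[OF s lf a, of "Suc k"]
      ultimately have "?H \<in> bad" unfolding bad_def using y T finite_verts_of_depth_le[OF rc]
        by (auto intro!: bexI[of _ y])
      moreover have "c \<in> cylinder (Suc k) ?H" using cylinder_iff[OF c] T by (simp add: rooted_iso_refl)
      ultimately show "c \<in> (\<Union>(h, H) \<in> {(h, H). H \<in> bad \<and> depth_le h H}. cylinder h H)"
        using rc(2) by blast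
    qed
  qed
qed

section \<open>Closed walks and polynomial moments\<close>

definition walk_vector :: "'a rooted \<Rightarrow> nat \<Rightarrow> 'a \<Rightarrow> real" where
  "walk_vector g j = (adj_op (fst g) ^^ j) (\<lambda>y. if y = snd g then 1 else 0)"

definition closed_walks :: "'a rooted \<Rightarrow> nat \<Rightarrow> real" where
  "closed_walks g j = walk_vector g j (snd g)"

text \<open>This is <\<delta>_o, p(A) \<delta>_o>, written through walk counts: a finite expression
  also on an infinite graph, which depends only on a ball, and which becomes the integral of p
  against the spectral measure.\<close>

definition poly_moment :: "'a rooted \<Rightarrow> real poly \<Rightarrow> real" where
  "poly_moment g p = (\<Sum>i\<le>degree p. coeff p i * closed_walks g i)"

lemma walk_vector_0: "walk_vector g 0 y = (if y = snd g then 1 else 0)"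
  by (simp add: walk_vector_def)

lemma walk_vector_Suc: "walk_vector g (Suc j) = adj_op (fst g) (walk_vector g j)"
  by (simp add: walk_vector_def)

lemma walk_vector_outside:
  assumes "snd g \<in> verts (fst g)" "y \<notin> verts (fst g)" shows "walk_vector g j y = 0"
  using assms by (cases j) (auto simp: walk_vector_0 walk_vector_Suc adj_op_def)

lemma neighbours_sym: "simple_graph G \<Longrightarrow> z \<in> neighbours G y \<longleftrightarrow> y \<in> neighbours G z"
  by (auto simp: neighbours_def simple_graph_def sym_def)

lemma walk_vector_support:
  assumes G: "simple_graph (fst g)" and root: "snd g \<in> verts (fst g)"
    and "walk_vector g j y \<noteq> 0" shows "y \<in> graph_ball (fst g) (snd g) j"
  using assms(3)
proof (induction j arbitrary: y)
  case 0
  then show ?case using root graph_ball_root[OF root] by (auto simp: walk_vector_0 split: if_splits)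
next
  case (Suc j)
  then have y: "y \<in> verts (fst g)" using walk_vector_outside[OF root] by blast
  have "(\<Sum>z\<in>neighbours (fst g) y. walk_vector g j z) \<noteq> 0" using Suc y by (simp add: walk_vector_Suc adj_op_def)
  then obtain z where z: "z \<in> neighbours (fst g) y" "walk_vector g j z \<noteq> 0" by (meson sum.neutral)
  obtain k where k: "k \<le> j" "(snd g, z) \<in> edges (fst g) ^^ k"
    using Suc.IH[OF z(2)] by (auto simp: graph_ball_def)
  have "(z, y) \<in> edges (fst g)" using z(1) neighbours_sym[OF G] by (auto simp: neighbours_def)
  then have "(snd g, y) \<in> edges (fst g) ^^ Suc k" using k by auto
  then show ?case using y k unfolding graph_ball_def by (intro CollectI conjI exI[of _ "Suc k"]) auto
qed

text \<open>The vector for \<open>j\<close> is carried by the ball of radius \<open>j\<close>. As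
  long as j < h, all neighbours of this ball are inside the cut, so one more application of the
  operator is unaffected. This is the origin of the restriction to polynomials of degree at most
  \<open>h\<close>.\<close>

lemma walk_vector_cut:
  assumes G: "simple_graph G" "locally_finite G" and x: "x \<in> verts G" and "j \<le> h"
  shows "walk_vector (cut h (G, x)) j = walk_vector (G, x) j"
  using assms(4)
proof (induction j)
  case 0
  then show ?case by (simp add: walk_vector_0 fun_eq_iff cut_def)
next
  case (Suc j)
  let ?B = "graph_ball G x h"
  have IH: "walk_vector (cut h (G, x)) j = walk_vector (G, x) j" using Suc by simp
  have supp: "z \<in> ?B \<and> (\<forall>y. (y, z) \<in> edges G \<longrightarrow> y \<in> ?B)" if "walk_vector (G, x) j z \<noteq> 0" for z
  proof -
    have "z \<in> graph_ball G x j" using walk_vector_support[of "(G, x)" j z] G x that by simp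
    then obtain k where k: "k \<le> j" "(x, z) \<in> edges G ^^ k" and z: "z \<in> verts G"
      unfolding graph_ball_def by blast
    have "y \<in> ?B" if "(y, z) \<in> edges G" for y
    proof -
      have "(z, y) \<in> edges G" "y \<in> verts G" using that G by (auto simp: simple_graph_def sym_def)
      then have "(x, y) \<in> edges G ^^ Suc k" "y \<in> verts G" using k by auto
      then show ?thesis using k Suc.prems unfolding graph_ball_def by (intro CollectI conjI exI[of _ "Suc k"]) auto
    qed
    moreover have "z \<in> ?B" using k z Suc.prems unfolding graph_ball_def by (intro CollectI conjI exI[of _ k]) auto
    ultimately show ?thesis by blast
  qed
  have "adj_op (induced G ?B) (walk_vector (G, x) j) y = adj_op G (walk_vector (G, x) j) y" for y
  proof (cases "y \<in> ?B")
    case True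
    then have y: "y \<in> verts G" by (simp add: graph_ball_def)
    have "(\<Sum>z\<in>neighbours (induced G ?B) y. walk_vector (G, x) j z) = (\<Sum>z\<in>neighbours G y. walk_vector (G, x) j z)"
    proof (intro sum.mono_neutral_left)
      show "finite (neighbours G y)" using G y by (simp add: locally_finite_def)
      show "\<forall>z\<in>neighbours G y - neighbours (induced G ?B) y. walk_vector (G, x) j z = 0"
        using supp True by (auto simp: neighbours_def induced_def)
    qed (rule neighbours_induced)
    then show ?thesis using True y by (simp add: adj_op_def induced_def)
  next
    case False
    have "walk_vector (G, x) j z = 0" if "z \<in> neighbours G y" for z
      using supp[of z] that False by (auto simp: neighbours_def)
    then have "adj_op G (walk_vector (G, x) j) y = 0" by (simp add: adj_op_def)
    then show ?thesis using False by (simp add: adj_op_def induced_def)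
  qed
  then show ?case unfolding walk_vector_Suc IH by (simp add: cut_def fun_eq_iff)
qed

lemma closed_walks_cut:
  assumes "simple_graph G" "locally_finite G" "x \<in> verts G" "j \<le> h"
  shows "closed_walks (cut h (G, x)) j = closed_walks (G, x) j"
  unfolding closed_walks_def walk_vector_cut[OF assms] by (simp add: cut_def)

lemma closed_walks_iso:
  assumes iso: "g \<simeq>\<^sub>r g'" and G: "simple_graph (fst g)" "simple_graph (fst g')"
    and root: "snd g \<in> verts (fst g)"
  shows "closed_walks g j = closed_walks g' j"
proof -
  obtain f where f: "bij_betw f (verts (fst g)) (verts (fst g'))" "f (snd g) = snd g'"
     and e: "\<And>u v. u \<in> verts (fst g) \<Longrightarrow> v \<in> verts (fst g) \<Longrightarrow>
        (u, v) \<in> edges (fst g) \<longleftrightarrow> (f u, f v) \<in> edges (fst g')"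
    using iso unfolding rooted_iso_def by blast
  have inj: "inj_on f (verts (fst g))" using f(1) by (simp add: bij_betw_def)
  have "walk_vector g' j (f y) = walk_vector g j y" if "y \<in> verts (fst g)" for y
    using that
  proof (induction j arbitrary: y)
    case 0
    then show ?case using root inj f(2)[symmetric] by (auto simp: walk_vector_0 dest: inj_onD)
  next
    case (Suc j)
    have "f y \<in> verts (fst g')" using Suc.prems f(1) bij_betwE by blast
    then have "walk_vector g' (Suc j) (f y) = (\<Sum>z\<in>f ` neighbours (fst g) y. walk_vector g' j z)"
      by (simp add: walk_vector_Suc adj_op_def neighbours_image[OF G f(1) e Suc.prems])
    also have "\<dots> = (\<Sum>z\<in>neighbours (fst g) y. walk_vector g' j (f z))"
      using inj_on_subset[OF inj neighbours_subset[OF G(1)]] by (simp add: sum.reindex)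
    also have "\<dots> = (\<Sum>z\<in>neighbours (fst g) y. walk_vector g j z)"
      using Suc.IH neighbours_subset[OF G(1)] by (intro sum.cong) auto
    finally show ?case using Suc.prems by (simp add: walk_vector_Suc adj_op_def)
  qed
  from this[OF root] show ?thesis by (simp add: closed_walks_def f(2))
qed

lemma poly_moment_cong:
  assumes "\<And>j. j \<le> degree p \<Longrightarrow> closed_walks g j = closed_walks g' j"
  shows "poly_moment g p = poly_moment g' p"
  unfolding poly_moment_def using assms by (intro sum.cong) auto

text \<open>Makes the polynomial moment a function on \<open>depth_classes h\<close>, the space on
  which the two ball laws are compared.\<close>

lemma poly_moment_class_cut:
  fixes G :: "'a graph"
  assumes G: "simple_graph G" "locally_finite G" and x: "x \<in> verts G" and p: "degree p \<le> h"
  shows "poly_moment (representative (iso_class (cut h (G, x)))) p = poly_moment (G, x) p"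
proof (rule poly_moment_cong)
  fix j assume j: "j \<le> degree p"
  note r = rooted_graph_cut[OF G x, of h]
  have c: "countable (verts (fst (cut h (G, x))))"
    using finite_verts_of_depth_le[OF r] by (rule countable_finite)
  note rep = representative_iso_class[OF r(1) c]
  have "closed_walks (representative (iso_class (cut h (G, x)))) j = closed_walks (cut h (G, x)) j"
    using closed_walks_iso[OF rep(2)] r(1) rep(1) by (simp add: rooted_graph_simple rooted_graph_root)
  also have "\<dots> = closed_walks (G, x) j" using closed_walks_cut[OF G x] j p by simp
  finally show "closed_walks (representative (iso_class (cut h (G, x)))) j = closed_walks (G, x) j" .
qed

section \<open>Comparison of local averages\<close>

lemma dTV_commute: "sets M = sets N \<Longrightarrow> dTV M N = dTV N M"
  by (simp add: dTV_def abs_minus_commute)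

text \<open>The supremum in \<open>dTV\<close> is taken in the reals, so it dominates its members
  only because the differences are bounded by 1.\<close>

lemma measure_diff_le_dTV:
  assumes "prob_space M" "prob_space N" "A \<in> sets M"
  shows "\<bar>measure M A - measure N A\<bar> \<le> dTV M N"
  unfolding dTV_def
proof (rule cSUP_upper[OF assms(3)])
  interpret M: prob_space M by fact
  interpret N: prob_space N by fact
  have "\<bar>measure M A - measure N A\<bar> \<le> 1" for A
    using M.prob_le_1[of A] N.prob_le_1[of A] measure_nonneg[of M A] measure_nonneg[of N A] by linarith
  then show "bdd_above ((\<lambda>A. \<bar>measure M A - measure N A\<bar>) ` sets M)" by (intro bdd_aboveI[of _ 1]) auto
qed

text \<open>\<open>f x\<close> is the length of the set of levels s in [0, B) with s < f x; Fubini's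
  theorem then exchanges levels and points.\<close>

lemma layer_cake:
  fixes f :: "'a \<Rightarrow> real"
  assumes "prob_space M" and f[measurable]: "f \<in> borel_measurable M" and b: "\<And>x. 0 \<le> f x" "\<And>x. f x \<le> B"
  shows "(\<integral>\<^sup>+x. ennreal (f x) \<partial>M) = (\<integral>\<^sup>+s. emeasure M {x \<in> space M. s < f x} * indicator {0..<B} s \<partial>lborel)"
proof -
  interpret prob_space M by fact
  interpret pair_sigma_finite M lborel ..
  have "(\<integral>\<^sup>+x. ennreal (f x) \<partial>M) = (\<integral>\<^sup>+x. (\<integral>\<^sup>+s. indicator {0..<B} s * indicator {s. s < f x} s \<partial>lborel) \<partial>M)"
  proof (intro nn_integral_cong)
    fix x
    have "(\<integral>\<^sup>+s. indicator {0..<B} s * indicator {s. s < f x} s \<partial>lborel) = (\<integral>\<^sup>+s. indicator {0..<f x} s \<partial>lborel)"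
      using b[of x] by (intro nn_integral_cong) (auto simp: indicator_def)
    then show "ennreal (f x) = (\<integral>\<^sup>+s. indicator {0..<B} s * indicator {s. s < f x} s \<partial>lborel)"
      using b(1)[of x] by simp
  qed
  also have "\<dots> = (\<integral>\<^sup>+s. (\<integral>\<^sup>+x. indicator {0..<B} s * indicator {s. s < f x} s \<partial>M) \<partial>lborel)"
    by (rule Fubini'[symmetric]) measurable
  also have "\<dots> = (\<integral>\<^sup>+s. emeasure M {x \<in> space M. s < f x} * indicator {0..<B} s \<partial>lborel)"
  proof (intro nn_integral_cong)
    fix s :: real
    have "(\<integral>\<^sup>+x. indicator {0..<B} s * indicator {s. s < f x} s \<partial>M)
       = (\<integral>\<^sup>+x. indicator {0..<B} s * indicator {x \<in> space M. s < f x} x \<partial>M)"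
      by (intro nn_integral_cong) (auto simp: indicator_def)
    then show "(\<integral>\<^sup>+x. indicator {0..<B} s * indicator {s. s < f x} s \<partial>M)
       = emeasure M {x \<in> space M. s < f x} * indicator {0..<B} s"
      by (simp add: nn_integral_cmult mult.commute)
  qed
  finally show ?thesis .
qed

text \<open>At each level the superlevel sets differ in measure by at most \<open>dTV M N\<close>;
  integrating over the levels in [0, B) gives the error \<open>B * dTV M N\<close>.\<close>

lemma nn_integral_le_dTV:
  fixes f :: "'a \<Rightarrow> real"
  assumes M: "prob_space M" and N: "prob_space N" and s: "sets M = sets N"
    and f: "f \<in> borel_measurable M" and b: "\<And>x. 0 \<le> f x" "\<And>x. f x \<le> B"
  shows "(\<integral>\<^sup>+x. ennreal (f x) \<partial>M) \<le> (\<integral>\<^sup>+x. ennreal (f x) \<partial>N) + ennreal (B * dTV M N)"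
proof -
  interpret M: prob_space M by fact
  interpret N: prob_space N by fact
  note f[measurable]
  have fN: "f \<in> borel_measurable N" using f measurable_cong_sets[OF s refl] by blast
  have B: "0 \<le> B" using b[of undefined] by linarith
  have sp: "space M = space N" using s by (rule sets_eq_imp_space_eq)
  have d: "dTV M N \<ge> 0" using measure_diff_le_dTV[OF M N sets.empty_sets] by simp
  have le: "emeasure M A \<le> emeasure N A + ennreal (dTV M N)" if "A \<in> sets M" for A
    using measure_diff_le_dTV[OF M N that] d
    by (simp add: M.emeasure_eq_measure N.emeasure_eq_measure ennreal_plus[symmetric] del: ennreal_plus)
  have [measurable]: "(\<lambda>s. emeasure N {x \<in> space N. s < f x}) \<in> borel_measurable borel"
  proof -
    note fN[measurable]
    have "(\<lambda>s. \<integral>\<^sup>+x. indicator {s. s < f x} s \<partial>N) \<in> borel_measurable borel" by measurable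
    moreover have "(\<integral>\<^sup>+x. indicator {s. s < f x} s \<partial>N) = emeasure N {x \<in> space N. s < f x}" for s
    proof -
      have "(\<integral>\<^sup>+x. indicator {s. s < f x} s \<partial>N) = (\<integral>\<^sup>+x. indicator {x \<in> space N. s < f x} x \<partial>N)"
        by (intro nn_integral_cong) (auto simp: indicator_def)
      then show ?thesis by simp
    qed
    ultimately show ?thesis by simp
  qed
  have "(\<integral>\<^sup>+x. ennreal (f x) \<partial>M) = (\<integral>\<^sup>+s. emeasure M {x \<in> space M. s < f x} * indicator {0..<B} s \<partial>lborel)"
    by (rule layer_cake[OF M f b])
  also have "\<dots> \<le> (\<integral>\<^sup>+s. emeasure N {x \<in> space N. s < f x} * indicator {0..<B} s
      + ennreal (dTV M N) * indicator {0..<B} s \<partial>lborel)"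
    using le by (intro nn_integral_mono) (auto simp: sp[symmetric] indicator_def)
  also have "\<dots> = (\<integral>\<^sup>+s. emeasure N {x \<in> space N. s < f x} * indicator {0..<B} s \<partial>lborel)
      + (\<integral>\<^sup>+s. ennreal (dTV M N) * indicator {0..<B} s \<partial>lborel)"
    by (intro nn_integral_add) measurable
  also have "(\<integral>\<^sup>+s. ennreal (dTV M N) * indicator {0..<B} s \<partial>lborel) = ennreal (B * dTV M N)"
    using B d by (simp add: nn_integral_cmult ennreal_mult'[symmetric] mult.commute)
  also have "(\<integral>\<^sup>+s. emeasure N {x \<in> space N. s < f x} * indicator {0..<B} s \<partial>lborel) = (\<integral>\<^sup>+x. ennreal (f x) \<partial>N)"
    by (rule layer_cake[OF N fN b, symmetric])
  finally show ?thesis .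
qed

text \<open>Both averages are integrals of one bounded function on \<open>depth_classes h\<close>,
  against the two ball laws. The bound \<open>B\<close> multiplies the distance, which is why \<psi>
  will always be a truncation. Measurability comes from factoring through a discrete space.\<close>

lemma empirical_vs_limit:
  fixes G :: "'a graph" and \<psi> :: "real \<Rightarrow> real"
  assumes P: "random_rooted_graph P"
    and G: "simple_graph G" "finite (verts G)" "verts G \<noteq> {}"
    and p: "degree p \<le> h" and b: "\<And>t. 0 \<le> \<psi> t" "\<And>t. \<psi> t \<le> B"
    and d: "dTV (empirical_ball_law h G) (ball_law h P) \<le> d"
  shows "ennreal ((\<Sum>x\<in>verts G. \<psi> (poly_moment (G, x) p)) / real (card (verts G)))
      \<le> (\<integral>\<^sup>+c. ennreal (\<psi> (poly_moment (representative c) p)) \<partial>P) + ennreal (B * d)"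
    and "(\<integral>\<^sup>+c. ennreal (\<psi> (poly_moment (representative c) p)) \<partial>P)
      \<le> ennreal ((\<Sum>x\<in>verts G. \<psi> (poly_moment (G, x) p)) / real (card (verts G))) + ennreal (B * d)"
    and "(\<lambda>c. \<psi> (poly_moment (representative c) p)) \<in> borel_measurable P"
proof -
  interpret P: prob_space P using P by (simp add: random_rooted_graph_def)
  have B: "B \<ge> 0" using b order_trans by blast
  have lf: "locally_finite G" unfolding locally_finite_def
    using neighbours_subset[OF G(1)] G(2) finite_subset by blast
  define f where "f k = \<psi> (poly_moment (representative k) p)" for k
  have mG: "(\<lambda>x. iso_class (cut h (G, x))) \<in> measurable (uniform_count_measure (verts G)) (count_space (depth_classes h))"
    using iso_class_cut_in_depth_classes[OF G(1) lf]
    by (auto simp: uniform_count_measure_def measurable_def point_measure_def)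
  have mP: "(\<lambda>c. iso_class (cut h (representative c))) \<in> measurable P (count_space (depth_classes h))"
    by (rule ball_class_measurable[OF P])
  interpret U: prob_space "uniform_count_measure (verts G)"
    by (rule prob_space_uniform_count_measure[OF G(2,3)])
  have pM: "prob_space (empirical_ball_law h G)"
    unfolding empirical_ball_law_def by (rule U.prob_space_distr[OF mG])
  have pN: "prob_space (ball_law h P)"
    unfolding ball_law_def by (rule P.prob_space_distr[OF mP])
  have s: "sets (empirical_ball_law h G) = sets (ball_law h P)"
    by (simp add: empirical_ball_law_def ball_law_def)
  have fm: "f \<in> borel_measurable (count_space (depth_classes h))" by simp
  have fM: "f \<in> borel_measurable (empirical_ball_law h G)" "f \<in> borel_measurable (ball_law h P)"
    by (simp_all add: empirical_ball_law_def ball_law_def)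
  have I1: "(\<integral>\<^sup>+k. ennreal (f k) \<partial>empirical_ball_law h G)
     = ennreal ((\<Sum>x\<in>verts G. \<psi> (poly_moment (G, x) p)) / real (card (verts G)))"
  proof -
    have "(\<integral>\<^sup>+k. ennreal (f k) \<partial>empirical_ball_law h G)
      = (\<integral>\<^sup>+x. ennreal (f (iso_class (cut h (G, x)))) \<partial>uniform_count_measure (verts G))"
      unfolding empirical_ball_law_def by (rule nn_integral_distr[OF mG]) simp
    also have "\<dots> = (\<integral>\<^sup>+x. ennreal (\<psi> (poly_moment (G, x) p)) \<partial>uniform_count_measure (verts G))"
      using poly_moment_class_cut[OF G(1) lf _ p] by (intro nn_integral_cong) (simp add: f_def space_uniform_count_measure)
    also have "\<dots> = (\<Sum>x\<in>verts G. ennreal (1 / real (card (verts G))) * ennreal (\<psi> (poly_moment (G, x) p)))"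
      unfolding uniform_count_measure_def using G(2) by (simp add: nn_integral_point_measure_finite mult.commute)
    also have "\<dots> = ennreal (\<Sum>x\<in>verts G. \<psi> (poly_moment (G, x) p) / real (card (verts G)))"
      using b by (subst sum_ennreal[symmetric]) (auto simp: ennreal_mult'[symmetric])
    finally show ?thesis by (simp add: sum_divide_distrib)
  qed
  have fc: "f (iso_class (cut h (representative c))) = \<psi> (poly_moment (representative c) p)" if "c \<in> space P" for c
  proof -
    have "rooted_graph (representative c)"
      using that by (simp add: random_rooted_graph_space[OF P] rooted_classes_representative)
    then show ?thesis using poly_moment_class_cut[of "fst (representative c)" "snd (representative c)", OF _ _ _ p]
      by (simp add: f_def rooted_graph_simple rooted_graph_locally_finite rooted_graph_root)
  qed
  have I2: "(\<integral>\<^sup>+k. ennreal (f k) \<partial>ball_law h P) = (\<integral>\<^sup>+c. ennreal (\<psi> (poly_moment (representative c) p)) \<partial>P)"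
  proof -
    have "(\<integral>\<^sup>+k. ennreal (f k) \<partial>ball_law h P) = (\<integral>\<^sup>+c. ennreal (f (iso_class (cut h (representative c)))) \<partial>P)"
      unfolding ball_law_def by (rule nn_integral_distr[OF mP]) simp
    also have "\<dots> = (\<integral>\<^sup>+c. ennreal (\<psi> (poly_moment (representative c) p)) \<partial>P)"
      by (intro nn_integral_cong) (simp add: fc)
    finally show ?thesis .
  qed
  have fb: "0 \<le> f k" "f k \<le> B" for k using b by (auto simp: f_def)
  have Bd: "ennreal (B * dTV (empirical_ball_law h G) (ball_law h P)) \<le> ennreal (B * d)"
    using d B by (intro ennreal_leI mult_left_mono)
  show "ennreal ((\<Sum>x\<in>verts G. \<psi> (poly_moment (G, x) p)) / real (card (verts G)))
      \<le> (\<integral>\<^sup>+c. ennreal (\<psi> (poly_moment (representative c) p)) \<partial>P) + ennreal (B * d)"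
    using nn_integral_le_dTV[OF pM pN s fM(1) fb] Bd unfolding I1 I2
    by (meson add_left_mono order_trans)
  show "(\<integral>\<^sup>+c. ennreal (\<psi> (poly_moment (representative c) p)) \<partial>P)
      \<le> ennreal ((\<Sum>x\<in>verts G. \<psi> (poly_moment (G, x) p)) / real (card (verts G))) + ennreal (B * d)"
    using nn_integral_le_dTV[OF pN pM s[symmetric] fM(2) fb] Bd unfolding I1 I2 dTV_commute[OF s]
    by (meson add_left_mono order_trans)
  have "(\<lambda>c. f (iso_class (cut h (representative c)))) \<in> borel_measurable P"
    by (rule measurable_compose[OF mP]) simp
  then show "(\<lambda>c. \<psi> (poly_moment (representative c) p)) \<in> borel_measurable P"
    using fc by (simp cong: measurable_cong)
qed

section \<open>The spectral measure of a graph of bounded degree\<close>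

definition poly_vector :: "'a rooted \<Rightarrow> real poly \<Rightarrow> 'a \<Rightarrow> real" where
  "poly_vector g p y = (\<Sum>i\<le>degree p. coeff p i * walk_vector g i y)"

lemma poly_moment_eq_poly_vector: "poly_moment g p = poly_vector g p (snd g)"
  by (simp add: poly_moment_def poly_vector_def closed_walks_def)

lemma poly_vector_altdef:
  assumes "degree p \<le> N" shows "poly_vector g p y = (\<Sum>i\<le>N. coeff p i * walk_vector g i y)"
  unfolding poly_vector_def using assms
  by (intro sum.mono_neutral_left) (auto simp: coeff_eq_0)

lemma poly_vector_add: "poly_vector g (p + q) y = poly_vector g p y + poly_vector g q y"
proof -
  let ?N = "max (degree p) (degree q)"
  have "degree (p + q) \<le> ?N" by (rule degree_add_le_max)
  then show ?thesis
    by (simp add: poly_vector_altdef[of _ ?N] sum.distrib[symmetric] distrib_right)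
qed

lemma poly_vector_smult: "poly_vector g (smult c p) y = c * poly_vector g p y"
  using poly_vector_altdef[of "smult c p" "degree p" g y] degree_smult_le[of c p]
  by (simp add: poly_vector_def sum_distrib_left mult.assoc)

lemma poly_vector_0 [simp]: "poly_vector g 0 y = 0"
  by (simp add: poly_vector_def)

lemma poly_vector_pCons:
  "poly_vector g (pCons c p) y = c * walk_vector g 0 y + (\<Sum>i\<le>degree p. coeff p i * walk_vector g (Suc i) y)"
  unfolding poly_vector_altdef[OF degree_pCons_le] sum.atMost_Suc_shift by simp

lemma poly_vector_diff: "poly_vector g (p - q) y = poly_vector g p y - poly_vector g q y"
  using poly_vector_add[of g p "smult (-1) q" y] poly_vector_smult[of g "-1" q y] by simp

lemma poly_vector_sum: "poly_vector g (\<Sum>k\<in>K. f k) y = (\<Sum>k\<in>K. poly_vector g (f k) y)"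
  by (induction K rule: infinite_finite_induct) (simp_all add: poly_vector_add)

text \<open>The sum runs over the support of the first argument, finite for polynomial vectors, so
  no summability on an infinite vertex set is involved.\<close>

definition inner_product :: "('a \<Rightarrow> real) \<Rightarrow> ('a \<Rightarrow> real) \<Rightarrow> real" where
  "inner_product u v = (\<Sum>y | u y \<noteq> 0. u y * v y)"

lemma inner_product_eq_sum:
  assumes "finite S" "\<And>y. u y \<noteq> 0 \<Longrightarrow> y \<in> S" shows "inner_product u v = (\<Sum>y\<in>S. u y * v y)"
  unfolding inner_product_def using assms by (intro sum.mono_neutral_left) auto

text \<open>\<open>D \<ge> 1\<close> allows division by \<open>D\<close> when [-D, D] is rescaled to
  [0, 1].\<close>

locale bounded_degree_graph =
  fixes g :: "'a rooted" and D :: nat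
  assumes simple: "simple_graph (fst g)" and locally_finite: "locally_finite (fst g)"
    and root: "snd g \<in> verts (fst g)" and D: "D \<ge> 1"
    and degree: "\<And>y. y \<in> verts (fst g) \<Longrightarrow> card (neighbours (fst g) y) \<le> D"
begin

abbreviation "A \<equiv> adj_op (fst g)"
abbreviation "V \<equiv> verts (fst g)"
abbreviation "N \<equiv> neighbours (fst g)"
abbreviation "pvec \<equiv> poly_vector g"

lemma poly_vector_pCons_adj: "pvec (pCons c p) y = c * walk_vector g 0 y + A (pvec p) y"
proof (cases "y \<in> V")
  case True
  have "(\<Sum>i\<le>degree p. coeff p i * walk_vector g (Suc i) y)
     = (\<Sum>i\<le>degree p. \<Sum>z\<in>N y. coeff p i * walk_vector g i z)"
    using True by (simp add: walk_vector_Suc adj_op_def sum_distrib_left)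
  also have "\<dots> = (\<Sum>z\<in>N y. pvec p z)"
    unfolding poly_vector_def by (rule sum.swap)
  finally show ?thesis using True by (simp add: poly_vector_pCons adj_op_def)
next
  case False
  then show ?thesis using walk_vector_outside[OF root False]
    by (simp add: poly_vector_pCons adj_op_def)
qed

lemma poly_vector_outside: "y \<notin> V \<Longrightarrow> pvec p y = 0"
  using walk_vector_outside[OF root] by (simp add: poly_vector_def)

lemma finite_support: "finite {y. pvec p y \<noteq> 0}"
proof (rule finite_subset)
  show "finite (\<Union>i\<le>degree p. graph_ball (fst g) (snd g) i)"
    using finite_graph_ball[OF simple locally_finite root] by blast
  show "{y. pvec p y \<noteq> 0} \<subseteq> (\<Union>i\<le>degree p. graph_ball (fst g) (snd g) i)"
  proof
    fix y assume "y \<in> {y. pvec p y \<noteq> 0}"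
    then obtain i where "i \<le> degree p" "walk_vector g i y \<noteq> 0"
      unfolding poly_vector_def by (auto elim!: sum.not_neutral_contains_not_neutral)
    then show "y \<in> (\<Union>i\<le>degree p. graph_ball (fst g) (snd g) i)"
      using walk_vector_support[OF simple root] by blast
  qed
qed

text \<open>As a sum over ordered edges inside a finite set, the form shows its symmetry:
  self-adjointness is the exchange of the two ends of an edge.\<close>

lemma adj_form:
  assumes S: "finite S" "S \<subseteq> V" and u: "\<And>y. u y \<noteq> 0 \<Longrightarrow> y \<in> S" and v: "\<And>y. v y \<noteq> 0 \<Longrightarrow> y \<in> S"
  shows "inner_product u (A v) = (\<Sum>(y, z)\<in>(S \<times> S) \<inter> edges (fst g). u y * v z)"
proof -
  have "inner_product u (A v) = (\<Sum>y\<in>S. u y * A v y)" by (rule inner_product_eq_sum[OF S(1) u])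
  also have "\<dots> = (\<Sum>y\<in>S. \<Sum>z\<in>S \<inter> N y. u y * v z)"
  proof (intro sum.cong refl)
    fix y assume "y \<in> S"
    then have y: "y \<in> V" using S by auto
    have "(\<Sum>z\<in>N y. v z) = (\<Sum>z\<in>S \<inter> N y. v z)"
      using locally_finite v y by (intro sum.mono_neutral_right) (auto simp: locally_finite_def)
    then show "u y * A v y = (\<Sum>z\<in>S \<inter> N y. u y * v z)" using y by (simp add: adj_op_def sum_distrib_left)
  qed
  also have "\<dots> = (\<Sum>(y, z)\<in>Sigma S (\<lambda>y. S \<inter> N y). u y * v z)"
    using S by (intro sum.Sigma) auto
  also have "Sigma S (\<lambda>y. S \<inter> N y) = (S \<times> S) \<inter> edges (fst g)"
    by (auto simp: neighbours_def)
  finally show ?thesis .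
qed

lemma common_support:
  obtains S where "finite S" "S \<subseteq> V" "\<And>y. pvec p y \<noteq> 0 \<Longrightarrow> y \<in> S" "\<And>y. pvec q y \<noteq> 0 \<Longrightarrow> y \<in> S"
  using that[of "{y. pvec p y \<noteq> 0} \<union> {y. pvec q y \<noteq> 0}"] finite_support[of p] finite_support[of q]
    poly_vector_outside by blast

lemma inner_product_add_left:
  "inner_product (\<lambda>y. c * walk_vector g 0 y + A (pvec p) y) (pvec q) = c * pvec q (snd g) + inner_product (A (pvec p)) (pvec q)"
proof -
  obtain S where S: "finite S" "S \<subseteq> V" "\<And>y. pvec (pCons c p) y \<noteq> 0 \<Longrightarrow> y \<in> S"
     "\<And>y. pvec (pCons 0 p) y \<noteq> 0 \<Longrightarrow> y \<in> S" by (rule common_support[of "pCons c p" "pCons 0 p"], rule that)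
  define S' where "S' = insert (snd g) S"
  have S': "finite S'" using S by (simp add: S'_def)
  have "inner_product (\<lambda>y. c * walk_vector g 0 y + A (pvec p) y) (pvec q)
    = (\<Sum>y\<in>S'. (c * walk_vector g 0 y + A (pvec p) y) * pvec q y)"
    using S(3) by (intro inner_product_eq_sum S') (auto simp: poly_vector_pCons_adj S'_def)
  also have "\<dots> = (\<Sum>y\<in>S'. c * walk_vector g 0 y * pvec q y) + (\<Sum>y\<in>S'. A (pvec p) y * pvec q y)"
    by (simp add: sum.distrib distrib_right)
  also have "(\<Sum>y\<in>S'. A (pvec p) y * pvec q y) = inner_product (A (pvec p)) (pvec q)"
    using S(4) by (intro inner_product_eq_sum[symmetric] S') (auto simp: poly_vector_pCons_adj S'_def)
  also have "(\<Sum>y\<in>S'. c * walk_vector g 0 y * pvec q y) = (\<Sum>y\<in>{snd g}. c * walk_vector g 0 y * pvec q y)"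
    using S' by (intro sum.mono_neutral_right) (auto simp: S'_def walk_vector_0)
  finally show ?thesis by (simp add: walk_vector_0)
qed

lemma inner_product_commute:
  "inner_product (pvec p) (pvec q) = inner_product (pvec q) (pvec p)"
proof -
  obtain S where S: "finite S" "S \<subseteq> V" "\<And>y. pvec p y \<noteq> 0 \<Longrightarrow> y \<in> S" "\<And>y. pvec q y \<noteq> 0 \<Longrightarrow> y \<in> S"
    by (rule common_support[of p q], rule that)
  then show ?thesis by (simp add: inner_product_eq_sum[OF S(1)] mult.commute)
qed

lemma adj_self_adjoint:
  "inner_product (A (pvec p)) (pvec q) = inner_product (pvec p) (A (pvec q))"
proof -
  obtain S where S: "finite S" "S \<subseteq> V" "\<And>y. pvec p y \<noteq> 0 \<Longrightarrow> y \<in> S" "\<And>y. pvec q y \<noteq> 0 \<Longrightarrow> y \<in> S"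
    by (rule common_support[of p q], rule that)
  have A: "A (pvec p) = pvec (pCons 0 p)" by (rule ext) (simp add: poly_vector_pCons_adj)
  have "inner_product (A (pvec p)) (pvec q) = inner_product (pvec q) (A (pvec p))"
    unfolding A by (rule inner_product_commute)
  also have "\<dots> = (\<Sum>(y, z)\<in>(S \<times> S) \<inter> edges (fst g). pvec q y * pvec p z)" by (rule adj_form[OF S(1,2,4,3)])
  also have "\<dots> = (\<Sum>(y, z)\<in>(S \<times> S) \<inter> edges (fst g). pvec p y * pvec q z)"
    using simple by (intro sum.reindex_bij_witness[where i = prod.swap and j = prod.swap])
      (auto simp: simple_graph_def sym_def mult.commute)
  also have "\<dots> = inner_product (pvec p) (A (pvec q))" by (rule adj_form[OF S(1,2,3,4), symmetric])
  finally show ?thesis .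
qed

text \<open>Self-adjointness moves the factors of the operator from the left vector to the right
  one, one at a time, along the Horner form of \<open>p\<close>. In particular the moment of a
  square is a squared norm.\<close>

lemma inner_product_poly_vector: "inner_product (pvec p) (pvec q) = poly_moment g (p * q)"
proof (induction p arbitrary: q rule: pCons_induct)
  case 0
  then show ?case by (simp add: inner_product_def poly_moment_eq_poly_vector)
next
  case (pCons c p)
  have e: "pvec (pCons c p) = (\<lambda>y. c * walk_vector g 0 y + A (pvec p) y)"
    by (rule ext) (rule poly_vector_pCons_adj)
  have A: "A (pvec q) = pvec (pCons 0 q)" by (rule ext) (simp add: poly_vector_pCons_adj)
  have "inner_product (pvec (pCons c p)) (pvec q) = c * pvec q (snd g) + inner_product (pvec p) (pvec (pCons 0 q))"
    unfolding e inner_product_add_left adj_self_adjoint A ..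
  also have "\<dots> = c * pvec q (snd g) + poly_moment g (p * pCons 0 q)" by (simp add: pCons.IH)
  finally show ?case by (simp add: poly_moment_eq_poly_vector poly_vector_add poly_vector_smult)
qed

text \<open>Each product over an edge is at most half the sum of the two squares, and each vertex
  lies in at most \<open>D\<close> edges. This bounds the operator by \<open>D\<close> in the
  quadratic form sense.\<close>

lemma adj_form_bound: "\<bar>inner_product (pvec p) (A (pvec p))\<bar> \<le> real D * inner_product (pvec p) (pvec p)"
proof -
  obtain S where S: "finite S" "S \<subseteq> V" "\<And>y. pvec p y \<noteq> 0 \<Longrightarrow> y \<in> S" "\<And>y. pvec p y \<noteq> 0 \<Longrightarrow> y \<in> S"
    by (rule common_support[of p p], rule that)
  let ?E = "(S \<times> S) \<inter> edges (fst g)" and ?u = "pvec p"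
  have E: "?E = Sigma S (\<lambda>y. S \<inter> N y)" by (auto simp: neighbours_def)
  have half: "(\<Sum>(y, z)\<in>?E. (?u y)\<^sup>2) \<le> real D * (\<Sum>y\<in>S. (?u y)\<^sup>2)"
  proof -
    have "(\<Sum>(y, z)\<in>?E. (?u y)\<^sup>2) = (\<Sum>y\<in>S. real (card (S \<inter> N y)) * (?u y)\<^sup>2)"
      unfolding E using S by (subst sum.Sigma[symmetric]) auto
    also have "\<dots> \<le> (\<Sum>y\<in>S. real D * (?u y)\<^sup>2)"
    proof (intro sum_mono mult_right_mono)
      fix y assume "y \<in> S"
      then have y: "y \<in> V" using S by auto
      then have "card (S \<inter> N y) \<le> card (N y)" using locally_finite by (intro card_mono) (auto simp: locally_finite_def)
      then show "real (card (S \<inter> N y)) \<le> real D" using degree[OF y] by simp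
    qed simp
    finally show ?thesis by (simp add: sum_distrib_left)
  qed
  have swap: "(\<Sum>(y, z)\<in>?E. (?u z)\<^sup>2) = (\<Sum>(y, z)\<in>?E. (?u y)\<^sup>2)"
    using simple by (intro sum.reindex_bij_witness[where i = prod.swap and j = prod.swap])
      (auto simp: simple_graph_def sym_def)
  have "\<bar>inner_product ?u (A ?u)\<bar> = \<bar>\<Sum>(y, z)\<in>?E. ?u y * ?u z\<bar>" by (simp add: adj_form[OF S])
  also have "\<dots> \<le> (\<Sum>(y, z)\<in>?E. ((?u y)\<^sup>2 + (?u z)\<^sup>2) / 2)"
  proof (intro order_trans[OF sum_abs] sum_mono)
    fix yz assume "yz \<in> ?E"
    obtain y z where yz: "yz = (y, z)" by (cases yz)
    have "2 * \<bar>?u y * ?u z\<bar> \<le> (?u y)\<^sup>2 + (?u z)\<^sup>2"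
      using sum_squares_bound[of "\<bar>?u y\<bar>" "\<bar>?u z\<bar>"] by (simp add: abs_mult)
    then show "\<bar>case yz of (y, z) \<Rightarrow> ?u y * ?u z\<bar> \<le> (case yz of (y, z) \<Rightarrow> ((?u y)\<^sup>2 + (?u z)\<^sup>2) / 2)"
      by (simp add: yz)
  qed
  also have "\<dots> = ((\<Sum>(y, z)\<in>?E. (?u y)\<^sup>2) + (\<Sum>(y, z)\<in>?E. (?u z)\<^sup>2)) / 2"
    by (simp add: case_prod_beta sum.distrib sum_divide_distrib[symmetric])
  also have "\<dots> \<le> real D * (\<Sum>y\<in>S. (?u y)\<^sup>2)" using half swap by simp
  also have "(\<Sum>y\<in>S. (?u y)\<^sup>2) = inner_product ?u ?u"
    by (simp add: inner_product_eq_sum[OF S(1,3)] power2_eq_square)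
  finally show ?thesis .
qed

text \<open>\<open>X\<close> maps \<open>[-D, D]\<close> onto \<open>[0, 1]\<close>, and \<open>Y = 1 - X\<close>.\<close>

definition "X = [:1/2, 1 / (2 * real D):]"
definition "Y = [:1/2, - 1 / (2 * real D):]"

lemma X_plus_Y: "X + Y = 1" by (simp add: X_def Y_def)

text \<open>The form bound makes D + A and D - A positive; the sign \<open>e\<close> treats the two
  cases, that is \<open>X\<close> and \<open>Y\<close>, together.\<close>

lemma moment_nonneg_aux:
  assumes e: "e = 1 \<or> e = -1"
  shows "poly_moment g ([:1/2, e / (2 * real D):] * (p * p)) \<ge> 0"
proof -
  have A: "A (pvec p) = pvec (pCons 0 p)" by (rule ext) (simp add: poly_vector_pCons_adj)
  have "[:1/2, e / (2 * real D):] * (p * p) = smult (1/2) (p * p) + smult (e / (2 * real D)) (p * pCons 0 p)"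
    by simp
  then have eq: "poly_moment g ([:1/2, e / (2 * real D):] * (p * p))
     = 1/2 * inner_product (pvec p) (pvec p) + e / (2 * real D) * inner_product (pvec p) (A (pvec p))"
    unfolding A inner_product_poly_vector
    by (simp only: poly_moment_eq_poly_vector poly_vector_add poly_vector_smult)
  define z where "z = poly_moment g ([:1/2, e / (2 * real D):] * (p * p))"
  have "2 * real D * z = real D * inner_product (pvec p) (pvec p) + e * inner_product (pvec p) (A (pvec p))"
    unfolding z_def eq using D by (simp add: field_simps)
  also have "\<dots> \<ge> 0" using adj_form_bound[of p] e by auto
  finally have "z \<ge> 0" using D by (simp add: zero_le_mult_iff)
  then show ?thesis by (simp only: z_def)
qed

lemma moment_nonneg_square: "poly_moment g (p * p) \<ge> 0"
  unfolding inner_product_poly_vector[symmetric] inner_product_def by (intro sum_nonneg) auto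

lemma poly_moment_add: "poly_moment g (p + q) = poly_moment g p + poly_moment g q"
  by (simp add: poly_moment_eq_poly_vector poly_vector_add)

text \<open>The product is a square, or a square times one factor \<open>X\<close> or one factor
  \<open>Y\<close>; two single factors cannot remain.\<close>

lemma moment_nonneg_even:
  assumes "even k \<or> even m" shows "poly_moment g (X ^ k * Y ^ m) \<ge> 0"
proof -
  obtain i j where "k = 2 * i \<or> k = 2 * i + 1" "m = 2 * j \<or> m = 2 * j + 1"
    by (metis evenE oddE)
  then consider "k = 2 * i" "m = 2 * j" | "k = 2 * i + 1" "m = 2 * j" | "k = 2 * i" "m = 2 * j + 1"
    using assms by auto
  then show ?thesis
  proof cases
    case 1
    have "X ^ k * Y ^ m = (X ^ i * Y ^ j) * (X ^ i * Y ^ j)"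
      unfolding 1 mult_2 power_add by (simp only: mult_ac)
    then show ?thesis using moment_nonneg_square[of "X ^ i * Y ^ j"] by simp
  next
    case 2
    have "X ^ k * Y ^ m = X * ((X ^ i * Y ^ j) * (X ^ i * Y ^ j))"
      unfolding 2 mult_2 power_add power_one_right by (simp only: mult_ac)
    then show ?thesis using moment_nonneg_aux[of 1 "X ^ i * Y ^ j"] by (simp only: X_def) simp
  next
    case 3
    have "X ^ k * Y ^ m = Y * ((X ^ i * Y ^ j) * (X ^ i * Y ^ j))"
      unfolding 3 mult_2 power_add power_one_right by (simp only: mult_ac)
    then show ?thesis using moment_nonneg_aux[of "-1" "X ^ i * Y ^ j"] by (simp only: Y_def) simp
  qed
qed

text \<open>Multiplying by \<open>X + Y = 1\<close> reduces the case of two odd exponents to the others.\<close>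

lemma moment_nonneg: "poly_moment g (X ^ k * Y ^ m) \<ge> 0"
proof (cases "even k \<or> even m")
  case False
  have "X ^ k * Y ^ m = X ^ k * Y ^ m * (X + Y)" by (simp add: X_plus_Y)
  also have "\<dots> = X ^ Suc k * Y ^ m + X ^ k * Y ^ Suc m" by (simp add: algebra_simps)
  finally have "poly_moment g (X ^ k * Y ^ m) = poly_moment g (X ^ Suc k * Y ^ m) + poly_moment g (X ^ k * Y ^ Suc m)"
    by (simp only: poly_moment_add)
  then show ?thesis using False moment_nonneg_even[of "Suc k" m] moment_nonneg_even[of k "Suc m"] by simp
qed (rule moment_nonneg_even)

section \<open>Bernstein weights and their weak limit\<close>

definition weight :: "nat \<Rightarrow> nat \<Rightarrow> real" where
  "weight n k = poly_moment g (smult (real (n choose k)) (X ^ k * Y ^ (n - k)))"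

lemma poly_moment_smult: "poly_moment g (smult c p) = c * poly_moment g p"
  by (simp add: poly_moment_eq_poly_vector poly_vector_smult)

lemma poly_moment_sum: "poly_moment g (\<Sum>k\<in>K. f k) = (\<Sum>k\<in>K. poly_moment g (f k))"
  by (simp add: poly_moment_eq_poly_vector poly_vector_sum)

lemma weight_nonneg: "weight n k \<ge> 0"
  unfolding weight_def poly_moment_smult using moment_nonneg by simp

text \<open>The weights are the moments of the Bernstein basis polynomials in \<open>X\<close>.
  Multiplying X^j by (X + Y)^(n - j) = 1 and expanding gives an exact identity with quotients of
  binomial coefficients; powers of k/n would only give it asymptotically.\<close>

lemma weight_factorial_moment:
  assumes j: "j \<le> n"
  shows "(\<Sum>k\<le>n. weight n k * (real (k choose j) / real (n choose j))) = poly_moment g (X ^ j)"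
proof -
  have "X ^ j = X ^ j * (X + Y) ^ (n - j)" by (simp add: X_plus_Y)
  also have "\<dots> = (\<Sum>i\<le>n - j. of_nat ((n - j) choose i) * (X ^ (i + j) * Y ^ (n - j - i)))"
    unfolding binomial_ring by (simp add: sum_distrib_left power_add mult_ac)
  also have "\<dots> = (\<Sum>k\<in>{j..n}. of_nat ((n - j) choose (k - j)) * (X ^ k * Y ^ (n - k)))"
    using j by (intro sum.reindex_bij_witness[where i = "\<lambda>k. k - j" and j = "\<lambda>i. i + j"]) (auto simp: algebra_simps)
  finally have "poly_moment g (X ^ j) = (\<Sum>k\<in>{j..n}. real ((n - j) choose (k - j)) * poly_moment g (X ^ k * Y ^ (n - k)))"
    by (simp add: poly_moment_sum of_nat_poly poly_moment_smult)
  also have "\<dots> = (\<Sum>k\<in>{j..n}. weight n k * (real (k choose j) / real (n choose j)))"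
  proof (intro sum.cong refl)
    fix k assume k: "k \<in> {j..n}"
    have "(n choose k) * (k choose j) = (n choose j) * ((n - j) choose (k - j))"
      using k by (intro choose_mult) auto
    then have "real (n choose k) * real (k choose j) = real (n choose j) * real ((n - j) choose (k - j))"
      by (metis of_nat_mult)
    moreover have "real (n choose j) \<noteq> 0" using j by simp
    ultimately have "real ((n - j) choose (k - j)) = real (n choose k) * (real (k choose j) / real (n choose j))"
      by (simp add: field_simps)
    then show "real ((n - j) choose (k - j)) * poly_moment g (X ^ k * Y ^ (n - k))
      = weight n k * (real (k choose j) / real (n choose j))"
      by (simp add: weight_def poly_moment_smult)
  qed
  also have "\<dots> = (\<Sum>k\<le>n. weight n k * (real (k choose j) / real (n choose j)))"
    by (intro sum.mono_neutral_left) (auto simp: not_le)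
  finally show ?thesis by simp
qed

lemma poly_moment_1: "poly_moment g 1 = 1"
  by (simp add: poly_moment_def closed_walks_def walk_vector_0)

lemma sum_weight: "(\<Sum>k\<le>n. weight n k) = 1"
  using weight_factorial_moment[of 0 n] by (simp add: poly_moment_1)

text \<open>Both sides are products of j factors of absolute value at most 1, so the difference is
  at most the sum of the differences of the factors, each at most j/(n - j). Factors with i > k are
  negative, and n > 2j keeps them above -1.\<close>

lemma binomial_quotient_approx:
  assumes k: "k \<le> n" and n: "n > 2 * j"
  shows "\<bar>real (k choose j) / real (n choose j) - (real k / real n) ^ j\<bar> \<le> real (j * j) / real (n - j)"
proof -
  have eq: "real (k choose j) / real (n choose j) = (\<Prod>i\<in>{0..<j}. (real k - real i) / (real n - real i))"
    unfolding binomial_gbinomial gbinomial_prod_rev by (simp add: prod_dividef)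
  have "\<bar>(\<Prod>i\<in>{0..<j}. (real k - real i) / (real n - real i)) - (\<Prod>i\<in>{0..<j}. real k / real n)\<bar>
     \<le> (\<Sum>i\<in>{0..<j}. \<bar>(real k - real i) / (real n - real i) - real k / real n\<bar>)"
  proof (rule norm_prod_diff[where 'a = real, unfolded real_norm_def])
    fix i assume i: "i \<in> {0..<j}"
    show "\<bar>(real k - real i) / (real n - real i)\<bar> \<le> 1"
      using i k n by (auto simp: divide_simps abs_le_iff)
    show "\<bar>real k / real n\<bar> \<le> 1" using k n by (auto simp: divide_simps)
  qed
  also have "\<dots> \<le> (\<Sum>i\<in>{0..<j}. real j / real (n - j))"
  proof (intro sum_mono)
    fix i assume i: "i \<in> {0..<j}"
    have pos: "real n - real i > 0" "real n > 0" using i n by auto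
    have "(real k - real i) / (real n - real i) - real k / real n = - (real i / (real n - real i) * ((real n - real k) / real n))"
      using pos by (simp add: field_simps)
    then have "\<bar>(real k - real i) / (real n - real i) - real k / real n\<bar> = real i / (real n - real i) * ((real n - real k) / real n)"
      using pos k by (simp add: abs_mult)
    also have "\<dots> \<le> real i / (real n - real i) * 1"
      using pos k by (intro mult_left_mono) (auto simp: divide_simps)
    also have "\<dots> \<le> real j / real (n - j)" using i n by (simp add: of_nat_diff frac_le)
    finally show "\<bar>(real k - real i) / (real n - real i) - real k / real n\<bar> \<le> real j / real (n - j)" .
  qed
  finally show ?thesis unfolding eq by simp
qed

definition bernstein_measure :: "nat \<Rightarrow> real measure" where
  "bernstein_measure n = distr (point_measure {..n} (\<lambda>k. ennreal (weight n k))) borel (\<lambda>k. real k / real n)"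

lemma real_distribution_bernstein: "real_distribution (bernstein_measure n)"
proof -
  have "emeasure (point_measure {..n} (\<lambda>k. ennreal (weight n k))) {..n} = (\<Sum>k\<le>n. ennreal (weight n k))"
    by (rule emeasure_point_measure_finite) auto
  also have "\<dots> = 1" using weight_nonneg by (simp add: sum_ennreal sum_weight)
  finally have "prob_space (point_measure {..n} (\<lambda>k. ennreal (weight n k)))"
    by (intro prob_spaceI) (simp add: space_point_measure)
  then interpret prob_space "point_measure {..n} (\<lambda>k. ennreal (weight n k))" .
  show ?thesis unfolding bernstein_measure_def
    by (intro real_distribution_distr) (auto simp: point_measure_def)
qed

lemma integral_bernstein:
  assumes f: "f \<in> borel_measurable borel"
  shows "integral\<^sup>L (bernstein_measure n) f = (\<Sum>k\<le>n. weight n k * (f (real k / real n) :: real))"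
proof -
  have "integral\<^sup>L (bernstein_measure n) f
     = integral\<^sup>L (point_measure {..n} (\<lambda>k. ennreal (weight n k))) (\<lambda>k. f (real k / real n))"
    unfolding bernstein_measure_def using f by (intro integral_distr) (auto simp: point_measure_def)
  also have "\<dots> = (\<Sum>k\<le>n. weight n k * f (real k / real n))"
    using weight_nonneg by (subst lebesgue_integral_point_measure_finite) auto
  finally show ?thesis .
qed

text \<open>All masses sit in [0, 1], also for n = 0, where k/0 = 0. The left end -1 leaves room for
  the atom at 0 in a half-open interval.\<close>

lemma bernstein_tight: "tight bernstein_measure"
  unfolding tight_def
proof (intro conjI allI impI)
  fix \<epsilon> :: real assume \<epsilon>: "\<epsilon> > 0"
  have "measure (bernstein_measure n) {-1<..1} > 1 - \<epsilon>" for n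
  proof -
    interpret real_distribution "bernstein_measure n" by (rule real_distribution_bernstein)
    have "measure (bernstein_measure n) {-1<..1} = integral\<^sup>L (bernstein_measure n) (indicator {-1<..1})"
      by simp
    also have "\<dots> = (\<Sum>k\<le>n. weight n k * indicator {-1<..1} (real k / real n))"
      by (intro integral_bernstein) auto
    also have "\<dots> = (\<Sum>k\<le>n. weight n k)"
    proof (intro sum.cong refl)
      fix k assume "k \<in> {..n}"
      then have "real k / real n \<le> 1" by (auto simp: divide_simps)
      moreover have "-1 < real k / real n" by (rule less_le_trans[of _ 0]) auto
      ultimately show "weight n k * indicator {-1<..1} (real k / real n) = weight n k" by (simp add: indicator_def)
    qed
    finally show ?thesis using \<epsilon> by (simp add: sum_weight)
  qed
  then show "\<exists>a b. a < b \<and> (\<forall>n. 1 - \<epsilon> < measure (bernstein_measure n) {a<..b})"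
    by (intro exI[of _ "-1"] exI[of _ 1]) auto
qed (rule real_distribution_bernstein)

text \<open>Tightness yields a weakly convergent subsequence. Its moments are the limits of the
  power sums of k/n, which agree with the binomial quotients up to an error tending to 0.\<close>

lemma bernstein_limit:
  obtains M where "real_distribution M" "AE y in M. y \<in> {0..1}"
    "\<And>j. (\<integral>y. y ^ j \<partial>M) = poly_moment g (X ^ j)"
proof -
  obtain r M where r: "strict_mono (r :: nat \<Rightarrow> nat)" and M: "real_distribution M"
     and w: "weak_conv_m (bernstein_measure \<circ> id \<circ> r) M"
    using tight_imp_convergent_subsubsequence[OF bernstein_tight strict_mono_id] by blast
  interpret M: real_distribution M by (rule M)
  have w': "weak_conv_m (\<lambda>n. bernstein_measure (r n)) M" using w by (simp add: o_def)
  \<comment> \<open>Weak convergence tests only bounded continuous functions, so y is clipped to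
    [0, 1]; on the atoms k/n nothing changes.\<close>
  define cl where "cl y = max 0 (min 1 y)" for y :: real
  have cl: "0 \<le> cl y" "cl y \<le> 1" for y by (auto simp: cl_def)
  have clc: "isCont cl y" for y unfolding cl_def[abs_def] by (intro continuous_intros)
  have clm[measurable]: "cl \<in> borel_measurable borel"
    using clc by (intro borel_measurable_continuous_onI) (simp add: continuous_on_eq_continuous_at)
  have clk: "cl (real k / real n) = real k / real n" if "k \<le> n" for k n
    using that by (auto simp: cl_def divide_simps)
  have conv: "(\<lambda>n. integral\<^sup>L (bernstein_measure (r n)) f) \<longlonglongrightarrow> integral\<^sup>L M f"
    if "\<And>x. isCont f x" "\<And>x. \<bar>f x\<bar> \<le> B" for f :: "real \<Rightarrow> real" and B
    using weak_conv_imp_integral_bdd_continuous_conv[OF real_distribution_bernstein M w', of f B] that by simp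
  have supp: "AE y in M. y \<in> {0..1}"
  proof -
    \<comment> \<open>Bounded, continuous and zero exactly on [0, 1]: its integrals against the
      Bernstein measures vanish, hence so does its integral against the limit.\<close>
    define f where "f y = min 1 \<bar>y - cl y\<bar>" for y
    have fb: "\<bar>f y\<bar> \<le> 1" for y by (auto simp: f_def)
    have fc: "isCont f y" for y unfolding f_def[abs_def] by (intro continuous_intros clc)
    have fm[measurable]: "f \<in> borel_measurable borel" unfolding f_def[abs_def] by measurable
    have "integral\<^sup>L (bernstein_measure n) f = 0" for n
      unfolding integral_bernstein[OF fm] by (intro sum.neutral) (auto simp: f_def clk)
    then have "(\<lambda>n. 0) \<longlonglongrightarrow> integral\<^sup>L M f" using conv[OF fc fb] by simp
    then have "integral\<^sup>L M f = 0" using LIMSEQ_unique tendsto_const by blast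
    moreover have "integrable M f" by (intro M.integrable_const_bound[of _ 1]) (auto simp: fb)
    ultimately have "AE y in M. f y = 0" by (subst integral_nonneg_eq_0_iff_AE[symmetric]) (auto simp: f_def)
    then show ?thesis by eventually_elim (auto simp: f_def cl_def min_def max_def split: if_splits)
  qed
  have mom: "(\<integral>y. y ^ j \<partial>M) = poly_moment g (X ^ j)" for j
  proof -
    have bd: "\<bar>cl y ^ j\<bar> \<le> 1" for y using cl[of y] by (simp add: power_le_one)
    have m: "(\<lambda>y. cl y ^ j) \<in> borel_measurable borel" by measurable
    have lim1: "(\<lambda>n. integral\<^sup>L (bernstein_measure (r n)) (\<lambda>y. cl y ^ j)) \<longlonglongrightarrow> integral\<^sup>L M (\<lambda>y. cl y ^ j)"
      by (rule conv[OF _ bd]) (intro continuous_intros clc)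
    have lim2: "(\<lambda>n. integral\<^sup>L (bernstein_measure n) (\<lambda>y. cl y ^ j)) \<longlonglongrightarrow> poly_moment g (X ^ j)"
    proof (rule Lim_transform_bound[THEN LIM_zero_cancel, rotated])
      show "(\<lambda>n. real (j * j) / real (n - j)) \<longlonglongrightarrow> 0"
      proof (rule LIMSEQ_offset[of _ j])
        show "(\<lambda>n. real (j * j) / real (n + j - j)) \<longlonglongrightarrow> 0" by (simp add: lim_const_over_n)
      qed
      show "\<forall>\<^sub>F n in sequentially. norm (integral\<^sup>L (bernstein_measure n) (\<lambda>y. cl y ^ j) - poly_moment g (X ^ j))
          \<le> norm (real (j * j) / real (n - j))"
      proof (rule eventually_sequentiallyI[of "2 * j + 1"])
        fix n assume n: "2 * j + 1 \<le> n"
        have "integral\<^sup>L (bernstein_measure n) (\<lambda>y. cl y ^ j) - poly_moment g (X ^ j)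
          = (\<Sum>k\<le>n. weight n k * (cl (real k / real n) ^ j - real (k choose j) / real (n choose j)))"
          using weight_factorial_moment[of j n] n unfolding integral_bernstein[OF m]
          by (simp add: sum_subtractf right_diff_distrib)
        also have "\<bar>\<dots>\<bar> \<le> (\<Sum>k\<le>n. weight n k * (real (j * j) / real (n - j)))"
        proof (intro order_trans[OF sum_abs] sum_mono)
          fix k assume "k \<in> {..n}"
          then have "\<bar>cl (real k / real n) ^ j - real (k choose j) / real (n choose j)\<bar> \<le> real (j * j) / real (n - j)"
            using binomial_quotient_approx[of k n j] n by (simp add: clk abs_minus_commute)
          then show "\<bar>weight n k * (cl (real k / real n) ^ j - real (k choose j) / real (n choose j))\<bar>
            \<le> weight n k * (real (j * j) / real (n - j))"
            unfolding abs_mult abs_of_nonneg[OF weight_nonneg] by (intro mult_left_mono weight_nonneg)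
        qed
        also have "\<dots> = real (j * j) / real (n - j)" by (simp only: sum_distrib_right[symmetric] sum_weight) simp
        finally show "norm (integral\<^sup>L (bernstein_measure n) (\<lambda>y. cl y ^ j) - poly_moment g (X ^ j))
          \<le> norm (real (j * j) / real (n - j))" by simp
      qed
    qed
    have "integral\<^sup>L M (\<lambda>y. cl y ^ j) = poly_moment g (X ^ j)"
      using LIMSEQ_unique[OF lim1 LIMSEQ_subseq_LIMSEQ[OF lim2 r, unfolded o_def]] .
    moreover have "integral\<^sup>L M (\<lambda>y. cl y ^ j) = (\<integral>y. y ^ j \<partial>M)"
    proof (rule integral_cong_AE)
      show "AE y in M. cl y ^ j = y ^ j" using supp by eventually_elim (auto simp: cl_def)
    qed auto
    ultimately show ?thesis by simp
  qed
  show thesis by (rule that[OF M supp mom])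
qed

text \<open>The limit measure on [0, 1] is transported by the affine map \<open>\<tau>\<close>,
  inverse to \<open>X\<close>. Every polynomial is re-expanded in powers of \<open>X\<close>, where
  the moments are known.\<close>

lemma moment_measure_exists:
  obtains M where "real_distribution M" "AE t in M. \<bar>t\<bar> \<le> real D"
    "\<And>p. (\<integral>t. poly p t \<partial>M) = poly_moment g p"
proof -
  obtain M where M: "real_distribution M" and supp: "AE y in M. y \<in> {0..1}"
    and mom: "\<And>j. (\<integral>y. y ^ j \<partial>M) = poly_moment g (X ^ j)" by (rule bernstein_limit, rule that)
  interpret M: real_distribution M by (rule M)
  define \<tau> where "\<tau> y = real D * (2 * y - 1)" for y
  have [measurable]: "\<tau> \<in> borel_measurable borel" unfolding \<tau>_def[abs_def] by measurable
  have intp: "integrable M (\<lambda>y. y ^ j)" for j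
  proof (rule M.integrable_const_bound[of _ 1])
    show "AE y in M. norm (y ^ j) \<le> 1" using supp by eventually_elim (auto simp: power_le_one)
  qed auto
  define L where "L = [:- real D, 2 * real D:]"
  have "(\<integral>t. poly p t \<partial>distr M borel \<tau>) = poly_moment g p" for p
  proof -
    let ?Q = "p \<circ>\<^sub>p L"
    have pL: "poly p (\<tau> y) = (\<Sum>j\<le>degree ?Q. coeff ?Q j * y ^ j)" for y
    proof -
      have "poly p (\<tau> y) = poly ?Q y" by (simp add: poly_pcompose L_def \<tau>_def algebra_simps)
      then show ?thesis by (simp only: poly_altdef)
    qed
    have "p = (\<Sum>j\<le>degree ?Q. smult (coeff ?Q j) (X ^ j))"
    proof (rule poly_eq_poly_eq_iff[THEN iffD1], rule ext)
      fix t
      have "\<tau> (poly X t) = t" using D by (simp add: \<tau>_def X_def field_simps)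
      then show "poly p t = poly (\<Sum>j\<le>degree ?Q. smult (coeff ?Q j) (X ^ j)) t"
        using pL[of "poly X t"] by (simp add: poly_sum)
    qed
    then have "poly_moment g p = (\<Sum>j\<le>degree ?Q. coeff ?Q j * poly_moment g (X ^ j))"
      by (metis (no_types, lifting) poly_moment_smult poly_moment_sum sum.cong)
    moreover have "(\<integral>t. poly p t \<partial>distr M borel \<tau>) = (\<integral>y. (\<Sum>j\<le>degree ?Q. coeff ?Q j * y ^ j) \<partial>M)"
      unfolding pL[symmetric] by (intro integral_distr) (auto intro!: borel_measurable_continuous_onI continuous_intros)
    moreover have "\<dots> = (\<Sum>j\<le>degree ?Q. coeff ?Q j * poly_moment g (X ^ j))"
      using intp by (subst Bochner_Integration.integral_sum) (auto simp: mom)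
    ultimately show ?thesis by simp
  qed
  moreover have "AE t in distr M borel \<tau>. \<bar>t\<bar> \<le> real D"
  proof (subst AE_distr_iff)
    show "AE y in M. \<bar>\<tau> y\<bar> \<le> real D" using supp
    proof eventually_elim
      case (elim y)
      then have "\<bar>2 * y - 1\<bar> \<le> 1" by auto
      then show ?case unfolding \<tau>_def abs_mult using D by (simp add: mult_left_le)
    qed
  qed auto
  moreover have "real_distribution (distr M borel \<tau>)" by (intro M.real_distribution_distr) auto
  ultimately show thesis using that by blast
qed

end

section \<open>The resolvent at the root\<close>

lemma ell2_inner_delta:
  assumes "a \<in> V" shows "ell2_inner V (delta a) f = f a"
proof -
  have "ell2_inner V (delta a) f = (\<Sum>\<^sub>\<infinity>x\<in>{a}. cnj (delta a x) * f x)"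
    unfolding ell2_inner_def using assms by (intro infsum_cong_neutral) (auto simp: delta_def)
  then show ?thesis by (simp add: delta_def)
qed

lemma polynomial_approx:
  fixes f :: "real \<Rightarrow> real"
  assumes "continuous_on {a..b} f" "\<epsilon> > 0"
  obtains p where "\<And>t. t \<in> {a..b} \<Longrightarrow> \<bar>poly p t - f t\<bar> \<le> \<epsilon>"
proof -
  obtain g where g: "real_polynomial_function g" "\<And>x. x \<in> {a..b} \<Longrightarrow> \<bar>f x - g x\<bar> < \<epsilon>"
    using Stone_Weierstrass_real_polynomial_function[OF compact_Icc assms] by blast
  then obtain c n where gc: "g = (\<lambda>x. \<Sum>i\<le>n. c i * x ^ i)"
    unfolding real_polynomial_function_iff_sum by blast
  have "poly (\<Sum>i\<le>n. monom (c i) i) t = g t" for t by (simp add: gc poly_sum poly_monom)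
  then show thesis using g(2) by (intro that[of "\<Sum>i\<le>n. monom (c i) i"]) (simp add: abs_minus_commute less_imp_le)
qed

context bounded_degree_graph
begin

text \<open>The squared norm of p(A) \<delta>_o is the integral of p^2 against a measure on [-D, D].
  This replaces an operator norm bound and turns uniform approximation of functions into
  approximation of vectors.\<close>

lemma sup_bound:
  assumes p: "\<And>t. \<bar>t\<bar> \<le> real D \<Longrightarrow> \<bar>poly p t\<bar> \<le> \<epsilon>"
  shows "finite S \<Longrightarrow> (\<Sum>y\<in>S. (pvec p y)\<^sup>2) \<le> \<epsilon>\<^sup>2" and "\<bar>pvec p y\<bar> \<le> \<epsilon>"
proof -
  obtain M where M: "real_distribution M" and supp: "AE t in M. \<bar>t\<bar> \<le> real D"
    and mom: "\<And>p. (\<integral>t. poly p t \<partial>M) = poly_moment g p" by (rule moment_measure_exists, rule that)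
  interpret M: real_distribution M by (rule M)
  have \<epsilon>: "\<epsilon> \<ge> 0" using p[of 0] by simp
  have "inner_product (pvec p) (pvec p) = (\<integral>t. poly (p * p) t \<partial>M)"
    by (simp only: inner_product_poly_vector mom)
  also have "\<dots> \<le> \<epsilon>\<^sup>2"
  proof -
    have b: "AE t in M. norm (poly (p * p) t) \<le> \<epsilon>\<^sup>2" using supp
    proof eventually_elim
      case (elim t)
      then have "\<bar>poly p t\<bar> * \<bar>poly p t\<bar> \<le> \<epsilon> * \<epsilon>" using p \<epsilon> by (intro mult_mono) auto
      then show ?case by (simp add: abs_mult power2_eq_square)
    qed
    have m: "poly (p * p) \<in> borel_measurable borel"
      by (intro borel_measurable_continuous_onI continuous_intros)
    have "(\<integral>t. poly (p * p) t \<partial>M) \<le> (\<integral>t. \<epsilon>\<^sup>2 \<partial>M)"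
    proof (rule integral_mono_AE)
      show "integrable M (poly (p * p))" using b m by (intro M.integrable_const_bound[of _ "\<epsilon>\<^sup>2"]) auto
      show "AE t in M. poly (p * p) t \<le> \<epsilon>\<^sup>2" using b by eventually_elim simp
    qed simp
    then show ?thesis using M.prob_space by simp
  qed
  finally have ip: "inner_product (pvec p) (pvec p) \<le> \<epsilon>\<^sup>2" .
  show fin: "(\<Sum>y\<in>S. (pvec p y)\<^sup>2) \<le> \<epsilon>\<^sup>2" if "finite S" for S
  proof -
    have "(\<Sum>y\<in>S. (pvec p y)\<^sup>2) \<le> (\<Sum>y\<in>S \<union> {y. pvec p y \<noteq> 0}. (pvec p y)\<^sup>2)"
      using that finite_support by (intro sum_mono2) auto
    also have "\<dots> = inner_product (pvec p) (pvec p)"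
      using that finite_support by (subst inner_product_eq_sum[of "S \<union> {y. pvec p y \<noteq> 0}"]) (auto simp: power2_eq_square)
    finally show ?thesis using ip by simp
  qed
  have "(pvec p y)\<^sup>2 \<le> \<epsilon>\<^sup>2" using fin[of "{y}"] by simp
  then show "\<bar>pvec p y\<bar> \<le> \<epsilon>" using \<epsilon> by (simp add: abs_le_square_iff[symmetric])
qed

text \<open>The vector (p + i r)(A) \<delta>_o: the kernel 1/(t - z) is approximated through its
  real and imaginary parts.\<close>

definition cvec :: "real poly \<Rightarrow> real poly \<Rightarrow> 'a \<Rightarrow> complex" where
  "cvec p r y = Complex (pvec p y) (pvec r y)"

lemma adj_pvec: "A (pvec p) y = pvec (pCons 0 p) y"
  by (simp add: poly_vector_pCons_adj)

lemma adj_cvec: "adj_op (fst g) (cvec p r) y = Complex (A (pvec p) y) (A (pvec r) y)"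
  by (simp add: adj_op_def cvec_def complex_eq_iff)

text \<open>The two polynomials on the right are the real and imaginary parts of (t - s - i
  \<eta>)(p + i r) - 1, the defect of p + i r as an approximate inverse of t - z.\<close>

lemma shifted_adj_cvec:
  "adj_op (fst g) (cvec p r) y - Complex s \<eta> * cvec p r y
     = delta (snd g) y + cvec ([:-s, 1:] * p + smult \<eta> r - 1) ([:-s, 1:] * r - smult \<eta> p) y"
proof -
  have one: "pvec 1 y = (if y = snd g then 1 else 0)"
    by (simp add: poly_vector_def walk_vector_0)
  have e: "[:-s, 1:] * p = pCons 0 p - smult s p" for p :: "real poly" by simp
  show ?thesis
    unfolding e adj_cvec adj_pvec
    by (simp add: complex_eq_iff cvec_def delta_def poly_vector_diff poly_vector_add poly_vector_smult one
      del: mult_pCons_left mult_pCons_right)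
qed

text \<open>Symmetry of the adjacency relation and the exchange of finite sums; \<open>f\<close> is
  arbitrary because \<open>u\<close> has finite support. \<open>S'\<close> contains the neighbours
  of \<open>S\<close> so that it carries A u. The pairing has no complex conjugation.\<close>

lemma adj_pairing:
  fixes f :: "'a \<Rightarrow> complex"
  assumes S: "finite S" "S \<subseteq> V" and S': "finite S'" "S' \<subseteq> V" "S \<subseteq> S'" "\<And>y. y \<in> S \<Longrightarrow> N y \<subseteq> S'"
    and u: "\<And>y. u y \<noteq> 0 \<Longrightarrow> y \<in> S"
  shows "(\<Sum>y\<in>S'. u y * adj_op (fst g) f y) = (\<Sum>z\<in>S'. adj_op (fst g) u z * f z)"
proof -
  have u0: "u y = 0" if "y \<notin> S" for y using u that by blast
  have "(\<Sum>y\<in>S'. u y * adj_op (fst g) f y) = (\<Sum>y\<in>S. u y * adj_op (fst g) f y)"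
    using S S' u0 by (intro sum.mono_neutral_right) auto
  also have "\<dots> = (\<Sum>y\<in>S. \<Sum>z\<in>N y. u y * f z)"
    using S by (intro sum.cong refl) (auto simp: adj_op_def sum_distrib_left)
  also have "\<dots> = (\<Sum>y\<in>S. \<Sum>z\<in>{z\<in>S'. z \<in> N y}. u y * f z)"
    using S' by (intro sum.cong refl) auto
  also have "\<dots> = (\<Sum>z\<in>S'. \<Sum>y\<in>{y\<in>S. z \<in> N y}. u y * f z)"
    by (rule sum.swap_restrict[OF S(1) S'(1)])
  also have "\<dots> = (\<Sum>z\<in>S'. adj_op (fst g) u z * f z)"
  proof (intro sum.cong refl)
    fix z assume z: "z \<in> S'"
    then have zV: "z \<in> V" using S' by auto
    have "(\<Sum>y\<in>{y\<in>S. z \<in> N y}. u y) = (\<Sum>y\<in>N z. u y)"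
      using locally_finite zV u neighbours_sym[OF simple] by (intro sum.mono_neutral_left) (auto simp: locally_finite_def)
    then show "(\<Sum>y\<in>{y\<in>S. z \<in> N y}. u y * f z) = adj_op (fst g) u z * f z"
      using zV by (simp add: adj_op_def sum_distrib_right[symmetric])
  qed
  finally show ?thesis .
qed

lemma kernel_approx:
  assumes "\<eta> > 0" "\<epsilon> > 0"
  obtains p r where
    "\<And>t. \<bar>t\<bar> \<le> real D \<Longrightarrow> \<bar>poly p t - (t - s) / ((t - s)\<^sup>2 + \<eta>\<^sup>2)\<bar> \<le> \<epsilon>"
    "\<And>t. \<bar>t\<bar> \<le> real D \<Longrightarrow> \<bar>poly r t - \<eta> / ((t - s)\<^sup>2 + \<eta>\<^sup>2)\<bar> \<le> \<epsilon>"
proof -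
  have nz: "(t - s)\<^sup>2 + \<eta>\<^sup>2 \<noteq> 0" for t using assms by (simp add: add_nonneg_eq_0_iff)
  have c1: "continuous_on {-real D..real D} (\<lambda>t. (t - s) / ((t - s)\<^sup>2 + \<eta>\<^sup>2))"
    and c2: "continuous_on {-real D..real D} (\<lambda>t. \<eta> / ((t - s)\<^sup>2 + \<eta>\<^sup>2))"
    using nz by (auto intro!: continuous_intros)
  obtain p where p: "\<And>t. t \<in> {-real D..real D} \<Longrightarrow> \<bar>poly p t - (t - s) / ((t - s)\<^sup>2 + \<eta>\<^sup>2)\<bar> \<le> \<epsilon>"
    by (rule polynomial_approx[OF c1 assms(2)], rule that)
  obtain r where r: "\<And>t. t \<in> {-real D..real D} \<Longrightarrow> \<bar>poly r t - \<eta> / ((t - s)\<^sup>2 + \<eta>\<^sup>2)\<bar> \<le> \<epsilon>"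
    by (rule polynomial_approx[OF c2 assms(2)], rule that)
  show thesis using that[of p r] p r by (auto simp: abs_le_iff)
qed

text \<open>For the exact kernels both residuals vanish, so only the approximation errors remain,
  multiplied by t - s and \<eta>.\<close>

lemma residual_bound:
  assumes \<eta>: "\<eta> > 0" and t: "\<bar>t\<bar> \<le> real D"
    and p: "\<bar>poly p t - (t - s) / ((t - s)\<^sup>2 + \<eta>\<^sup>2)\<bar> \<le> \<epsilon>"
    and r: "\<bar>poly r t - \<eta> / ((t - s)\<^sup>2 + \<eta>\<^sup>2)\<bar> \<le> \<epsilon>"
  shows "\<bar>poly ([:-s, 1:] * p + smult \<eta> r - 1) t\<bar> \<le> (real D + \<bar>s\<bar> + \<eta>) * \<epsilon>"
    "\<bar>poly ([:-s, 1:] * r - smult \<eta> p) t\<bar> \<le> (real D + \<bar>s\<bar> + \<eta>) * \<epsilon>"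
proof -
  define d where "d = (t - s)\<^sup>2 + \<eta>\<^sup>2"
  have d: "d > 0" unfolding d_def using \<eta> by (simp add: add_nonneg_pos)
  define a b where "a = poly p t - (t - s) / d" and "b = poly r t - \<eta> / d"
  have ab: "\<bar>a\<bar> \<le> \<epsilon>" "\<bar>b\<bar> \<le> \<epsilon>" using p r by (auto simp: a_def b_def d_def)
  have e0: "(t - s) * ((t - s) / d) + \<eta> * (\<eta> / d) = 1"
  proof -
    have "(t - s) * ((t - s) / d) + \<eta> * (\<eta> / d) = ((t - s)\<^sup>2 + \<eta>\<^sup>2) / d"
      by (simp add: power2_eq_square add_divide_distrib)
    then show ?thesis using d by (simp add: d_def[symmetric])
  qed
  have pr: "poly p t = a + (t - s) / d" "poly r t = b + \<eta> / d" by (auto simp: a_def b_def)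
  have "poly ([:-s, 1:] * p + smult \<eta> r - 1) t = (t - s) * (a + (t - s) / d) + \<eta> * (b + \<eta> / d) - 1"
    by (simp add: pr[symmetric] algebra_simps)
  also have "\<dots> = (t - s) * a + \<eta> * b" using e0 by (simp add: algebra_simps)
  finally have e1: "poly ([:-s, 1:] * p + smult \<eta> r - 1) t = (t - s) * a + \<eta> * b" .
  have "poly ([:-s, 1:] * r - smult \<eta> p) t = (t - s) * (b + \<eta> / d) - \<eta> * (a + (t - s) / d)"
    by (simp add: pr[symmetric] algebra_simps)
  also have "\<dots> = (t - s) * b - \<eta> * a" by (simp add: algebra_simps)
  finally have e2: "poly ([:-s, 1:] * r - smult \<eta> p) t = (t - s) * b - \<eta> * a" .
  have ts: "\<bar>t - s\<bar> \<le> real D + \<bar>s\<bar>" using t by linarith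
  have \<epsilon>: "\<epsilon> \<ge> 0" using ab by linarith
  have m: "\<bar>t - s\<bar> * \<bar>c\<bar> + \<eta> * \<bar>c'\<bar> \<le> (real D + \<bar>s\<bar> + \<eta>) * \<epsilon>" if "\<bar>c\<bar> \<le> \<epsilon>" "\<bar>c'\<bar> \<le> \<epsilon>" for c c'
  proof -
    have "\<bar>t - s\<bar> * \<bar>c\<bar> \<le> (real D + \<bar>s\<bar>) * \<epsilon>" using ts that by (intro mult_mono) auto
    moreover have "\<eta> * \<bar>c'\<bar> \<le> \<eta> * \<epsilon>" using that \<eta> by (intro mult_left_mono) auto
    ultimately show ?thesis by (simp add: distrib_right)
  qed
  have "\<bar>(t - s) * a + \<eta> * b\<bar> \<le> \<bar>t - s\<bar> * \<bar>a\<bar> + \<eta> * \<bar>b\<bar>"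
    using \<eta> by (intro order_trans[OF abs_triangle_ineq]) (simp add: abs_mult)
  then show "\<bar>poly ([:-s, 1:] * p + smult \<eta> r - 1) t\<bar> \<le> (real D + \<bar>s\<bar> + \<eta>) * \<epsilon>"
    unfolding e1 using m[OF ab] by linarith
  have "\<bar>(t - s) * b - \<eta> * a\<bar> \<le> \<bar>t - s\<bar> * \<bar>b\<bar> + \<eta> * \<bar>a\<bar>"
    using \<eta> by (intro order_trans[OF abs_triangle_ineq4]) (simp add: abs_mult)
  then show "\<bar>poly ([:-s, 1:] * r - smult \<eta> p) t\<bar> \<le> (real D + \<bar>s\<bar> + \<eta>) * \<epsilon>"
    unfolding e2 using m[OF ab(2,1)] by linarith
qed

text \<open>The solution is the pointwise limit of polynomial vectors approximating the kernel 1/(t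
  - z). \<open>sup_bound\<close> makes every coordinate Cauchy, bounds finite partial sums of
  squares uniformly, and sends the residual to 0; the operator passes to the limit because
  neighbourhoods are finite.\<close>

lemma shifted_adj_surj:
  assumes \<eta>: "\<eta> > 0"
  obtains f where "f \<in> ell2 V" "(\<lambda>x. adj_op (fst g) f x - Complex s \<eta> * f x) = delta (snd g)"
proof -
  define K where "K = real D + \<bar>s\<bar> + \<eta>"
  have "\<exists>p r. \<forall>t. \<bar>t\<bar> \<le> real D \<longrightarrow> \<bar>poly p t - (t - s) / ((t - s)\<^sup>2 + \<eta>\<^sup>2)\<bar> \<le> 1 / real (Suc n)
        \<and> \<bar>poly r t - \<eta> / ((t - s)\<^sup>2 + \<eta>\<^sup>2)\<bar> \<le> 1 / real (Suc n)" for n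
  proof -
    have "1 / real (Suc n) > 0" by simp
    from kernel_approx[OF \<eta> this, of s] show ?thesis by metis
  qed
  then obtain p r where pr: "\<And>n t. \<bar>t\<bar> \<le> real D \<Longrightarrow> \<bar>poly (p n) t - (t - s) / ((t - s)\<^sup>2 + \<eta>\<^sup>2)\<bar> \<le> 1 / real (Suc n)"
      "\<And>n t. \<bar>t\<bar> \<le> real D \<Longrightarrow> \<bar>poly (r n) t - \<eta> / ((t - s)\<^sup>2 + \<eta>\<^sup>2)\<bar> \<le> 1 / real (Suc n)"
    by metis
  have diff: "\<bar>pvec (x n) y - pvec (x m) y\<bar> \<le> 1 / real (Suc n) + 1 / real (Suc m)"
    if "\<And>n t. \<bar>t\<bar> \<le> real D \<Longrightarrow> \<bar>poly (x n) t - \<phi> t\<bar> \<le> 1 / real (Suc n)" for x \<phi> n m y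
  proof -
    have "\<bar>pvec (x n - x m) y\<bar> \<le> 1 / real (Suc n) + 1 / real (Suc m)"
      by (rule sup_bound) (use that[of _ n] that[of _ m] in \<open>fastforce simp: abs_le_iff\<close>)
    then show ?thesis by (simp add: poly_vector_diff)
  qed
  have conv: "convergent (\<lambda>n. pvec (x n) y)"
    if "\<And>n t. \<bar>t\<bar> \<le> real D \<Longrightarrow> \<bar>poly (x n) t - \<phi> t\<bar> \<le> 1 / real (Suc n)" for x \<phi> y
  proof -
    have "Cauchy (\<lambda>n. pvec (x n) y)"
    proof (rule metric_CauchyI)
      fix e :: real assume "e > 0"
      then obtain n0 where n0: "inverse (real (Suc n0)) < e / 2" using reals_Archimedean[of "e / 2"] by auto
      have "dist (pvec (x m) y) (pvec (x n) y) < e" if "m \<ge> n0" "n \<ge> n0" for m n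
      proof -
        have "1 / real (Suc k) < e / 2" if "k \<ge> n0" for k
        proof -
          have "1 / real (Suc k) \<le> inverse (real (Suc n0))" using that by (simp add: field_simps)
          then show ?thesis using n0 by simp
        qed
        from this[OF that(1)] this[OF that(2)] show ?thesis
          using diff[of x \<phi> m y n] \<open>\<And>n t. \<bar>t\<bar> \<le> real D \<Longrightarrow> \<bar>poly (x n) t - \<phi> t\<bar> \<le> 1 / real (Suc n)\<close>
          by (simp add: dist_real_def)
      qed
      then show "\<exists>M. \<forall>m\<ge>M. \<forall>n\<ge>M. dist (pvec (x m) y) (pvec (x n) y) < e" by blast
    qed
    then show ?thesis by (simp add: Cauchy_convergent)
  qed
  define f1 f2 where "f1 y = lim (\<lambda>n. pvec (p n) y)" and "f2 y = lim (\<lambda>n. pvec (r n) y)" for y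
  have f1: "(\<lambda>n. pvec (p n) y) \<longlonglongrightarrow> f1 y" for y
    unfolding f1_def using conv[of p, OF pr(1)] by (simp add: convergent_LIMSEQ_iff)
  have f2: "(\<lambda>n. pvec (r n) y) \<longlonglongrightarrow> f2 y" for y
    unfolding f2_def using conv[of r, OF pr(2)] by (simp add: convergent_LIMSEQ_iff)
  define f where "f y = Complex (f1 y) (f2 y)" for y
  have fl: "(\<lambda>n. cvec (p n) (r n) y) \<longlonglongrightarrow> f y" for y
    unfolding f_def cvec_def by (intro tendsto_Complex f1 f2)
  have "f \<in> ell2 V"
    unfolding ell2_def
  proof (intro CollectI conjI allI impI)
    fix y assume y: "y \<notin> V"
    then have "cvec (p n) (r n) y = 0" for n by (simp add: cvec_def poly_vector_outside complex_eq_iff)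
    then show "f y = 0" using fl[of y] by (simp add: LIMSEQ_const_iff)
  next
    obtain B where B: "\<And>n t. \<bar>t\<bar> \<le> real D \<Longrightarrow> \<bar>poly (p n) t\<bar> \<le> B" "\<And>n t. \<bar>t\<bar> \<le> real D \<Longrightarrow> \<bar>poly (r n) t\<bar> \<le> B"
    \<comment> \<open>Both kernels are bounded by \<open>K / \<eta>\<^sup>2\<close> on [-D, D], and
      all approximation errors are at most 1.\<close>
    proof (rule that[of "1 + K / \<eta>\<^sup>2"])
      fix n t assume t: "\<bar>t\<bar> \<le> real D"
      have le1: "1 / real (Suc n) \<le> 1" by simp
      have K: "\<bar>t - s\<bar> \<le> K" "\<eta> \<le> K" "0 \<le> K" using t \<eta> by (auto simp: K_def)
      have den: "\<eta>\<^sup>2 \<le> (t - s)\<^sup>2 + \<eta>\<^sup>2" "\<eta>\<^sup>2 > 0" using \<eta> by auto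
      have "\<bar>(t - s) / ((t - s)\<^sup>2 + \<eta>\<^sup>2)\<bar> = \<bar>t - s\<bar> / ((t - s)\<^sup>2 + \<eta>\<^sup>2)" by (simp add: abs_of_nonneg)
      also have "\<dots> \<le> K / \<eta>\<^sup>2" using K den by (intro frac_le) auto
      finally show "\<bar>poly (p n) t\<bar> \<le> 1 + K / \<eta>\<^sup>2" using pr(1)[OF t, of n] le1 by linarith
      have "\<bar>\<eta> / ((t - s)\<^sup>2 + \<eta>\<^sup>2)\<bar> = \<eta> / ((t - s)\<^sup>2 + \<eta>\<^sup>2)" using \<eta> by (simp add: abs_of_nonneg)
      also have "\<dots> \<le> K / \<eta>\<^sup>2" using K den by (intro frac_le) auto
      finally show "\<bar>poly (r n) t\<bar> \<le> 1 + K / \<eta>\<^sup>2" using pr(2)[OF t, of n] le1 by linarith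
    qed
    show "(\<lambda>x. (cmod (f x))\<^sup>2) summable_on V"
    proof (rule nonneg_bdd_above_summable_on)
      show "bdd_above (sum (\<lambda>x. (cmod (f x))\<^sup>2) ` {F. F \<subseteq> V \<and> finite F})"
      proof (rule bdd_aboveI2[of _ _ "2 * B\<^sup>2"])
        fix S assume "S \<in> {F. F \<subseteq> V \<and> finite F}"
        then have S: "finite S" by simp
        have "(\<lambda>n. \<Sum>x\<in>S. (cmod (cvec (p n) (r n) x))\<^sup>2) \<longlonglongrightarrow> (\<Sum>x\<in>S. (cmod (f x))\<^sup>2)"
          by (intro tendsto_intros fl)
        moreover have "(\<Sum>x\<in>S. (cmod (cvec (p n) (r n) x))\<^sup>2) \<le> 2 * B\<^sup>2" for n
          using sup_bound(1)[OF B(1)[of _ n] S] sup_bound(1)[OF B(2)[of _ n] S]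
          by (simp add: cvec_def cmod_power2 sum.distrib)
        ultimately show "(\<Sum>x\<in>S. (cmod (f x))\<^sup>2) \<le> 2 * B\<^sup>2" by (intro LIMSEQ_le_const2) auto
      qed
    qed simp
  qed
  moreover have "adj_op (fst g) f y - Complex s \<eta> * f y = delta (snd g) y" for y
  proof -
    have "(\<lambda>n. adj_op (fst g) (cvec (p n) (r n)) y - Complex s \<eta> * cvec (p n) (r n) y)
       \<longlonglongrightarrow> adj_op (fst g) f y - Complex s \<eta> * f y"
      unfolding adj_op_def by (cases "y \<in> V") (auto intro!: tendsto_intros fl)
    moreover have "(\<lambda>n. adj_op (fst g) (cvec (p n) (r n)) y - Complex s \<eta> * cvec (p n) (r n) y)
       \<longlonglongrightarrow> delta (snd g) y + Complex 0 0"
      unfolding shifted_adj_cvec unfolding cvec_def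
    proof (intro tendsto_add tendsto_const tendsto_Complex)
      have z: "(\<lambda>n. K * (1 / real (Suc n))) \<longlonglongrightarrow> 0"
        using tendsto_mult_right_zero[OF LIMSEQ_inverse_real_of_nat, of K] by (simp add: divide_inverse)
      show "(\<lambda>n. pvec ([:- s, 1:] * p n + smult \<eta> (r n) - 1) y) \<longlonglongrightarrow> 0"
        by (rule Lim_null_comparison[OF always_eventually z], rule allI, unfold real_norm_def)
          (rule sup_bound(2), rule residual_bound(1)[OF \<eta> _ pr, folded K_def]; assumption)
      show "(\<lambda>n. pvec ([:- s, 1:] * r n - smult \<eta> (p n)) y) \<longlonglongrightarrow> 0"
        by (rule Lim_null_comparison[OF always_eventually z], rule allI, unfold real_norm_def)
          (rule sup_bound(2), rule residual_bound(2)[OF \<eta> _ pr, folded K_def]; assumption)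
    qed
    ultimately have "adj_op (fst g) f y - Complex s \<eta> * f y = delta (snd g) y + Complex 0 0"
      by (rule LIMSEQ_unique)
    then show ?thesis by (simp add: complex_eq_iff)
  qed
  ultimately show thesis using that by blast
qed

text \<open>The bilinear pairing of a solution \<open>f\<close> with a polynomial approximation of the solution
  only involves finite sums; this determines \<open>f\<close> at the root.\<close>

lemma solution_at_root:
  assumes \<eta>: "\<eta> > 0" and f: "f \<in> ell2 V"
    and sol: "(\<lambda>x. adj_op (fst g) f x - Complex s \<eta> * f x) = delta (snd g)"
    and M: "real_distribution M" and supp: "AE t in M. \<bar>t\<bar> \<le> real D"
    and mom: "\<And>p. (\<integral>t. poly p t \<partial>M) = poly_moment g p"
  shows "f (snd g) = (LINT t|M. 1 / (complex_of_real t - Complex s \<eta>))"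
proof -
  interpret M: real_distribution M by (rule M)
  define K where "K = real D + \<bar>s\<bar> + \<eta>"
  define F where "F = sqrt (\<Sum>\<^sub>\<infinity>x\<in>V. (cmod (f x))\<^sup>2)"
  have sumf: "(\<lambda>x. (cmod (f x))\<^sup>2) summable_on V" using f by (simp add: ell2_def)
  have L2f: "L2_set (\<lambda>x. cmod (f x)) S \<le> F" if "finite S" "S \<subseteq> V" for S
    unfolding L2_set_def F_def using finite_sum_le_infsum[OF sumf that(1,2)] by simp
  have F0: "F \<ge> 0" unfolding F_def by (simp add: infsum_nonneg)
  let ?I = "LINT t|M. 1 / (complex_of_real t - Complex s \<eta>)"
  have close: "cmod (f (snd g) - ?I) \<le> (2 + 2 * K * F) * \<epsilon>" if \<epsilon>: "\<epsilon> > 0" for \<epsilon>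
  proof -
    obtain p r where p: "\<And>t. \<bar>t\<bar> \<le> real D \<Longrightarrow> \<bar>poly p t - (t - s) / ((t - s)\<^sup>2 + \<eta>\<^sup>2)\<bar> \<le> \<epsilon>"
      and r: "\<And>t. \<bar>t\<bar> \<le> real D \<Longrightarrow> \<bar>poly r t - \<eta> / ((t - s)\<^sup>2 + \<eta>\<^sup>2)\<bar> \<le> \<epsilon>"
      by (rule kernel_approx[OF \<eta> \<epsilon>, of s], rule that)
    define e1 e2 where "e1 = [:-s, 1:] * p + smult \<eta> r - 1" and "e2 = [:-s, 1:] * r - smult \<eta> p"
    define S where "S = insert (snd g) ({y. pvec p y \<noteq> 0} \<union> {y. pvec r y \<noteq> 0})"
    have S: "finite S" "S \<subseteq> V" using finite_support poly_vector_outside root by (auto simp: S_def)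
    define S' where "S' = S \<union> (\<Union>y\<in>S. N y)"
    have S': "finite S'" "S' \<subseteq> V" "S \<subseteq> S'" "\<And>y. y \<in> S \<Longrightarrow> N y \<subseteq> S'"
      using S locally_finite neighbours_subset[OF simple] by (auto simp: S'_def locally_finite_def)
    have u: "\<And>y. cvec p r y \<noteq> 0 \<Longrightarrow> y \<in> S" by (auto simp: cvec_def S_def complex_eq_iff)
    have rootS: "snd g \<in> S'" using S' by (auto simp: S_def)
    have pair_delta: "(\<Sum>y\<in>S'. v y * delta (snd g) y) = v (snd g)" "(\<Sum>y\<in>S'. delta (snd g) y * v y) = v (snd g)" for v
    proof -
      have "v y * delta (snd g) y = (if y = snd g then v y else 0)"
        "delta (snd g) y * v y = (if y = snd g then v y else 0)" for y by (simp_all add: delta_def)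
      then show "(\<Sum>y\<in>S'. v y * delta (snd g) y) = v (snd g)" "(\<Sum>y\<in>S'. delta (snd g) y * v y) = v (snd g)"
        using S'(1) rootS by (simp_all add: sum.delta)
    qed
    \<comment> \<open>The point mass is replaced by (A - z) f and A - z is moved to the polynomial
      vector, where it gives back the point mass plus a residual. Cauchy-Schwarz bounds the pairing
      of the residual with f.\<close>
    have "cvec p r (snd g) = (\<Sum>y\<in>S'. cvec p r y * delta (snd g) y)" by (rule pair_delta(1)[symmetric])
    also have "\<dots> = (\<Sum>y\<in>S'. cvec p r y * adj_op (fst g) f y) - (\<Sum>y\<in>S'. Complex s \<eta> * cvec p r y * f y)"
      unfolding sol[symmetric] by (simp add: right_diff_distrib sum_subtractf mult_ac)
    also have "(\<Sum>y\<in>S'. cvec p r y * adj_op (fst g) f y) = (\<Sum>y\<in>S'. adj_op (fst g) (cvec p r) y * f y)"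
      by (rule adj_pairing[OF S S' u])
    also have "\<dots> - (\<Sum>y\<in>S'. Complex s \<eta> * cvec p r y * f y)
      = (\<Sum>y\<in>S'. (adj_op (fst g) (cvec p r) y - Complex s \<eta> * cvec p r y) * f y)"
      by (simp add: left_diff_distrib sum_subtractf)
    also have "\<dots> = f (snd g) + (\<Sum>y\<in>S'. cvec e1 e2 y * f y)"
      unfolding shifted_adj_cvec e1_def[symmetric] e2_def[symmetric]
      by (simp add: distrib_right sum.distrib pair_delta)
    finally have eq: "cvec p r (snd g) - f (snd g) = (\<Sum>y\<in>S'. cvec e1 e2 y * f y)" by simp
    have b1: "\<bar>poly e1 t\<bar> \<le> K * \<epsilon>" and b2: "\<bar>poly e2 t\<bar> \<le> K * \<epsilon>" if "\<bar>t\<bar> \<le> real D" for t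
      unfolding e1_def e2_def K_def using residual_bound[OF \<eta> that p[OF that] r[OF that]] by simp_all
    have K0: "K \<ge> 0" using \<eta> by (simp add: K_def)
    have L: "L2_set (pvec e) S' \<le> K * \<epsilon>" if "\<And>t. \<bar>t\<bar> \<le> real D \<Longrightarrow> \<bar>poly e t\<bar> \<le> K * \<epsilon>" for e
      unfolding L2_set_def using sup_bound(1)[OF that S'(1)] K0 \<epsilon> by (intro real_le_lsqrt) (auto simp: sum_nonneg)
    have CS: "(\<Sum>y\<in>S'. \<bar>pvec e y\<bar> * cmod (f y)) \<le> K * \<epsilon> * F" if "\<And>t. \<bar>t\<bar> \<le> real D \<Longrightarrow> \<bar>poly e t\<bar> \<le> K * \<epsilon>" for e
    proof -
      have "(\<Sum>y\<in>S'. \<bar>pvec e y\<bar> * cmod (f y)) \<le> L2_set (pvec e) S' * L2_set (\<lambda>x. cmod (f x)) S'"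
        using L2_set_mult_ineq[of "pvec e" "\<lambda>x. cmod (f x)" S'] by simp
      also have "\<dots> \<le> K * \<epsilon> * F"
        using L[OF that] L2f[OF S'(1,2)] F0 K0 \<epsilon> by (intro mult_mono) (auto simp: L2_set_nonneg)
      finally show ?thesis .
    qed
    have "cmod (cvec p r (snd g) - f (snd g)) \<le> (\<Sum>y\<in>S'. \<bar>pvec e1 y\<bar> * cmod (f y) + \<bar>pvec e2 y\<bar> * cmod (f y))"
      unfolding eq
    proof (intro order_trans[OF norm_sum] sum_mono)
      fix y
      have "cmod (cvec e1 e2 y) \<le> \<bar>pvec e1 y\<bar> + \<bar>pvec e2 y\<bar>"
        unfolding cvec_def using cmod_le[of "Complex (pvec e1 y) (pvec e2 y)"] by simp
      then show "cmod (cvec e1 e2 y * f y) \<le> \<bar>pvec e1 y\<bar> * cmod (f y) + \<bar>pvec e2 y\<bar> * cmod (f y)"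
        unfolding norm_mult distrib_right[symmetric] by (rule mult_right_mono) simp
    qed
    also have "\<dots> \<le> 2 * K * F * \<epsilon>" using CS[OF b1] CS[OF b2] by (simp add: sum.distrib algebra_simps)
    finally have c1: "cmod (cvec p r (snd g) - f (snd g)) \<le> 2 * K * F * \<epsilon>" .
    have mp[measurable]: "poly q \<in> borel_measurable borel" for q :: "real poly"
      by (intro borel_measurable_continuous_onI continuous_intros)
    have ip: "integrable M (\<lambda>t. poly q t)" for q
    proof -
      obtain B where B: "\<And>t. t \<in> {-real D..real D} \<Longrightarrow> \<bar>poly q t\<bar> \<le> B"
      proof -
        have "compact (poly q ` {-real D..real D})"
          by (intro compact_continuous_image continuous_intros compact_Icc)
        then obtain B where "\<forall>x\<in>poly q ` {-real D..real D}. norm x \<le> B"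
          using compact_imp_bounded bounded_iff by metis
        then show ?thesis using that[of B] by auto
      qed
      show ?thesis
      proof (rule M.integrable_const_bound[of _ B])
        show "AE t in M. norm (poly q t) \<le> B" using supp by eventually_elim (use B in \<open>auto simp: abs_le_iff\<close>)
      qed auto
    qed
    define P where "P t = complex_of_real (poly p t) + \<i> * complex_of_real (poly r t)" for t
    have iP: "integrable M P" unfolding P_def[abs_def] using ip by auto
    have IP: "integral\<^sup>L M P = cvec p r (snd g)"
      unfolding P_def using ip
      by (simp add: mom cvec_def poly_moment_eq_poly_vector complex_eq_iff)
    have nz: "complex_of_real t - Complex s \<eta> \<noteq> 0" for t using \<eta> by (auto simp: complex_eq_iff)
    have kern: "1 / (complex_of_real t - Complex s \<eta>) = Complex ((t - s) / ((t - s)\<^sup>2 + \<eta>\<^sup>2)) (\<eta> / ((t - s)\<^sup>2 + \<eta>\<^sup>2))" for t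
      by (simp add: complex_eq_iff Re_divide Im_divide)
    have bdd: "cmod (1 / (complex_of_real t - Complex s \<eta>)) \<le> 1 / \<eta>" for t
    proof -
      have "\<eta> \<le> cmod (complex_of_real t - Complex s \<eta>)"
        using abs_Im_le_cmod[of "complex_of_real t - Complex s \<eta>"] \<eta> by simp
      then show ?thesis using \<eta> by (simp add: norm_divide frac_le)
    qed
    have iR: "integrable M (\<lambda>t. 1 / (complex_of_real t - Complex s \<eta>))"
      by (rule M.integrable_const_bound[of _ "1 / \<eta>"]) (use bdd in auto)
    have "cmod (integral\<^sup>L M P - ?I) = cmod (LINT t|M. P t - 1 / (complex_of_real t - Complex s \<eta>))"
      using iP iR by simp
    also have "\<dots> \<le> (LINT t|M. cmod (P t - 1 / (complex_of_real t - Complex s \<eta>)))" by (rule integral_norm_bound)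
    also have "\<dots> \<le> (LINT t|M. 2 * \<epsilon>)"
    proof (rule integral_mono_AE)
      show "AE t in M. cmod (P t - 1 / (complex_of_real t - Complex s \<eta>)) \<le> 2 * \<epsilon>" using supp
      proof eventually_elim
        case (elim t)
        have "cmod (P t - 1 / (complex_of_real t - Complex s \<eta>))
          \<le> \<bar>poly p t - (t - s) / ((t - s)\<^sup>2 + \<eta>\<^sup>2)\<bar> + \<bar>poly r t - \<eta> / ((t - s)\<^sup>2 + \<eta>\<^sup>2)\<bar>"
          unfolding kern P_def by (rule order_trans[OF cmod_le]) simp
        then show ?case using p[OF elim] r[OF elim] by linarith
      qed
    qed (use iP iR in auto)
    also have "\<dots> = 2 * \<epsilon>" using M.prob_space by simp
    finally have c2: "cmod (cvec p r (snd g) - ?I) \<le> 2 * \<epsilon>" unfolding IP .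
    have "cmod (f (snd g) - ?I) \<le> cmod (cvec p r (snd g) - ?I) + cmod (cvec p r (snd g) - f (snd g))"
      using norm_triangle_ineq4[of "cvec p r (snd g) - ?I" "cvec p r (snd g) - f (snd g)"] by simp
    then show ?thesis using c1 c2 by (simp add: algebra_simps)
  qed
  have "cmod (f (snd g) - ?I) \<le> 0"
  proof (rule field_le_epsilon)
    fix e :: real assume e: "e > 0"
    have pos: "2 + 2 * K * F > 0" using F0 \<eta> by (simp add: K_def add_pos_nonneg)
    have "cmod (f (snd g) - ?I) \<le> (2 + 2 * K * F) * (e / (2 + 2 * K * F))" using e pos by (intro close) simp
    then show "cmod (f (snd g) - ?I) \<le> 0 + e" using pos by simp
  qed
  then show ?thesis by simp
qed

text \<open>Existence of a solution makes \<open>inv_into\<close> return one. Which one it returns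
  does not matter here, since every square summable solution has the same value at the root.\<close>

lemma resolvent_eq_integral:
  assumes M: "real_distribution M" and supp: "AE t in M. \<bar>t\<bar> \<le> real D"
    and mom: "\<And>p. (\<integral>t. poly p t \<partial>M) = poly_moment g p" and z: "Im z > 0"
  shows "resolvent g z = (LINT t|M. 1 / (complex_of_real t - z))"
proof -
  obtain s \<eta> where z': "z = Complex s \<eta>" "\<eta> > 0" using z by (cases z) auto
  define op where "op f = (\<lambda>x. adj_op (fst g) f x - z * f x)" for f
  define f where "f = inv_into (ell2 V) op (delta (snd g))"
  obtain f0 where "f0 \<in> ell2 V" "op f0 = delta (snd g)"
    using shifted_adj_surj[OF z'(2), of s] unfolding op_def z'(1) by blast
  then have mem: "delta (snd g) \<in> op ` ell2 V" by (metis image_eqI)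
  have f: "f \<in> ell2 V" "op f = delta (snd g)"
    unfolding f_def by (rule inv_into_into[OF mem], rule f_inv_into_f[OF mem])
  have "resolvent g z = ell2_inner V (delta (snd g)) f"
    unfolding resolvent_def f_def op_def by (simp add: case_prod_beta)
  also have "\<dots> = f (snd g)" by (rule ell2_inner_delta[OF root])
  also have "\<dots> = (LINT t|M. 1 / (complex_of_real t - z))"
    using solution_at_root[OF z'(2) f(1) _ M supp mom] f(2) unfolding op_def z'(1) by simp
  finally show ?thesis .
qed

end

section \<open>A measure is determined by its Stieltjes transform\<close>

text \<open>The mass to the left of \<open>b\<close> minus the mass to the right; an atom at
  \<open>b\<close> counts 0. This is what the arctangent primitives of the Poisson kernel converge
  to.\<close>

definition sgn_integral :: "real measure \<Rightarrow> real \<Rightarrow> real" where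
  "sgn_integral M b = (LINT t|M. sgn (b - t))"

lemma arctan_scaled_tendsto: "(\<lambda>n. arctan (x * real (Suc n))) \<longlonglongrightarrow> pi / 2 * sgn x"
proof -
  have S: "filterlim (\<lambda>n. real (Suc n)) at_top sequentially"
    using filterlim_tendsto_add_at_top[OF tendsto_const filterlim_real_sequentially, of 1] by simp
  consider "x > 0" | "x = 0" | "x < 0" by linarith
  then show ?thesis
  proof cases
    case 1
    have "filterlim (\<lambda>n. x * real (Suc n)) at_top sequentially"
      using filterlim_tendsto_pos_mult_at_top[OF tendsto_const 1 S] .
    then show ?thesis using 1 filterlim_compose[OF tendsto_arctan_at_top] by simp
  next
    case 3
    have "filterlim (\<lambda>n. x * real (Suc n)) at_bot sequentially"
      using filterlim_tendsto_neg_mult_at_bot[OF tendsto_const 3 S] .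
    then show ?thesis using 3 filterlim_compose[OF tendsto_arctan_at_bot] by simp
  qed simp
qed

text \<open>Stieltjes inversion: integrating the Poisson kernel over s in [a, b] gives, by Fubini,
  differences of arctangents, which tend to \<pi>/2 times signs as \<eta> tends to 0 along 1/(n +
  1).\<close>

lemma sgn_integral_eq:
  assumes "real_distribution M" "real_distribution M'"
    and eq: "\<And>s \<eta>. \<eta> > 0 \<Longrightarrow> (LINT t|M. \<eta> / ((t - s)\<^sup>2 + \<eta>\<^sup>2)) = (LINT t|M'. \<eta> / ((t - s)\<^sup>2 + \<eta>\<^sup>2))"
    and ab: "a \<le> b"
  shows "sgn_integral M b - sgn_integral M a = sgn_integral M' b - sgn_integral M' a"
proof -
  have arctan_int: "integrable N (\<lambda>t. arctan ((b - t) / \<eta>))" if "real_distribution N" for N b \<eta>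
  proof -
    interpret N: real_distribution N by fact
    have "norm (arctan x) \<le> pi / 2" for x
      using arctan_lbound[of x] arctan_ubound[of x] by (simp add: abs_le_iff)
    then show ?thesis by (intro N.integrable_const_bound[of _ "pi / 2"]) auto
  qed
  have poisson: "(\<integral>\<^sup>+s. ennreal (LINT t|N. \<eta> / ((t - s)\<^sup>2 + \<eta>\<^sup>2)) * indicator {a..b} s \<partial>lborel)
     = ennreal ((LINT t|N. arctan ((b - t) / \<eta>)) - (LINT t|N. arctan ((a - t) / \<eta>)))"
    if N: "real_distribution N" and \<eta>: "\<eta> > 0" for N \<eta>
  proof -
    interpret N: real_distribution N by fact
    interpret pair_sigma_finite lborel N ..
    have nz: "(t - s)\<^sup>2 + \<eta>\<^sup>2 > 0" for t s using \<eta> by (simp add: add_nonneg_pos)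
    have m[measurable]: "(\<lambda>x. \<eta> / ((snd x - fst x)\<^sup>2 + \<eta>\<^sup>2)) \<in> borel_measurable (lborel \<Otimes>\<^sub>M N)" by measurable
    have "(\<integral>\<^sup>+s. ennreal (LINT t|N. \<eta> / ((t - s)\<^sup>2 + \<eta>\<^sup>2)) * indicator {a..b} s \<partial>lborel)
      = (\<integral>\<^sup>+s. (\<integral>\<^sup>+t. ennreal (\<eta> / ((t - s)\<^sup>2 + \<eta>\<^sup>2)) * indicator {a..b} s \<partial>N) \<partial>lborel)"
    proof (intro nn_integral_cong)
      fix s :: real
      have "integrable N (\<lambda>t. \<eta> / ((t - s)\<^sup>2 + \<eta>\<^sup>2))"
      proof (rule N.integrable_const_bound[of _ "\<eta> / \<eta>\<^sup>2"])
        show "AE t in N. norm (\<eta> / ((t - s)\<^sup>2 + \<eta>\<^sup>2)) \<le> \<eta> / \<eta>\<^sup>2"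
          using \<eta> nz by (intro always_eventually allI) (auto simp: intro!: frac_le)
      qed simp
      then have "ennreal (LINT t|N. \<eta> / ((t - s)\<^sup>2 + \<eta>\<^sup>2)) = (\<integral>\<^sup>+t. ennreal (\<eta> / ((t - s)\<^sup>2 + \<eta>\<^sup>2)) \<partial>N)"
        using \<eta> nz by (intro nn_integral_eq_integral[symmetric]) (auto simp: less_imp_le)
      then show "ennreal (LINT t|N. \<eta> / ((t - s)\<^sup>2 + \<eta>\<^sup>2)) * indicator {a..b} s
        = (\<integral>\<^sup>+t. ennreal (\<eta> / ((t - s)\<^sup>2 + \<eta>\<^sup>2)) * indicator {a..b} s \<partial>N)"
        by (simp add: nn_integral_multc)
    qed
    also have "\<dots> = (\<integral>\<^sup>+t. (\<integral>\<^sup>+s. ennreal (\<eta> / ((t - s)\<^sup>2 + \<eta>\<^sup>2)) * indicator {a..b} s \<partial>lborel) \<partial>N)"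
      by (rule Fubini'[symmetric]) measurable
    also have "\<dots> = (\<integral>\<^sup>+t. ennreal (arctan ((b - t) / \<eta>) - arctan ((a - t) / \<eta>)) \<partial>N)"
    proof (intro nn_integral_cong)
      fix t
      show "(\<integral>\<^sup>+s. ennreal (\<eta> / ((t - s)\<^sup>2 + \<eta>\<^sup>2)) * indicator {a..b} s \<partial>lborel)
        = ennreal (arctan ((b - t) / \<eta>) - arctan ((a - t) / \<eta>))"
      proof (rule nn_integral_FTC_Icc)
        fix s
        have "1 / \<eta> / (1 + ((s - t) / \<eta>)\<^sup>2) = \<eta> / ((t - s)\<^sup>2 + \<eta>\<^sup>2)"
        proof -
          have "1 + ((s - t) / \<eta>)\<^sup>2 = ((t - s)\<^sup>2 + \<eta>\<^sup>2) / \<eta>\<^sup>2" using \<eta> by (simp add: power_divide add_divide_distrib power2_commute)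
          then show ?thesis using \<eta> by (simp add: power2_eq_square)
        qed
        moreover have "((\<lambda>s. arctan ((s - t) / \<eta>)) has_real_derivative 1 / \<eta> / (1 + ((s - t) / \<eta>)\<^sup>2)) (at s)"
          by (auto intro!: derivative_eq_intros simp: divide_inverse mult_ac)
        ultimately show "((\<lambda>s. arctan ((s - t) / \<eta>)) has_real_derivative \<eta> / ((t - s)\<^sup>2 + \<eta>\<^sup>2)) (at s)"
          by simp
      next
        show "0 \<le> \<eta> / ((t - s)\<^sup>2 + \<eta>\<^sup>2)" for s using \<eta> nz[of t s] by simp
      qed (use ab in auto)
    qed
    also have "\<dots> = ennreal (LINT t|N. arctan ((b - t) / \<eta>) - arctan ((a - t) / \<eta>))"
    proof (rule nn_integral_eq_integral)
      show "integrable N (\<lambda>t. arctan ((b - t) / \<eta>) - arctan ((a - t) / \<eta>))"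
        by (intro Bochner_Integration.integrable_diff arctan_int N)
      show "AE t in N. 0 \<le> arctan ((b - t) / \<eta>) - arctan ((a - t) / \<eta>)"
        using ab \<eta> by (intro always_eventually allI) (auto simp: arctan_le_iff divide_right_mono)
    qed
    also have "\<dots> = ennreal ((LINT t|N. arctan ((b - t) / \<eta>)) - (LINT t|N. arctan ((a - t) / \<eta>)))"
      using arctan_int[OF N] by simp
    finally show ?thesis .
  qed
  have lim: "(\<lambda>n. LINT t|N. arctan ((b - t) * real (Suc n))) \<longlonglongrightarrow> pi / 2 * sgn_integral N b"
    if N: "real_distribution N" for N b
  proof -
    interpret N: real_distribution N by fact
    have "(\<lambda>n. LINT t|N. arctan ((b - t) * real (Suc n))) \<longlonglongrightarrow> (LINT t|N. pi / 2 * sgn (b - t))"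
    proof (rule integral_dominated_convergence[where w = "\<lambda>_. pi / 2"])
      show "AE t in N. (\<lambda>n. arctan ((b - t) * real (Suc n))) \<longlonglongrightarrow> pi / 2 * sgn (b - t)"
        by (intro always_eventually allI arctan_scaled_tendsto)
      show "AE t in N. norm (arctan ((b - t) * real (Suc n))) \<le> pi / 2" for n
      proof (intro always_eventually allI)
        fix t show "norm (arctan ((b - t) * real (Suc n))) \<le> pi / 2"
          using arctan_lbound[of "(b - t) * real (Suc n)"] arctan_ubound[of "(b - t) * real (Suc n)"]
          by (simp only: real_norm_def abs_le_iff) linarith
      qed
    qed auto
    then show ?thesis by (simp add: sgn_integral_def)
  qed
  have diff_eq: "(LINT t|M. arctan ((b - t) * real (Suc n))) - (LINT t|M. arctan ((a - t) * real (Suc n)))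
    = (LINT t|M'. arctan ((b - t) * real (Suc n))) - (LINT t|M'. arctan ((a - t) * real (Suc n)))" for n
  proof -
    define \<eta> where "\<eta> = 1 / real (Suc n)"
    have \<eta>: "\<eta> > 0" by (simp add: \<eta>_def)
    have ge: "0 \<le> (LINT t|N. arctan ((b - t) / \<eta>)) - (LINT t|N. arctan ((a - t) / \<eta>))"
      if "real_distribution N" for N
    proof -
      have "(LINT t|N. arctan ((a - t) / \<eta>)) \<le> (LINT t|N. arctan ((b - t) / \<eta>))"
        using ab \<eta> by (intro integral_mono arctan_int that) (auto simp: arctan_le_iff divide_right_mono)
      then show ?thesis by simp
    qed
    have "ennreal ((LINT t|M. arctan ((b - t) / \<eta>)) - (LINT t|M. arctan ((a - t) / \<eta>)))
      = ennreal ((LINT t|M'. arctan ((b - t) / \<eta>)) - (LINT t|M'. arctan ((a - t) / \<eta>)))"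
      unfolding poisson[OF assms(1) \<eta>, symmetric] poisson[OF assms(2) \<eta>, symmetric] eq[OF \<eta>] ..
    then have "(LINT t|M. arctan ((b - t) / \<eta>)) - (LINT t|M. arctan ((a - t) / \<eta>))
      = (LINT t|M'. arctan ((b - t) / \<eta>)) - (LINT t|M'. arctan ((a - t) / \<eta>))"
      using ge[OF assms(1)] ge[OF assms(2)] by (subst (asm) ennreal_inj) auto
    then show ?thesis by (simp add: \<eta>_def)
  qed
  have "pi / 2 * sgn_integral M b - pi / 2 * sgn_integral M a = pi / 2 * sgn_integral M' b - pi / 2 * sgn_integral M' a"
    using LIMSEQ_unique[OF tendsto_diff[OF lim[OF assms(1), of b] lim[OF assms(1), of a]]
        tendsto_diff[OF lim[OF assms(2), of b] lim[OF assms(2), of a], folded diff_eq]] .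
  then have "pi / 2 * (sgn_integral M b - sgn_integral M a) = pi / 2 * (sgn_integral M' b - sgn_integral M' a)"
    by (simp only: right_diff_distrib)
  then show ?thesis by simp
qed

lemma sgn_integral_at_bot:
  assumes "real_distribution N" shows "(\<lambda>n. sgn_integral N (- real n)) \<longlonglongrightarrow> -1"
proof -
  interpret N: real_distribution N by fact
  have "(\<lambda>n. LINT t|N. sgn (- real n - t)) \<longlonglongrightarrow> (LINT t|N. -1)"
  proof (rule integral_dominated_convergence[where w = "\<lambda>_. 1"])
    show "AE t in N. (\<lambda>n. sgn (- real n - t)) \<longlonglongrightarrow> -1"
    proof (intro always_eventually allI)
      fix t :: real
      obtain n0 where "- t < real n0" using reals_Archimedean2 by blast
      then have "sgn (- real n - t) = -1" if "n \<ge> n0" for n using that by (simp add: sgn_if)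
      then show "(\<lambda>n. sgn (- real n - t)) \<longlonglongrightarrow> -1"
        by (intro tendsto_eventually eventually_sequentiallyI)
    qed
  qed (auto simp: sgn_if)
  then show ?thesis using N.prob_space by (simp add: sgn_integral_def)
qed

text \<open>Approaching \<open>b\<close> from the right counts an atom at \<open>b\<close> fully,
  which recovers the distribution function.\<close>

lemma sgn_integral_right_limit:
  assumes "real_distribution N"
  shows "(\<lambda>n. sgn_integral N (b + 1 / real (Suc n))) \<longlonglongrightarrow> 2 * cdf N b - 1"
proof -
  interpret N: real_distribution N by fact
  have "(\<lambda>n. LINT t|N. sgn (b + 1 / real (Suc n) - t)) \<longlonglongrightarrow> (LINT t|N. 2 * indicator {..b} t - 1)"
  proof (rule integral_dominated_convergence[where w = "\<lambda>_. 1"])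
    show "AE t in N. (\<lambda>n. sgn (b + 1 / real (Suc n) - t)) \<longlonglongrightarrow> 2 * indicator {..b} t - 1"
    proof (intro always_eventually allI)
      fix t :: real
      show "(\<lambda>n. sgn (b + 1 / real (Suc n) - t)) \<longlonglongrightarrow> 2 * indicator {..b} t - 1"
      proof (cases "t \<le> b")
        case True
        have "sgn (b + 1 / real (Suc n) - t) = 1" for n
        proof -
          have "1 / real (Suc n) > 0" by simp
          then have "b + 1 / real (Suc n) - t > 0" using True by linarith
          then show ?thesis by (rule sgn_pos)
        qed
        then show ?thesis using True by simp
      next
        case False
        then obtain n0 where n0: "inverse (real (Suc n0)) < t - b" using reals_Archimedean[of "t - b"] by auto
        have "sgn (b + 1 / real (Suc n) - t) = -1" if "n \<ge> n0" for n
        proof -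
          have "1 / real (Suc n) \<le> inverse (real (Suc n0))" using that by (simp add: field_simps)
          then have "b + 1 / real (Suc n) - t < 0" using n0 by linarith
          then show ?thesis by (rule sgn_neg)
        qed
        then have "\<forall>\<^sub>F n in sequentially. sgn (b + 1 / real (Suc n) - t) = -1" by (rule eventually_sequentiallyI)
        then show ?thesis using False by (intro tendsto_eventually) simp
      qed
    qed
  qed (auto simp: sgn_if)
  moreover have "(LINT t|N. 2 * indicator {..b} t - 1) = 2 * cdf N b - 1"
  proof -
    have "integrable N (\<lambda>t. 2 * indicat_real {..b} t)" by (rule N.integrable_const_bound[of _ 2]) auto
    then have "(LINT t|N. 2 * indicat_real {..b} t - 1) = (LINT t|N. 2 * indicat_real {..b} t) - (LINT t|N. 1)"
      by (intro Bochner_Integration.integral_diff) auto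
    then show ?thesis using N.prob_space by (simp add: cdf_def)
  qed
  ultimately show ?thesis by (simp add: sgn_integral_def)
qed

text \<open>The imaginary parts determine the increments of \<open>sgn_integral\<close>; its limit
  -1 at minus infinity fixes the additive constant, and right limits give the distribution
  functions.\<close>

lemma Stieltjes_unique:
  assumes M: "real_distribution M" "real_distribution M'"
    and eq: "\<And>z. Im z > 0 \<Longrightarrow> (LINT t|M. 1 / (complex_of_real t - z)) = (LINT t|M'. 1 / (complex_of_real t - z))"
  shows "M = M'"
proof -
  have im: "Im (LINT t|N. 1 / (complex_of_real t - Complex s \<eta>)) = (LINT t|N. \<eta> / ((t - s)\<^sup>2 + \<eta>\<^sup>2))"
    if "real_distribution N" "\<eta> > 0" for N s \<eta>
  proof -
    interpret N: real_distribution N by fact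
    have "integrable N (\<lambda>t. 1 / (complex_of_real t - Complex s \<eta>))"
    proof (rule N.integrable_const_bound[of _ "1 / \<eta>"])
      have "\<eta> \<le> cmod (complex_of_real t - Complex s \<eta>)" for t
        using abs_Im_le_cmod[of "complex_of_real t - Complex s \<eta>"] that by simp
      then show "AE t in N. cmod (1 / (complex_of_real t - Complex s \<eta>)) \<le> 1 / \<eta>"
        using that by (simp add: norm_divide frac_le)
    qed simp
    then have "Im (LINT t|N. 1 / (complex_of_real t - Complex s \<eta>)) = (LINT t|N. Im (1 / (complex_of_real t - Complex s \<eta>)))"
      by (rule integral_Im[symmetric])
    also have "\<dots> = (LINT t|N. \<eta> / ((t - s)\<^sup>2 + \<eta>\<^sup>2))"
      by (intro Bochner_Integration.integral_cong refl) (simp add: Im_divide)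
    finally show ?thesis .
  qed
  have P: "(LINT t|M. \<eta> / ((t - s)\<^sup>2 + \<eta>\<^sup>2)) = (LINT t|M'. \<eta> / ((t - s)\<^sup>2 + \<eta>\<^sup>2))" if "\<eta> > 0" for s \<eta>
    using eq[of "Complex s \<eta>"] im[OF M(1) that, of s] im[OF M(2) that, of s] that by simp
  have S: "sgn_integral M b = sgn_integral M' b" for b
  proof -
    obtain n0 where n0: "- b < real n0" using reals_Archimedean2 by blast
    have ev: "\<forall>\<^sub>F n in sequentially. sgn_integral M b - sgn_integral M (- real n) = sgn_integral M' b - sgn_integral M' (- real n)"
    proof (rule eventually_sequentiallyI)
      fix n assume "n0 \<le> n"
      then show "sgn_integral M b - sgn_integral M (- real n) = sgn_integral M' b - sgn_integral M' (- real n)"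
        using n0 by (intro sgn_integral_eq M P) auto
    qed
    have L: "(\<lambda>n. sgn_integral N b - sgn_integral N (- real n)) \<longlonglongrightarrow> sgn_integral N b - (-1)"
      if "real_distribution N" for N
      by (intro tendsto_intros sgn_integral_at_bot that)
    have "sgn_integral M b - (-1) = sgn_integral M' b - (-1)"
      using LIMSEQ_unique[OF Lim_transform_eventually[OF L[OF M(1)] ev] L[OF M(2)]] .
    then show ?thesis by simp
  qed
  have "cdf M b = cdf M' b" for b
  proof -
    have "2 * cdf M b - 1 = 2 * cdf M' b - 1"
      using LIMSEQ_unique[OF sgn_integral_right_limit[OF M(1), of b]
          sgn_integral_right_limit[OF M(2), of b, folded S]] .
    then show ?thesis by simp
  qed
  then show ?thesis using M by (intro cdf_unique) auto
qed

context bounded_degree_graph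
begin

text \<open>The measure built from the moments satisfies the defining equation, and uniqueness of
  the Stieltjes transform makes \<open>THE\<close> return it; support and polynomial moments are
  then inherited.\<close>

lemma spectral_measure_properties:
  shows "real_distribution (spectral_measure g)" "AE t in spectral_measure g. \<bar>t\<bar> \<le> real D"
    "(LINT t|spectral_measure g. poly p t) = poly_moment g p"
    "Im z > 0 \<Longrightarrow> resolvent g z = (LINT t|spectral_measure g. 1 / (complex_of_real t - z))"
proof -
  obtain M where M: "real_distribution M" and supp: "AE t in M. \<bar>t\<bar> \<le> real D"
    and mom: "\<And>p. (\<integral>t. poly p t \<partial>M) = poly_moment g p" by (rule moment_measure_exists, rule that)
  interpret M: real_distribution M by (rule M)
  note R = resolvent_eq_integral[OF M supp mom]
  have "spectral_measure g = M"
    unfolding spectral_measure_def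
  proof (rule the_equality)
    show "prob_space M \<and> sets M = sets borel \<and> (\<forall>z. 0 < Im z \<longrightarrow> resolvent g z = (LINT t|M. 1 / (complex_of_real t - z)))"
      using M.prob_space_axioms R by simp
    fix M' :: "real measure"
    assume M': "prob_space M' \<and> sets M' = sets borel \<and> (\<forall>z. 0 < Im z \<longrightarrow> resolvent g z = (LINT t|M'. 1 / (complex_of_real t - z)))"
    then have "real_distribution M'" by (simp add: real_distribution_def real_distribution_axioms_def)
    then show "M' = M" using M' R by (intro Stieltjes_unique M) auto
  qed
  then show "real_distribution (spectral_measure g)" "AE t in spectral_measure g. \<bar>t\<bar> \<le> real D"
    "(LINT t|spectral_measure g. poly p t) = poly_moment g p"
    "Im z > 0 \<Longrightarrow> resolvent g z = (LINT t|spectral_measure g. 1 / (complex_of_real t - z))"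
    by (simp_all only: M supp mom R)
qed

end

section \<open>Eigenbases of finite graphs\<close>

locale graph_eigenbasis =
  fixes G :: "'a graph" and \<psi> :: "nat \<Rightarrow> 'a \<Rightarrow> real" and lam :: "nat \<Rightarrow> real" and D :: nat
  assumes simple: "simple_graph G" and fin: "finite (verts G)" and nonempty: "verts G \<noteq> {}"
    and degree: "\<And>x. x \<in> verts G \<Longrightarrow> card (neighbours G x) \<le> D"
    and basis: "eigenbasis G \<psi> lam"
begin

abbreviation "n \<equiv> card (verts G)"

lemma orthonormal: "j < n \<Longrightarrow> k < n \<Longrightarrow> (\<Sum>x\<in>verts G. \<psi> j x * \<psi> k x) = (if j = k then 1 else 0)"
  using basis by (simp add: eigenbasis_def)

lemma eigen: "k < n \<Longrightarrow> x \<in> verts G \<Longrightarrow> adj_op G (\<psi> k) x = lam k * \<psi> k x"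
  using basis by (simp add: eigenbasis_def)

text \<open>Bessel's inequality for the point masses, summed over the vertices, is an equality since
  there are as many eigenvectors as vertices; hence it is an equality for each point mass.\<close>

lemma bessel_defect:
  assumes x: "x \<in> verts G"
  shows "(\<Sum>y\<in>verts G. ((if y = x then 1 else 0) - (\<Sum>k<n. \<psi> k x * \<psi> k y))\<^sup>2) = 1 - (\<Sum>k<n. (\<psi> k x)\<^sup>2)"
proof -
  define K where "K y = (\<Sum>k<n. \<psi> k x * \<psi> k y)" for y
  have KK: "(\<Sum>y\<in>verts G. (K y)\<^sup>2) = (\<Sum>k<n. (\<psi> k x)\<^sup>2)"
  proof -
    have "(\<Sum>y\<in>verts G. (K y)\<^sup>2) = (\<Sum>y\<in>verts G. \<Sum>j<n. \<Sum>k<n. \<psi> j x * \<psi> k x * (\<psi> j y * \<psi> k y))"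
      unfolding K_def power2_eq_square sum_product by (simp add: mult_ac)
    also have "\<dots> = (\<Sum>j<n. \<Sum>k<n. \<Sum>y\<in>verts G. \<psi> j x * \<psi> k x * (\<psi> j y * \<psi> k y))"
      by (subst sum.swap, intro sum.cong refl, rule sum.swap)
    also have "\<dots> = (\<Sum>j<n. \<Sum>k<n. if j = k then \<psi> j x * \<psi> k x else 0)"
      by (intro sum.cong refl) (simp add: sum_distrib_left[symmetric] orthonormal)
    also have "\<dots> = (\<Sum>k<n. (\<psi> k x)\<^sup>2)" by (simp add: power2_eq_square)
    finally show ?thesis .
  qed
  have Kx: "K x = (\<Sum>k<n. (\<psi> k x)\<^sup>2)" by (simp add: K_def power2_eq_square)
  have "(\<Sum>y\<in>verts G. ((if y = x then 1 else 0) - K y)\<^sup>2)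
     = (\<Sum>y\<in>verts G. (if y = x then 1 - 2 * K y else 0) + (K y)\<^sup>2)"
    by (intro sum.cong refl) (simp add: power2_eq_square algebra_simps)
  also have "\<dots> = 1 - 2 * K x + (\<Sum>y\<in>verts G. (K y)\<^sup>2)"
    using x fin by (simp add: sum.distrib)
  finally show ?thesis unfolding KK Kx by (simp add: K_def)
qed

lemma completeness:
  assumes x: "x \<in> verts G" and y: "y \<in> verts G"
  shows "(\<Sum>k<n. \<psi> k x * \<psi> k y) = (if y = x then 1 else 0)"
proof -
  have le: "(\<Sum>k<n. (\<psi> k x)\<^sup>2) \<le> 1" if "x \<in> verts G" for x
    using bessel_defect[OF that] sum_nonneg[of "verts G" "\<lambda>y. ((if y = x then 1 else 0) - (\<Sum>k<n. \<psi> k x * \<psi> k y))\<^sup>2"]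
    by simp
  have "(\<Sum>x\<in>verts G. 1 - (\<Sum>k<n. (\<psi> k x)\<^sup>2)) = real n - (\<Sum>k<n. \<Sum>x\<in>verts G. \<psi> k x * \<psi> k x)"
    by (subst sum.swap) (simp add: sum_subtractf power2_eq_square)
  also have "\<dots> = 0" by (simp add: orthonormal)
  finally have "\<forall>x\<in>verts G. 1 - (\<Sum>k<n. (\<psi> k x)\<^sup>2) = 0"
    using le by (subst (asm) sum_nonneg_eq_0_iff) (auto simp: fin)
  then have "(\<Sum>y\<in>verts G. ((if y = x then 1 else 0) - (\<Sum>k<n. \<psi> k x * \<psi> k y))\<^sup>2) = 0"
    using bessel_defect[OF x] x by simp
  then have "\<forall>y\<in>verts G. ((if y = x then 1 else 0) - (\<Sum>k<n. \<psi> k x * \<psi> k y))\<^sup>2 = 0"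
    by (subst (asm) sum_nonneg_eq_0_iff) (auto simp: fin)
  then show ?thesis using y by simp
qed

lemma sum_eigenvectors_sq: "x \<in> verts G \<Longrightarrow> (\<Sum>k<n. (\<psi> k x)\<^sup>2) = 1"
  using completeness[of x x] by (simp add: power2_eq_square)

lemma walk_vector_eigen:
  assumes x: "x \<in> verts G" and y: "y \<in> verts G"
  shows "walk_vector (G, x) j y = (\<Sum>k<n. lam k ^ j * \<psi> k x * \<psi> k y)"
  using y
proof (induction j arbitrary: y)
  case 0
  then show ?case using completeness[OF x 0] by (simp add: walk_vector_0)
next
  case (Suc j)
  have "walk_vector (G, x) (Suc j) y = (\<Sum>z\<in>neighbours G y. \<Sum>k<n. lam k ^ j * \<psi> k x * \<psi> k z)"
    unfolding walk_vector_Suc adj_op_def using Suc neighbours_subset[OF simple] by (auto intro!: sum.cong)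
  also have "\<dots> = (\<Sum>k<n. lam k ^ j * \<psi> k x * (\<Sum>z\<in>neighbours G y. \<psi> k z))"
    by (subst sum.swap) (simp add: sum_distrib_left)
  also have "\<dots> = (\<Sum>k<n. lam k ^ j * \<psi> k x * adj_op G (\<psi> k) y)"
    using Suc.prems by (simp add: adj_op_def)
  also have "\<dots> = (\<Sum>k<n. lam k ^ Suc j * \<psi> k x * \<psi> k y)"
    using Suc.prems by (intro sum.cong refl) (simp add: eigen)
  finally show ?case .
qed

lemma poly_moment_eigen:
  assumes x: "x \<in> verts G"
  shows "poly_moment (G, x) p = (\<Sum>k<n. poly p (lam k) * (\<psi> k x)\<^sup>2)"
proof -
  have "poly_moment (G, x) p = (\<Sum>i\<le>degree p. \<Sum>k<n. coeff p i * lam k ^ i * (\<psi> k x)\<^sup>2)"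
    unfolding poly_moment_def closed_walks_def
    by (simp add: walk_vector_eigen[OF x x] sum_distrib_left power2_eq_square mult_ac)
  also have "\<dots> = (\<Sum>k<n. poly p (lam k) * (\<psi> k x)\<^sup>2)"
    by (subst sum.swap) (simp add: poly_altdef sum_distrib_right)
  finally show ?thesis .
qed

text \<open>The eigenvalue equation is read at a vertex where the eigenvector is largest in absolute
  value.\<close>

lemma eigenvalue_bound:
  assumes k: "k < n" shows "\<bar>lam k\<bar> \<le> real D"
proof -
  define m where "m = Max ((\<lambda>x. \<bar>\<psi> k x\<bar>) ` verts G)"
  have fi: "finite ((\<lambda>x. \<bar>\<psi> k x\<bar>) ` verts G)" "(\<lambda>x. \<bar>\<psi> k x\<bar>) ` verts G \<noteq> {}" using fin nonempty by auto
  obtain x where x: "x \<in> verts G" "m = \<bar>\<psi> k x\<bar>" using Max_in[OF fi] unfolding m_def by auto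
  have le: "\<bar>\<psi> k y\<bar> \<le> m" if "y \<in> verts G" for y unfolding m_def using fi that by (intro Max_ge) auto
  have "m \<noteq> 0"
  proof
    assume "m = 0"
    then have "\<psi> k y = 0" if "y \<in> verts G" for y using le[OF that] by simp
    then show False using orthonormal[OF k k] by simp
  qed
  then have m: "m > 0" using x by simp
  have "\<bar>lam k\<bar> * m = \<bar>adj_op G (\<psi> k) x\<bar>" using eigen[OF k x(1)] x by (simp add: abs_mult)
  also have "\<dots> = \<bar>\<Sum>y\<in>neighbours G x. \<psi> k y\<bar>" using x by (simp add: adj_op_def)
  also have "\<dots> \<le> (\<Sum>y\<in>neighbours G x. m)"
    using le neighbours_subset[OF simple] by (intro order_trans[OF sum_abs] sum_mono) blast
  also have "\<dots> \<le> real D * m" using degree[OF x(1)] m by (simp add: mult_right_mono)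
  finally show ?thesis using m by simp
qed

text \<open>The dimension of the spectral subspace is the trace of its projection, whose diagonal
  entries are the inner sums on the right.\<close>

lemma card_spectral_indices:
  "real (card (spectral_indices G lam I)) = (\<Sum>x\<in>verts G. \<Sum>k\<in>spectral_indices G lam I. (\<psi> k x)\<^sup>2)"
proof -
  have "(\<Sum>x\<in>verts G. \<Sum>k\<in>spectral_indices G lam I. (\<psi> k x)\<^sup>2) = (\<Sum>k\<in>spectral_indices G lam I. \<Sum>x\<in>verts G. \<psi> k x * \<psi> k x)"
    by (subst sum.swap) (simp add: power2_eq_square)
  also have "\<dots> = (\<Sum>k\<in>spectral_indices G lam I. 1)"
    by (intro sum.cong refl) (auto simp: spectral_indices_def orthonormal)
  finally show ?thesis by simp
qed

text \<open>Certifies that the sphere on which the random vector is drawn is nonempty.\<close>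

lemma spectral_subspace_nontrivial:
  assumes "spectral_indices G lam I \<noteq> {}"
  shows "spectral_subspace G \<psi> lam I \<noteq> {zero_vector G}"
proof
  assume eq: "spectral_subspace G \<psi> lam I = {zero_vector G}"
  obtain j where j: "j \<in> spectral_indices G lam I" using assms by blast
  have fS: "finite (spectral_indices G lam I)" by (auto simp: spectral_indices_def)
  define c where "c k = (if k = j then 1 else 0::real)" for k
  have "lin_comb G \<psi> (spectral_indices G lam I) c \<in> spectral_subspace G \<psi> lam I"
    unfolding spectral_subspace_def by blast
  then have z: "lin_comb G \<psi> (spectral_indices G lam I) c = zero_vector G" using eq by simp
  have "\<psi> j x = 0" if x: "x \<in> verts G" for x
  proof -
    have "(\<Sum>k\<in>spectral_indices G lam I. c k * \<psi> k x) = (\<Sum>k\<in>spectral_indices G lam I. if k = j then \<psi> k x else 0)"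
      by (intro sum.cong) (auto simp: c_def)
    also have "\<dots> = \<psi> j x" using fS j by simp
    finally show ?thesis using fun_cong[OF z, of x] x by (simp add: lin_comb_def zero_vector_def)
  qed
  then show False using orthonormal[of j j] j by (simp add: spectral_indices_def)
qed

end

text \<open>u(x) is a linear form of the point on the sphere, with coefficients \<psi>_k(x) whose
  squares sum to the diagonal entry of the projection. Summing the moments over the vertices bounds
  the expectation of the q-th power of the norm, and Markov's inequality applies.\<close>

lemma random_eigenvector_tail:
  fixes G :: "'a graph"
  assumes V: "finite (verts G)" and q: "q \<ge> 2"
    and K: "spectral_indices G lam I \<noteq> {}"
    and a: "a > 0"
  shows "measure (random_eigenvector G \<psi> lam I)
      {u \<in> space (random_eigenvector G \<psi> lam I). Lq_norm q (verts G) u \<ge> a}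
    \<le> normal_abs_moment q * (\<Sum>x\<in>verts G. ((\<Sum>k\<in>spectral_indices G lam I. (\<psi> k x)\<^sup>2)
          / real (card (spectral_indices G lam I))) powr (q / 2)) / a powr q"
proof -
  define K where "K = spectral_indices G lam I"
  have fK: "finite K" "K \<noteq> {}" using K by (auto simp: K_def spectral_indices_def)
  define F where "F c = (\<Sum>x\<in>verts G. \<bar>\<Sum>k\<in>K. c k * \<psi> k x\<bar> powr q)" for c
  have sets: "sets (sphere_measure K) = sets (PiM K (\<lambda>_. borel))" by (simp add: sphere_measure_def)
  note sets[measurable_cong]
  have lc: "lin_comb G \<psi> K \<in> measurable (sphere_measure K) (PiM (verts G) (\<lambda>_. borel))"
    unfolding lin_comb_def by measurable
  have Fm: "F \<in> borel_measurable (sphere_measure K)" unfolding F_def by measurable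
  have norm_m: "(\<lambda>u. Lq_norm q (verts G) u) \<in> borel_measurable (PiM (verts G) (\<lambda>_. borel))"
    unfolding Lq_norm_def using V by measurable
  define T where "T = {u \<in> space (PiM (verts G) (\<lambda>_. borel)). Lq_norm q (verts G) u \<ge> a}"
  have T: "T \<in> sets (PiM (verts G) (\<lambda>_. borel))" unfolding T_def using norm_m by measurable
  define R where "R = normal_abs_moment q * (\<Sum>x\<in>verts G. ((\<Sum>k\<in>K. (\<psi> k x)\<^sup>2) / real (card K)) powr (q / 2))"
  have R0: "R \<ge> 0" unfolding R_def using normal_abs_moment_nonneg by (intro mult_nonneg_nonneg sum_nonneg) auto
  have "(\<integral>\<^sup>+c. ennreal (F c) \<partial>sphere_measure K)
     = (\<Sum>x\<in>verts G. \<integral>\<^sup>+c. ennreal (\<bar>\<Sum>k\<in>K. c k * \<psi> k x\<bar> powr q) \<partial>sphere_measure K)"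
  proof -
    have "(\<integral>\<^sup>+c. ennreal (F c) \<partial>sphere_measure K)
       = (\<integral>\<^sup>+c. (\<Sum>x\<in>verts G. ennreal (\<bar>\<Sum>k\<in>K. c k * \<psi> k x\<bar> powr q)) \<partial>sphere_measure K)"
      unfolding F_def by (intro nn_integral_cong) (simp add: sum_ennreal)
    also have "\<dots> = (\<Sum>x\<in>verts G. \<integral>\<^sup>+c. ennreal (\<bar>\<Sum>k\<in>K. c k * \<psi> k x\<bar> powr q) \<partial>sphere_measure K)"
      by (intro nn_integral_sum) measurable
    finally show ?thesis .
  qed
  also have "\<dots> \<le> (\<Sum>x\<in>verts G. ennreal (normal_abs_moment q * ((\<Sum>k\<in>K. (\<psi> k x)\<^sup>2) / real (card K)) powr (q / 2)))"
    by (intro sum_mono sphere_linear_moment fK q)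
  also have "\<dots> = ennreal R" unfolding R_def
    using normal_abs_moment_nonneg by (subst sum_ennreal) (auto simp: sum_distrib_left)
  finally have int: "(\<integral>\<^sup>+c. ennreal (F c) \<partial>sphere_measure K) \<le> ennreal R" .
  have aq: "a powr q > 0" using a by simp
  have "emeasure (random_eigenvector G \<psi> lam I) T = emeasure (sphere_measure K) (lin_comb G \<psi> K -` T \<inter> space (sphere_measure K))"
    unfolding random_eigenvector_def K_def[symmetric] by (rule emeasure_distr[OF lc T])
  also have "\<dots> \<le> emeasure (sphere_measure K) {c \<in> space (sphere_measure K). 1 \<le> ennreal (1 / a powr q) * ennreal (F c)}"
  proof (rule emeasure_mono)
    show "{c \<in> space (sphere_measure K). 1 \<le> ennreal (1 / a powr q) * ennreal (F c)} \<in> sets (sphere_measure K)"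
      using Fm by measurable
    show "lin_comb G \<psi> K -` T \<inter> space (sphere_measure K) \<subseteq> {c \<in> space (sphere_measure K). 1 \<le> ennreal (1 / a powr q) * ennreal (F c)}"
    proof
      fix c assume c: "c \<in> lin_comb G \<psi> K -` T \<inter> space (sphere_measure K)"
      then have "a \<le> Lq_norm q (verts G) (lin_comb G \<psi> K c)" by (simp add: T_def)
      then have "a powr q \<le> Lq_norm q (verts G) (lin_comb G \<psi> K c) powr q" using a q by (intro powr_mono2) auto
      also have "\<dots> = F c" using q by (simp add: F_def Lq_norm_def lin_comb_def powr_powr sum_nonneg)
      finally have "1 \<le> 1 / a powr q * F c" using aq by (simp add: field_simps)
      then have "ennreal 1 \<le> ennreal (1 / a powr q * F c)" by (rule ennreal_leI)
      also have "\<dots> = ennreal (1 / a powr q) * ennreal (F c)" using aq by (intro ennreal_mult') simp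
      finally have "1 \<le> ennreal (1 / a powr q) * ennreal (F c)" by simp
      then show "c \<in> {c \<in> space (sphere_measure K). 1 \<le> ennreal (1 / a powr q) * ennreal (F c)}"
        using c by blast
    qed
  qed
  also have "\<dots> \<le> ennreal (1 / a powr q) * (\<integral>\<^sup>+c. ennreal (F c) * indicator (space (sphere_measure K)) c \<partial>sphere_measure K)"
    using nn_integral_Markov_inequality[of "\<lambda>c. ennreal (F c)" "space (sphere_measure K)" "sphere_measure K" "ennreal (1 / a powr q)"] Fm
    by simp
  also have "(\<integral>\<^sup>+c. ennreal (F c) * indicator (space (sphere_measure K)) c \<partial>sphere_measure K) = (\<integral>\<^sup>+c. ennreal (F c) \<partial>sphere_measure K)"
    by (intro nn_integral_cong) simp
  also have "ennreal (1 / a powr q) * \<dots> \<le> ennreal (1 / a powr q) * ennreal R"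
    by (intro mult_left_mono int) simp
  also have "\<dots> = ennreal (R / a powr q)" using aq R0 by (simp add: ennreal_mult'[symmetric])
  finally have "emeasure (random_eigenvector G \<psi> lam I) T \<le> ennreal (R / a powr q)" .
  then have "measure (random_eigenvector G \<psi> lam I) T \<le> R / a powr q"
    unfolding measure_def using R0 aq by (intro enn2real_leI) auto
  moreover have "T = {u \<in> space (random_eigenvector G \<psi> lam I). Lq_norm q (verts G) u \<ge> a}"
    by (simp add: T_def random_eigenvector_def)
  ultimately show ?thesis by (simp add: R_def K_def)
qed

section \<open>Poisson averages\<close>

text \<open>Normalized to have maximum 1 instead of a fixed mass, so that it can be compared with
  indicator functions.\<close>

definition poisson :: "real \<Rightarrow> real \<Rightarrow> real \<Rightarrow> real" where
  "poisson a \<eta> t = \<eta>\<^sup>2 / ((t - a)\<^sup>2 + \<eta>\<^sup>2)"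

lemma poisson_range: "0 \<le> poisson a \<eta> t" "poisson a \<eta> t \<le> 1"
proof -
  show "0 \<le> poisson a \<eta> t" by (simp add: poisson_def)
  have "(t - a)\<^sup>2 + \<eta>\<^sup>2 \<ge> 0" by simp
  then consider "(t - a)\<^sup>2 + \<eta>\<^sup>2 = 0" | "(t - a)\<^sup>2 + \<eta>\<^sup>2 > 0" by linarith
  then show "poisson a \<eta> t \<le> 1" by cases (simp_all add: poisson_def)
qed

lemma poisson_measurable [measurable]: "poisson a \<eta> \<in> borel_measurable borel"
  unfolding poisson_def[abs_def] by measurable

text \<open>Since the kernel is at most 1 and \<epsilon> \<le> 1, \<bar>u\<bar> is at most 2. Hence
  the factor 3 from the sum in the difference of squares, and the bound 4.\<close>

lemma poisson_square_approx:
  assumes "\<bar>poisson a \<eta> t - u\<bar> \<le> \<epsilon>" "\<epsilon> \<le> 1"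
  shows "\<bar>(poisson a \<eta> t)\<^sup>2 - u * u\<bar> \<le> 3 * \<epsilon>" "u * u \<le> 4"
proof -
  have u: "\<bar>u\<bar> \<le> 2" using assms poisson_range[of a \<eta> t] by (auto simp: abs_le_iff)
  have "(poisson a \<eta> t)\<^sup>2 - u * u = (poisson a \<eta> t - u) * (poisson a \<eta> t + u)"
    by (simp add: power2_eq_square algebra_simps)
  moreover have "\<bar>poisson a \<eta> t - u\<bar> * \<bar>poisson a \<eta> t + u\<bar> \<le> \<epsilon> * 3"
    using assms u poisson_range[of a \<eta> t] by (intro mult_mono) (auto simp: abs_le_iff)
  ultimately show "\<bar>(poisson a \<eta> t)\<^sup>2 - u * u\<bar> \<le> 3 * \<epsilon>" by (simp add: abs_mult)
  have "\<bar>u\<bar> * \<bar>u\<bar> \<le> 2 * 2" using u by (intro mult_mono) auto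
  then show "u * u \<le> 4" by (simp add: abs_mult_self_eq)
qed

context bounded_degree_graph
begin

text \<open>Polynomial approximations are controlled on [-D, D] only; the support of the spectral
  measure makes this enough.\<close>

lemma spectral_integral_mono:
  fixes f f' :: "real \<Rightarrow> real" and b :: real
  assumes f: "f \<in> borel_measurable borel" and g: "f' \<in> borel_measurable borel"
    and le: "\<And>t. \<bar>t\<bar> \<le> real D \<Longrightarrow> f t \<le> f' t"
    and b: "\<And>t. \<bar>t\<bar> \<le> real D \<Longrightarrow> \<bar>f t\<bar> \<le> b" "\<And>t. \<bar>t\<bar> \<le> real D \<Longrightarrow> \<bar>f' t\<bar> \<le> b"
  shows "(LINT t|spectral_measure g. f t) \<le> (LINT t|spectral_measure g. f' t)"
proof -
  interpret S: real_distribution "spectral_measure g" by (rule spectral_measure_properties)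
  note supp = spectral_measure_properties(2)
  have i: "integrable (spectral_measure g) k" if "k \<in> borel_measurable borel" "\<And>t. \<bar>t\<bar> \<le> real D \<Longrightarrow> \<bar>k t\<bar> \<le> b" for k
  proof (rule S.integrable_const_bound[of _ b])
    show "AE t in spectral_measure g. norm (k t) \<le> b" using supp by eventually_elim (use that in auto)
  qed (use that in simp)
  show ?thesis
    by (rule integral_mono_AE[OF i[OF f b(1)] i[OF g b(2)]]) (use supp le in \<open>auto elim: eventually_mono\<close>)
qed

lemma poisson_integral:
  assumes "\<eta> > 0"
  shows "(LINT t|spectral_measure g. poisson a \<eta> t) = \<eta> * Im (resolvent g (Complex a \<eta>))"
proof -
  interpret S: real_distribution "spectral_measure g" by (rule spectral_measure_properties)
  have "integrable (spectral_measure g) (\<lambda>t. 1 / (complex_of_real t - Complex a \<eta>))"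
  proof (rule S.integrable_const_bound[of _ "1 / \<eta>"])
    have "\<eta> \<le> cmod (complex_of_real t - Complex a \<eta>)" for t
      using abs_Im_le_cmod[of "complex_of_real t - Complex a \<eta>"] assms by simp
    then show "AE t in spectral_measure g. cmod (1 / (complex_of_real t - Complex a \<eta>)) \<le> 1 / \<eta>"
      using assms by (simp add: norm_divide frac_le)
  qed simp
  then have "Im (resolvent g (Complex a \<eta>)) = (LINT t|spectral_measure g. Im (1 / (complex_of_real t - Complex a \<eta>)))"
    using assms by (subst spectral_measure_properties(4)) (auto intro: integral_Im[symmetric])
  also have "\<dots> = (LINT t|spectral_measure g. 1 / \<eta> * poisson a \<eta> t)"
    using assms by (intro Bochner_Integration.integral_cong refl) (simp add: Im_divide poisson_def power2_eq_square)
  finally show ?thesis using assms by simp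
qed

lemma resolvent_Im_nonneg:
  assumes "\<eta> > 0" shows "Im (resolvent g (Complex a \<eta>)) \<ge> 0"
proof -
  have "\<eta> * Im (resolvent g (Complex a \<eta>)) \<ge> 0"
    unfolding poisson_integral[OF assms, symmetric] by (intro Bochner_Integration.integral_nonneg poisson_range)
  then show ?thesis using assms by (simp add: zero_le_mult_iff)
qed

context
  fixes a \<eta> \<epsilon> :: real and Q :: "real poly"
  assumes approx: "\<And>t. \<bar>t\<bar> \<le> real D \<Longrightarrow> \<bar>poisson a \<eta> t - poly Q t\<bar> \<le> \<epsilon>" and \<epsilon>: "\<epsilon> \<le> 1"
begin

lemma poly_moment_le_resolvent:
  assumes "\<eta> > 0" shows "poly_moment g Q \<le> \<eta> * Im (resolvent g (Complex a \<eta>)) + \<epsilon>"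
proof -
  interpret S: real_distribution "spectral_measure g" by (rule spectral_measure_properties)
  have ip: "integrable (spectral_measure g) (poisson a \<eta>)"
    by (rule S.integrable_const_bound[of _ 1]) (auto simp: poisson_range)
  have "(LINT t|spectral_measure g. poly Q t) \<le> (LINT t|spectral_measure g. poisson a \<eta> t + \<epsilon>)"
  proof (rule spectral_integral_mono[of _ _ 2])
    fix t assume "\<bar>t\<bar> \<le> real D"
    then show "poly Q t \<le> poisson a \<eta> t + \<epsilon>" "\<bar>poly Q t\<bar> \<le> 2" "\<bar>poisson a \<eta> t + \<epsilon>\<bar> \<le> 2"
      using approx[of t] \<epsilon> poisson_range[of a \<eta> t] by (auto simp: abs_le_iff)
  qed (auto intro!: borel_measurable_continuous_onI continuous_intros)
  also have "\<dots> = \<eta> * Im (resolvent g (Complex a \<eta>)) + \<epsilon>"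
    using ip S.prob_space by (simp add: poisson_integral[OF assms])
  finally show ?thesis by (simp add: spectral_measure_properties(3))
qed

text \<open>At distance at most \<eta> from the centre the kernel is at least 1/2, so the indicator
  is at most 4 times its square, which costs 4 * 3 \<epsilon> on passing to Q^2. The bound 4 on the
  moment lets a later truncation at 4 act trivially on the tree.\<close>

lemma spectral_measure_interval_le:
  assumes "\<eta> > 0"
  shows "emeasure (spectral_measure g) {a - \<eta>..a + \<eta>} \<le> ennreal (4 * poly_moment g (Q * Q) + 12 * \<epsilon>)"
    "poly_moment g (Q * Q) \<le> 4"
proof -
  interpret S: real_distribution "spectral_measure g" by (rule spectral_measure_properties)
  have \<epsilon>0: "\<epsilon> \<ge> 0" using approx[of 0] by simp
  have QQ: "4 * poly_moment g (Q * Q) + 12 * \<epsilon> = (LINT t|spectral_measure g. poly (smult 4 (Q * Q) + [:12 * \<epsilon>:]) t)"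
    unfolding spectral_measure_properties(3) by (simp add: poly_moment_add poly_moment_smult)
     (simp add: poly_moment_def closed_walks_def walk_vector_0)
  have "measure (spectral_measure g) {a - \<eta>..a + \<eta>} = (LINT t|spectral_measure g. indicator {a - \<eta>..a + \<eta>} t)" by simp
  also have "\<dots> \<le> (LINT t|spectral_measure g. poly (smult 4 (Q * Q) + [:12 * \<epsilon>:]) t)"
  proof (rule spectral_integral_mono[of _ _ 28])
    fix t assume t: "\<bar>t\<bar> \<le> real D"
    note sq = poisson_square_approx[OF approx[OF t] \<epsilon>]
    have q: "poly (smult 4 (Q * Q) + [:12 * \<epsilon>:]) t = 4 * (poly Q t * poly Q t) + 12 * \<epsilon>" by simp
    have ind: "indicator {a - \<eta>..a + \<eta>} t \<le> 4 * (poisson a \<eta> t)\<^sup>2"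
    proof (cases "t \<in> {a - \<eta>..a + \<eta>}")
      case True
      then have "\<bar>t - a\<bar> \<le> \<bar>\<eta>\<bar>" using assms by (auto simp: abs_le_iff)
      then have "(t - a)\<^sup>2 \<le> \<eta>\<^sup>2" by (simp add: abs_le_square_iff)
      then have "1 / 2 \<le> poisson a \<eta> t" 
        using add_nonneg_pos[of "(t - a)\<^sup>2" "\<eta>\<^sup>2"] assms by (simp add: poisson_def)
      then have "(1 / 2)\<^sup>2 \<le> (poisson a \<eta> t)\<^sup>2" by (intro power_mono) auto
      then show ?thesis using True by (simp add: power2_eq_square)
    qed simp
    show "indicator {a - \<eta>..a + \<eta>} t \<le> poly (smult 4 (Q * Q) + [:12 * \<epsilon>:]) t"
      unfolding q using ind sq by (auto simp: abs_le_iff)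
    show "\<bar>poly (smult 4 (Q * Q) + [:12 * \<epsilon>:]) t\<bar> \<le> 28"
      unfolding q using sq(2) \<epsilon> \<epsilon>0 by (simp add: abs_le_iff)
    show "\<bar>indicator {a - \<eta>..a + \<eta>} t\<bar> \<le> (28::real)" by (simp add: indicator_def)
  qed (auto intro!: borel_measurable_continuous_onI continuous_intros)
  finally show "emeasure (spectral_measure g) {a - \<eta>..a + \<eta>} \<le> ennreal (4 * poly_moment g (Q * Q) + 12 * \<epsilon>)"
    unfolding QQ S.emeasure_eq_measure by (rule ennreal_leI)
  have "(LINT t|spectral_measure g. poly (Q * Q) t) \<le> (LINT t|spectral_measure g. 4)"
  proof (rule spectral_integral_mono[of _ _ 4])
    fix t assume t: "\<bar>t\<bar> \<le> real D"
    note sq = poisson_square_approx[OF approx[OF t] \<epsilon>]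
    show "poly (Q * Q) t \<le> 4" "\<bar>poly (Q * Q) t\<bar> \<le> 4" using sq(2) by auto
  qed (auto intro!: borel_measurable_continuous_onI continuous_intros)
  then show "poly_moment g (Q * Q) \<le> 4"
    using S.prob_space by (simp add: spectral_measure_properties(3) del: poly_mult)
qed

end

end

section \<open>Local masses and eigenvalue counts on one finite graph\<close>

lemma powr_add_one_le:
  fixes w p :: real assumes "w \<ge> 0" "p \<ge> 1" shows "(w + 1) powr p \<le> 2 powr p * (w powr p + 1)"
proof -
  have "(w + 1) powr p \<le> (2 * max w 1) powr p" using assms by (intro powr_mono2) auto
  also have "\<dots> = 2 powr p * (max w 1) powr p" using assms by (simp add: powr_mult)
  also have "\<dots> \<le> 2 powr p * (w powr p + 1)"
    using assms by (intro mult_left_mono) (auto simp: max_def)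
  finally show ?thesis .
qed

text \<open>One graph with its width, approximating polynomial and error. The interval and
  \<open>K\<close> enter only in a later context, so the moment bound on the local masses cannot
  depend on them.\<close>

locale approximate_eigenvectors = graph_eigenbasis G \<psi> lam D
  for G :: "'a graph" and \<psi> lam D +
  fixes P :: "rclass measure" and h :: nat and d :: real and a \<eta> \<epsilon> :: real and Q :: "real poly"
  assumes P: "random_rooted_graph P" and D: "D \<ge> 1"
    and P_degree: "AE c in P. \<forall>y\<in>verts (fst (representative c)). card (neighbours (fst (representative c)) y) \<le> D"
    and dTV_le: "dTV (empirical_ball_law h G) (ball_law h P) \<le> d"
    and \<eta>: "\<eta> > 0" and \<epsilon>: "\<epsilon> \<le> 1" "2 * \<epsilon> \<le> \<eta>"
    and deg_Q: "degree Q \<le> h" and deg_QQ: "degree (Q * Q) \<le> h"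
    and approx: "\<And>t. \<bar>t\<bar> \<le> real D \<Longrightarrow> \<bar>poisson a \<eta> t - poly Q t\<bar> \<le> \<epsilon>"
begin

lemma \<epsilon>_nonneg: "\<epsilon> \<ge> 0"
  using approx[of 0] by simp

lemma AE_bounded_degree: "AE c in P. bounded_degree_graph (representative c) D"
  using P_degree AE_space
proof eventually_elim
  case (elim c)
  then have "rooted_graph (representative c)"
    by (simp add: random_rooted_graph_space[OF P] rooted_classes_representative)
  then show ?case using elim D
    by unfold_locales (auto simp: rooted_graph_simple rooted_graph_locally_finite rooted_graph_root)
qed

text \<open>The diagonal entry at \<open>x\<close> of the Poisson kernel of the adjacency matrix;
  \<open>local_mass2\<close> is that of its square.\<close>

definition local_mass :: "'a \<Rightarrow> real" where
  "local_mass x = (\<Sum>k<n. poisson a \<eta> (lam k) * (\<psi> k x)\<^sup>2)"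

definition local_mass2 :: "'a \<Rightarrow> real" where
  "local_mass2 x = (\<Sum>k<n. (poisson a \<eta> (lam k))\<^sup>2 * (\<psi> k x)\<^sup>2)"

text \<open>The weights \<psi>_k(x)^2 sum to 1 and the eigenvalues lie in [-D, D], so a uniform
  error there is an error of each diagonal entry.\<close>

lemma spectral_sum_diff:
  assumes x: "x \<in> verts G" and f: "\<And>t. \<bar>t\<bar> \<le> real D \<Longrightarrow> \<bar>f t - f' t\<bar> \<le> b"
  shows "\<bar>(\<Sum>k<n. f (lam k) * (\<psi> k x)\<^sup>2) - (\<Sum>k<n. f' (lam k) * (\<psi> k x)\<^sup>2)\<bar> \<le> b"
proof -
  have "\<bar>(\<Sum>k<n. f (lam k) * (\<psi> k x)\<^sup>2) - (\<Sum>k<n. f' (lam k) * (\<psi> k x)\<^sup>2)\<bar>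
     = \<bar>\<Sum>k<n. (f (lam k) - f' (lam k)) * (\<psi> k x)\<^sup>2\<bar>"
    by (simp add: sum_subtractf left_diff_distrib)
  also have "\<dots> \<le> (\<Sum>k<n. b * (\<psi> k x)\<^sup>2)"
    using f eigenvalue_bound by (intro order_trans[OF sum_abs] sum_mono) (auto simp: abs_mult intro!: mult_right_mono)
  also have "\<dots> = b" using sum_eigenvectors_sq[OF x] by (simp add: sum_distrib_left[symmetric])
  finally show ?thesis .
qed

lemma local_mass_approx: "x \<in> verts G \<Longrightarrow> \<bar>local_mass x - poly_moment (G, x) Q\<bar> \<le> \<epsilon>"
  unfolding poly_moment_eigen local_mass_def by (rule spectral_sum_diff, assumption, rule approx)

lemma local_mass2_approx: "x \<in> verts G \<Longrightarrow> \<bar>local_mass2 x - poly_moment (G, x) (Q * Q)\<bar> \<le> 3 * \<epsilon>"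
  unfolding poly_moment_eigen local_mass2_def poly_mult
  by (rule spectral_sum_diff, assumption, rule poisson_square_approx(1)[OF approx \<epsilon>(1)])

lemma local_mass_range: "0 \<le> local_mass x" "x \<in> verts G \<Longrightarrow> local_mass x \<le> 1"
proof -
  show "0 \<le> local_mass x" unfolding local_mass_def by (intro sum_nonneg mult_nonneg_nonneg poisson_range) auto
  assume x: "x \<in> verts G"
  have "local_mass x \<le> (\<Sum>k<n. 1 * (\<psi> k x)\<^sup>2)"
    unfolding local_mass_def by (intro sum_mono mult_right_mono poisson_range) auto
  then show "local_mass x \<le> 1" using sum_eigenvectors_sq[OF x] by simp
qed

lemma n_pos: "real n > 0"
  using fin nonempty by (simp add: card_gt_0_iff)

lemma local_mass_moment:
  assumes p: "p \<ge> 1" and M0: "M0 \<ge> 0"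
    and res: "(\<integral>\<^sup>+c. ennreal (Im (resolvent (representative c) (Complex a \<eta>)) powr p) \<partial>P) \<le> ennreal M0"
    and L: "(2 / \<eta>) powr p * d \<le> L" "L \<ge> 0"
  shows "(\<Sum>x\<in>verts G. (local_mass x / \<eta>) powr p) \<le> real n * (2 powr p * (M0 + L + 1))"
proof -
  \<comment> \<open>The cut at 2 bounds the test function by 2/\<eta>, and subtracting \<epsilon>
    puts it below Im R on the tree. On the graph the cut is harmless: local masses are at most 1, so
    their approximations are at most 2. The lost 2 \<epsilon> is at most \<eta>, which adds 1 after
    division.\<close>
  define w where "w u = max 0 (min u 2 - \<epsilon>) / \<eta>" for u
  have w: "0 \<le> w u" "w u \<le> 2 / \<eta>" for u
    using \<eta> \<epsilon>_nonneg by (auto simp: w_def intro!: divide_right_mono)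
  have wp: "0 \<le> w u powr p" "w u powr p \<le> (2 / \<eta>) powr p" for u
    using w[of u] p by (auto intro!: powr_mono2)
  have tree: "AE c in P. ennreal (w (poly_moment (representative c) Q) powr p)
      \<le> ennreal (Im (resolvent (representative c) (Complex a \<eta>)) powr p)"
    using AE_bounded_degree
  proof eventually_elim
    case (elim c)
    then interpret T: bounded_degree_graph "representative c" D .
    have "max 0 (min (poly_moment (representative c) Q) 2 - \<epsilon>) \<le> \<eta> * Im (resolvent (representative c) (Complex a \<eta>))"
      using T.poly_moment_le_resolvent[OF approx \<epsilon>(1) \<eta>] T.resolvent_Im_nonneg[OF \<eta>, of a] \<eta> by auto
    then have "w (poly_moment (representative c) Q) \<le> Im (resolvent (representative c) (Complex a \<eta>))"
      using \<eta> by (simp add: w_def divide_le_eq mult.commute)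
    then show ?case using w p by (intro ennreal_leI powr_mono2) auto
  qed
  define Avg where "Avg = (\<Sum>x\<in>verts G. w (poly_moment (G, x) Q) powr p) / real n"
  have "ennreal Avg \<le> (\<integral>\<^sup>+c. ennreal (w (poly_moment (representative c) Q) powr p) \<partial>P) + ennreal ((2 / \<eta>) powr p * d)"
    unfolding Avg_def by (rule empirical_vs_limit(1)[OF P simple fin nonempty deg_Q wp dTV_le])
  also have "\<dots> \<le> ennreal M0 + ennreal L"
    using order_trans[OF nn_integral_mono_AE[OF tree] res] L by (intro add_mono ennreal_leI) auto
  also have "\<dots> = ennreal (M0 + L)" using M0 L by simp
  finally have "Avg \<le> M0 + L" using M0 L by (simp add: ennreal_le_iff del: ennreal_plus)
  then have avg: "(\<Sum>x\<in>verts G. w (poly_moment (G, x) Q) powr p) \<le> real n * (M0 + L)"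
    using n_pos by (simp add: Avg_def divide_le_eq mult.commute)
  have "(local_mass x / \<eta>) powr p \<le> 2 powr p * (w (poly_moment (G, x) Q) powr p + 1)" if x: "x \<in> verts G" for x
  proof -
    have X: "\<bar>local_mass x - poly_moment (G, x) Q\<bar> \<le> \<epsilon>" by (rule local_mass_approx[OF x])
    then have "local_mass x \<le> max 0 (min (poly_moment (G, x) Q) 2 - \<epsilon>) + 2 * \<epsilon>"
      using local_mass_range(2)[OF x] \<epsilon> by (auto simp: abs_le_iff)
    then have "local_mass x / \<eta> \<le> (max 0 (min (poly_moment (G, x) Q) 2 - \<epsilon>) + \<eta>) / \<eta>"
      using \<epsilon> \<eta> by (intro divide_right_mono) auto
    also have "\<dots> = w (poly_moment (G, x) Q) + 1" using \<eta> by (simp add: w_def add_divide_distrib)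
    finally have "(local_mass x / \<eta>) powr p \<le> (w (poly_moment (G, x) Q) + 1) powr p"
      using local_mass_range(1) \<eta> p by (intro powr_mono2) auto
    also have "\<dots> \<le> 2 powr p * (w (poly_moment (G, x) Q) powr p + 1)" by (intro powr_add_one_le w p)
    finally show ?thesis .
  qed
  then have "(\<Sum>x\<in>verts G. (local_mass x / \<eta>) powr p) \<le> (\<Sum>x\<in>verts G. 2 powr p * (w (poly_moment (G, x) Q) powr p + 1))"
    by (rule sum_mono)
  also have "\<dots> = 2 powr p * ((\<Sum>x\<in>verts G. w (poly_moment (G, x) Q) powr p) + real n)"
    by (simp add: sum_distrib_left[symmetric] sum.distrib)
  also have "\<dots> \<le> 2 powr p * (real n * (M0 + L) + real n)"
    using avg by (intro mult_left_mono add_right_mono) auto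
  finally show ?thesis by (simp add: algebra_simps)
qed

lemma local_mass2_lower:
  assumes dens: "ennreal (2 * \<eta> * c0) \<le> (\<integral>\<^sup>+c. emeasure (spectral_measure (representative c)) {a - \<eta>..a + \<eta>} \<partial>P)"
    and d: "d \<ge> 0"
  shows "real n * (2 * \<eta> * c0) \<le> 4 * (\<Sum>x\<in>verts G. local_mass2 x) + real n * (24 * \<epsilon> + 28 * d)"
proof -
  \<comment> \<open>The truncated upper bound for the mass of the interval, at most 4 * 4 + 12 = 28.
    On the graph it costs 12 \<epsilon> from here and 4 * 3 \<epsilon> from approximating
    \<open>local_mass2\<close>, in total 24 \<epsilon>.\<close>
  define f where "f u = 4 * max 0 (min u 4) + 12 * \<epsilon>" for u
  have f: "0 \<le> f u" "f u \<le> 28" for u using \<epsilon>_nonneg \<epsilon>(1) by (auto simp: f_def)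
  have tree: "AE c in P. emeasure (spectral_measure (representative c)) {a - \<eta>..a + \<eta>}
     \<le> ennreal (f (poly_moment (representative c) (Q * Q)))"
    using AE_bounded_degree
  proof eventually_elim
    case (elim c)
    then interpret T: bounded_degree_graph "representative c" D .
    note S = T.spectral_measure_interval_le[OF approx \<epsilon>(1) \<eta>]
    have "emeasure (spectral_measure (representative c)) {a - \<eta>..a + \<eta>}
      \<le> ennreal (4 * poly_moment (representative c) (Q * Q) + 12 * \<epsilon>)" by (rule S(1))
    also have "\<dots> \<le> ennreal (f (poly_moment (representative c) (Q * Q)))"
      using S(2) unfolding f_def by (intro ennreal_leI) auto
    finally show ?case .
  qed
  define Avg where "Avg = (\<Sum>x\<in>verts G. f (poly_moment (G, x) (Q * Q))) / real n"
  have Avg0: "Avg \<ge> 0" unfolding Avg_def using f by (intro divide_nonneg_nonneg sum_nonneg) auto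
  have "ennreal (2 * \<eta> * c0) \<le> (\<integral>\<^sup>+c. ennreal (f (poly_moment (representative c) (Q * Q))) \<partial>P)"
    using dens nn_integral_mono_AE[OF tree] by (rule order_trans)
  also have "\<dots> \<le> ennreal Avg + ennreal (28 * d)"
    unfolding Avg_def by (rule empirical_vs_limit(2)[OF P simple fin nonempty deg_QQ f dTV_le])
  also have "\<dots> = ennreal (Avg + 28 * d)" using Avg0 d by simp
  finally have "2 * \<eta> * c0 \<le> Avg + 28 * d" using Avg0 d by (simp add: ennreal_le_iff del: ennreal_plus)
  then have "real n * (2 * \<eta> * c0) \<le> real n * (Avg + 28 * d)" by (intro mult_left_mono) auto
  also have "\<dots> = (\<Sum>x\<in>verts G. f (poly_moment (G, x) (Q * Q))) + real n * (28 * d)"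
    using n_pos by (simp add: Avg_def distrib_left)
  also have "(\<Sum>x\<in>verts G. f (poly_moment (G, x) (Q * Q))) \<le> (\<Sum>x\<in>verts G. 4 * local_mass2 x + 24 * \<epsilon>)"
  proof (rule sum_mono)
    fix x assume x: "x \<in> verts G"
    have "local_mass2 x \<ge> 0" unfolding local_mass2_def by (intro sum_nonneg) auto
    then show "f (poly_moment (G, x) (Q * Q)) \<le> 4 * local_mass2 x + 24 * \<epsilon>"
      using local_mass2_approx[OF x] \<epsilon>_nonneg by (auto simp: f_def abs_le_iff)
  qed
  also have "\<dots> = 4 * (\<Sum>x\<in>verts G. local_mass2 x) + real n * (24 * \<epsilon>)"
    by (simp add: sum.distrib sum_distrib_left)
  finally show ?thesis by (simp add: algebra_simps)
qed

text \<open>Weak inequalities on both sides: endpoints of the interval may or may not belong to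
  it.\<close>

context
  fixes I :: "real set" and K :: real
  assumes K: "K > 0" and I_in: "\<And>t. t \<in> I \<Longrightarrow> \<bar>t - a\<bar> \<le> K * \<eta>" and I_out: "\<And>t. t \<notin> I \<Longrightarrow> \<bar>t - a\<bar> \<ge> K * \<eta>"
begin

lemma projection_le_local_mass:
  "(\<Sum>k\<in>spectral_indices G lam I. (\<psi> k x)\<^sup>2) \<le> (1 + K\<^sup>2) * local_mass x"
proof -
  have "(\<Sum>k\<in>spectral_indices G lam I. (\<psi> k x)\<^sup>2)
     \<le> (\<Sum>k\<in>spectral_indices G lam I. (1 + K\<^sup>2) * (poisson a \<eta> (lam k) * (\<psi> k x)\<^sup>2))"
  proof (rule sum_mono)
    fix k assume "k \<in> spectral_indices G lam I"
    then have "\<bar>lam k - a\<bar> \<le> \<bar>K * \<eta>\<bar>" using I_in[of "lam k"] K \<eta> by (simp add: spectral_indices_def)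
    then have "(lam k - a)\<^sup>2 \<le> (K * \<eta>)\<^sup>2" by (simp only: abs_le_square_iff)
    then have "(lam k - a)\<^sup>2 + \<eta>\<^sup>2 \<le> (1 + K\<^sup>2) * \<eta>\<^sup>2" by (simp add: power_mult_distrib algebra_simps)
    moreover have "(lam k - a)\<^sup>2 + \<eta>\<^sup>2 > 0" using \<eta> by (simp add: add_nonneg_pos)
    ultimately have "1 \<le> (1 + K\<^sup>2) * poisson a \<eta> (lam k)" by (simp add: poisson_def)
    then have "1 * (\<psi> k x)\<^sup>2 \<le> (1 + K\<^sup>2) * poisson a \<eta> (lam k) * (\<psi> k x)\<^sup>2" by (rule mult_right_mono) simp
    then show "(\<psi> k x)\<^sup>2 \<le> (1 + K\<^sup>2) * (poisson a \<eta> (lam k) * (\<psi> k x)\<^sup>2)" by (simp add: mult.assoc)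
  qed
  also have "\<dots> \<le> (\<Sum>k<n. (1 + K\<^sup>2) * (poisson a \<eta> (lam k) * (\<psi> k x)\<^sup>2))"
    by (intro sum_mono2) (auto simp: spectral_indices_def poisson_range)
  finally show ?thesis by (simp add: local_mass_def sum_distrib_left)
qed

lemma local_mass2_le: "local_mass2 x \<le> (\<Sum>k\<in>spectral_indices G lam I. (\<psi> k x)\<^sup>2) + local_mass x / K\<^sup>2"
proof -
  have "local_mass2 x \<le> (\<Sum>k<n. (if lam k \<in> I then (\<psi> k x)\<^sup>2 else 0) + poisson a \<eta> (lam k) * (\<psi> k x)\<^sup>2 / K\<^sup>2)"
    unfolding local_mass2_def
  proof (rule sum_mono)
    fix k
    note r = poisson_range[of a \<eta> "lam k"]
    have sq: "(poisson a \<eta> (lam k))\<^sup>2 \<le> poisson a \<eta> (lam k)" using r by (simp add: power2_eq_square mult_left_le)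
    show "(poisson a \<eta> (lam k))\<^sup>2 * (\<psi> k x)\<^sup>2 \<le> (if lam k \<in> I then (\<psi> k x)\<^sup>2 else 0) + poisson a \<eta> (lam k) * (\<psi> k x)\<^sup>2 / K\<^sup>2"
    proof (cases "lam k \<in> I")
      case True
      have "(poisson a \<eta> (lam k))\<^sup>2 * (\<psi> k x)\<^sup>2 \<le> 1 * (\<psi> k x)\<^sup>2" using r sq by (intro mult_right_mono) auto
      moreover have "poisson a \<eta> (lam k) * (\<psi> k x)\<^sup>2 / K\<^sup>2 \<ge> 0" using r by simp
      ultimately show ?thesis using True by simp
    next
      case False
      then have "\<bar>K * \<eta>\<bar> \<le> \<bar>lam k - a\<bar>" using I_out[of "lam k"] K \<eta> by simp
      then have "K\<^sup>2 * \<eta>\<^sup>2 \<le> (lam k - a)\<^sup>2" by (simp only: abs_le_square_iff power_mult_distrib)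
      then have "K\<^sup>2 * \<eta>\<^sup>2 \<le> (lam k - a)\<^sup>2 + \<eta>\<^sup>2" using zero_le_power2[of \<eta>] by linarith
      moreover have "(lam k - a)\<^sup>2 + \<eta>\<^sup>2 > 0" using \<eta> by (simp add: add_nonneg_pos)
      ultimately have "poisson a \<eta> (lam k) \<le> 1 / K\<^sup>2" using K by (simp add: poisson_def divide_simps mult.commute)
      then have "poisson a \<eta> (lam k) * poisson a \<eta> (lam k) * (\<psi> k x)\<^sup>2 \<le> 1 / K\<^sup>2 * poisson a \<eta> (lam k) * (\<psi> k x)\<^sup>2"
        using r by (intro mult_right_mono) auto
      then show ?thesis using False by (simp add: power2_eq_square)
    qed
  qed
  also have "\<dots> = (\<Sum>k<n. if lam k \<in> I then (\<psi> k x)\<^sup>2 else 0) + local_mass x / K\<^sup>2"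
    by (simp add: sum.distrib local_mass_def sum_divide_distrib)
  also have "(\<Sum>k<n. if lam k \<in> I then (\<psi> k x)\<^sup>2 else 0) = (\<Sum>k\<in>spectral_indices G lam I. (\<psi> k x)\<^sup>2)"
    by (subst sum.inter_filter[symmetric]) (auto simp: spectral_indices_def intro!: sum.cong)
  finally show ?thesis .
qed

text \<open>In units of n \<eta> c0: the density gives 2, the errors take at most 1, so the sum of
  \<open>local_mass2\<close> is at least 1/4. The tail outside the interval takes at most 1/8, and
  1/8 is left for the eigenvalues. The tail needs only a first moment, obtained from the p-th one by
  y \<le> 1 + y^p.\<close>

lemma eigenvalue_count_lower:
  assumes dens: "ennreal (2 * \<eta> * c0) \<le> (\<integral>\<^sup>+c. emeasure (spectral_measure (representative c)) {a - \<eta>..a + \<eta>} \<partial>P)"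
    and d: "d \<ge> 0" and err: "24 * \<epsilon> + 28 * d \<le> \<eta> * c0"
    and U: "(\<Sum>x\<in>verts G. (local_mass x / \<eta>) powr p) \<le> real n * U" "p \<ge> 1"
    and KU: "8 * (1 + U) \<le> K\<^sup>2 * c0"
  shows "real n * (\<eta> * c0) / 8 \<le> real (card (spectral_indices G lam I))"
proof -
  have "(\<Sum>x\<in>verts G. local_mass x / \<eta>) \<le> (\<Sum>x\<in>verts G. 1 + (local_mass x / \<eta>) powr p)"
  proof (rule sum_mono)
    fix x
    have y: "local_mass x / \<eta> \<ge> 0" using local_mass_range(1) \<eta> by simp
    show "local_mass x / \<eta> \<le> 1 + (local_mass x / \<eta>) powr p"
    proof (cases "local_mass x / \<eta> \<le> 1")
      case False
      then have "(local_mass x / \<eta>) powr 1 \<le> (local_mass x / \<eta>) powr p" using U by (intro powr_mono) auto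
      moreover have "(local_mass x / \<eta>) powr 1 = local_mass x / \<eta>" using y by (rule powr_one)
      ultimately show ?thesis by linarith
    qed (simp add: add_increasing2)
  qed
  also have "\<dots> \<le> real n * (1 + U)" using U(1) by (simp add: sum.distrib algebra_simps)
  finally have "(\<Sum>x\<in>verts G. local_mass x) / \<eta> \<le> real n * (1 + U)" by (simp add: sum_divide_distrib)
  then have "(\<Sum>x\<in>verts G. local_mass x) \<le> real n * (1 + U) * \<eta>" using \<eta> by (simp add: divide_le_eq)
  then have "(\<Sum>x\<in>verts G. local_mass x) / K\<^sup>2 \<le> real n * (1 + U) * \<eta> / K\<^sup>2" by (intro divide_right_mono) auto
  also have "\<dots> \<le> real n * (\<eta> * c0) / 8"
  proof -
    have "(1 + U) / K\<^sup>2 \<le> c0 / 8" using KU K by (simp add: divide_simps mult.commute)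
    then have "real n * \<eta> * ((1 + U) / K\<^sup>2) \<le> real n * \<eta> * (c0 / 8)" using \<eta> by (intro mult_left_mono) auto
    then show ?thesis by (simp add: mult_ac)
  qed
  finally have tail: "(\<Sum>x\<in>verts G. local_mass x) / K\<^sup>2 \<le> real n * (\<eta> * c0) / 8" .
  have "(\<Sum>x\<in>verts G. local_mass2 x) \<le> (\<Sum>x\<in>verts G. (\<Sum>k\<in>spectral_indices G lam I. (\<psi> k x)\<^sup>2) + local_mass x / K\<^sup>2)"
    by (intro sum_mono local_mass2_le)
  also have "\<dots> = real (card (spectral_indices G lam I)) + (\<Sum>x\<in>verts G. local_mass x) / K\<^sup>2"
    by (simp add: sum.distrib card_spectral_indices sum_divide_distrib)
  finally have "(\<Sum>x\<in>verts G. local_mass2 x) \<le> real (card (spectral_indices G lam I)) + real n * (\<eta> * c0) / 8"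
    using tail by linarith
  moreover have "real n * (24 * \<epsilon> + 28 * d) \<le> real n * (\<eta> * c0)" using err by (intro mult_left_mono) auto
  ultimately show ?thesis using local_mass2_lower[OF dens d] by (simp add: algebra_simps)
qed

text \<open>In the ratio of the diagonal entry to the dimension one factor \<eta> cancels: it is at
  most (W/n) times the normalized local mass. The sum of the p-th powers is then of order n^(1 -
  q/2), exactly the power of n in the q-th power of the threshold.\<close>

lemma random_eigenvector_tail_bound:
  assumes cnt: "real n * (\<eta> * c0) / 8 \<le> real (card (spectral_indices G lam I))"
    and U: "(\<Sum>x\<in>verts G. (local_mass x / \<eta>) powr (q / 2)) \<le> real n * U" and q: "q \<ge> 2" and c0: "c0 > 0"
    and C': "C' > 0" "normal_abs_moment q * ((8 * (1 + K\<^sup>2) / c0) powr (q / 2) * U) \<le> C' powr q"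
    and \<Lambda>: "\<Lambda> > 0"
  shows "measure (random_eigenvector G \<psi> lam I)
      {u \<in> space (random_eigenvector G \<psi> lam I). Lq_norm q (verts G) u \<ge> \<Lambda> * C' * real n powr (1 / q - 1 / 2)} \<le> \<Lambda> powr (- q)"
proof -
  let ?S = "spectral_indices G lam I" and ?a = "\<Lambda> * C' * real n powr (1 / q - 1 / 2)" and ?p = "q / 2"
  define W where "W = 8 * (1 + K\<^sup>2) / c0"
  have cpos: "real n * (\<eta> * c0) / 8 > 0" using n_pos \<eta> c0 by simp
  then have card_pos: "real (card ?S) > 0" using cnt by linarith
  have ne: "?S \<noteq> {}" using card_pos by auto
  have le: "((\<Sum>k\<in>?S. (\<psi> k x)\<^sup>2) / real (card ?S)) powr ?p \<le> (W / real n) powr ?p * (local_mass x / \<eta>) powr ?p" for x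
  proof -
    have "(\<Sum>k\<in>?S. (\<psi> k x)\<^sup>2) / real (card ?S) \<le> (1 + K\<^sup>2) * local_mass x / (real n * (\<eta> * c0) / 8)"
      using projection_le_local_mass[of x] cnt cpos local_mass_range(1)[of x] by (intro frac_le) auto
    also have "\<dots> = (W / real n) * (local_mass x / \<eta>)" using n_pos \<eta> c0 by (simp add: W_def field_simps)
    finally have "((\<Sum>k\<in>?S. (\<psi> k x)\<^sup>2) / real (card ?S)) powr ?p \<le> ((W / real n) * (local_mass x / \<eta>)) powr ?p"
      using q by (intro powr_mono2) (auto intro!: divide_nonneg_nonneg sum_nonneg)
    also have "\<dots> = (W / real n) powr ?p * (local_mass x / \<eta>) powr ?p"
      using c0 \<eta> local_mass_range(1)[of x] by (intro powr_mult)
    finally show ?thesis .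
  qed
  have np: "(W / real n) powr ?p * real n = W powr ?p * real n powr (1 - ?p)"
  proof -
    have "W \<ge> 0" using c0 by (simp add: W_def)
    then show ?thesis using n_pos by (simp add: powr_divide powr_diff)
  qed
  have "(\<Sum>x\<in>verts G. ((\<Sum>k\<in>?S. (\<psi> k x)\<^sup>2) / real (card ?S)) powr ?p)
      \<le> (\<Sum>x\<in>verts G. (W / real n) powr ?p * (local_mass x / \<eta>) powr ?p)" by (intro sum_mono le)
  also have "\<dots> = (W / real n) powr ?p * (\<Sum>x\<in>verts G. (local_mass x / \<eta>) powr ?p)"
    by (simp add: sum_distrib_left)
  also have "\<dots> \<le> (W / real n) powr ?p * (real n * U)" using U by (intro mult_left_mono) auto
  also have "\<dots> = W powr ?p * real n powr (1 - ?p) * U" using np by (simp add: mult.assoc[symmetric])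
  finally have sum: "(\<Sum>x\<in>verts G. ((\<Sum>k\<in>?S. (\<psi> k x)\<^sup>2) / real (card ?S)) powr ?p) \<le> W powr ?p * real n powr (1 - ?p) * U" .
  have a: "?a > 0" using \<Lambda> C' n_pos by simp
  have aq: "?a powr q = \<Lambda> powr q * C' powr q * real n powr (1 - ?p)"
  proof -
    have "?a powr q = \<Lambda> powr q * C' powr q * (real n powr (1 / q - 1 / 2)) powr q"
      using \<Lambda> C' by (simp add: powr_mult)
    also have "(real n powr (1 / q - 1 / 2)) powr q = real n powr (1 - ?p)"
      using q by (simp add: powr_powr left_diff_distrib)
    finally show ?thesis .
  qed
  have "measure (random_eigenvector G \<psi> lam I) {u \<in> space (random_eigenvector G \<psi> lam I). Lq_norm q (verts G) u \<ge> ?a}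
     \<le> normal_abs_moment q * (\<Sum>x\<in>verts G. ((\<Sum>k\<in>?S. (\<psi> k x)\<^sup>2) / real (card ?S)) powr ?p) / ?a powr q"
    by (rule random_eigenvector_tail[OF fin q ne a])
  also have "\<dots> \<le> normal_abs_moment q * (W powr ?p * real n powr (1 - ?p) * U) / ?a powr q"
    using sum normal_abs_moment_nonneg by (intro divide_right_mono mult_left_mono) auto
  also have "\<dots> = normal_abs_moment q * (W powr ?p * U) * real n powr (1 - ?p) / ?a powr q"
    by (simp add: mult_ac)
  also have "\<dots> \<le> C' powr q * real n powr (1 - ?p) / ?a powr q"
    using C'(2) by (intro divide_right_mono mult_right_mono) (auto simp: W_def)
  also have "\<dots> = \<Lambda> powr (- q)"
    unfolding aq using C' \<Lambda> n_pos by (simp add: powr_minus divide_simps)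
  finally show ?thesis .
qed

end

end

section \<open>Intervals and the mean spectral measure\<close>

text \<open>\<open>measure_of\<close> returns the zero measure when the given set function is not a
  measure. In either case its value is at most the integral on the right, and this inequality is the
  direction required.\<close>

lemma mean_spectral_measure_lower:
  assumes dens: "has_density_ge_on (mean_spectral_measure P) c0 S" and S: "open S"
    and B: "B \<in> sets borel" "B \<subseteq> S"
  shows "ennreal c0 * emeasure lborel B \<le> (\<integral>\<^sup>+c. emeasure (spectral_measure (representative c)) B \<partial>P)"
proof -
  let ?M = "mean_spectral_measure P"
  obtain f where f[measurable]: "f \<in> borel_measurable borel" and ge: "\<And>t. t \<in> S \<Longrightarrow> c0 \<le> f t"
    and eq: "restrict_space ?M S = density (restrict_space lborel S) (\<lambda>t. ennreal (f t))"
    using dens unfolding has_density_ge_on_def by blast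
  have S': "S \<in> sets borel" using S by simp
  have sM: "sets ?M = sets borel" "space ?M = UNIV" unfolding mean_spectral_measure_def
    by (simp_all add: sets_measure_of_conv space_measure_of_conv sets.sigma_sets_eq[of borel, simplified])
  have Br: "B \<in> sets (restrict_space lborel S)" using B S' by (subst sets_restrict_space_iff) auto
  have "ennreal c0 * emeasure lborel B = (\<integral>\<^sup>+t. ennreal c0 * indicator B t \<partial>lborel)"
    using B by (simp add: nn_integral_cmult)
  also have "\<dots> \<le> (\<integral>\<^sup>+t. ennreal (f t) * indicator B t * indicator S t \<partial>lborel)"
    using ge B by (intro nn_integral_mono) (auto simp: indicator_def intro!: ennreal_leI)
  also have "\<dots> = (\<integral>\<^sup>+t. ennreal (f t) * indicator B t \<partial>restrict_space lborel S)"
    using S' by (subst nn_integral_restrict_space) auto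
  also have "\<dots> = emeasure (density (restrict_space lborel S) (\<lambda>t. ennreal (f t))) B"
    using Br by (subst emeasure_density) (auto intro!: measurable_restrict_space1)
  also have "\<dots> = emeasure (restrict_space ?M S) B" by (simp only: eq)
  also have "\<dots> = emeasure ?M B" using S' B sM by (intro emeasure_restrict_space) auto
  also have "\<dots> \<le> (\<integral>\<^sup>+c. emeasure (spectral_measure (representative c)) B \<partial>P)"
    unfolding mean_spectral_measure_def emeasure_measure_of_conv by auto
  finally show ?thesis .
qed

text \<open>Positive length excludes the empty set and points; the endpoints may or may not belong
  to \<open>I\<close>, hence the open interval inside and the closed one outside.\<close>

lemma interval_endpoints:
  fixes I :: "real set"
  assumes I: "is_interval I" "bounded I" and pos: "measure lborel I > 0"
  obtains a b where "a < b" "{a<..<b} \<subseteq> I" "I \<subseteq> {a..b}" "measure lborel I = b - a"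
proof -
  define a b where "a = Inf I" and "b = Sup I"
  have ne: "I \<noteq> {}" using pos by auto
  have bd: "bdd_below I" "bdd_above I" using I(2) by (auto simp: bounded_imp_bdd_below bounded_imp_bdd_above)
  have sub: "I \<subseteq> {a..b}" using bd by (auto simp: a_def b_def intro: cInf_lower cSup_upper)
  have inc: "{a<..<b} \<subseteq> I"
  proof
    fix t assume t: "t \<in> {a<..<b}"
    obtain u where "u \<in> I" "u < t" using t ne bd cInf_less_iff[of I t] by (auto simp: a_def)
    moreover obtain v where "v \<in> I" "t < v" using t ne bd less_cSup_iff[of I t] by (auto simp: b_def)
    ultimately show "t \<in> I" using I(1) by (metis is_interval_1 less_imp_le)
  qed
  have "I = {a<..<b} \<union> (I \<inter> {a, b})" using inc sub by force
  moreover have "I \<inter> {a, b} \<in> sets borel" by (intro borel_closed finite_imp_closed) auto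
  ultimately have Im: "I \<in> sets borel" by (metis borel_open open_greaterThanLessThan sets.Un)
  have ab: "a < b"
  proof (rule ccontr)
    assume "\<not> a < b"
    then have "emeasure lborel I \<le> emeasure lborel {b}" using sub by (intro emeasure_mono) auto
    then have "measure lborel I = 0" by (simp add: measure_def)
    then show False using pos by simp
  qed
  have "emeasure lborel {a<..<b} \<le> emeasure lborel I" "emeasure lborel I \<le> emeasure lborel {a..b}"
    using inc sub Im by (auto intro!: emeasure_mono)
  then have "emeasure lborel I = ennreal (b - a)" using ab by simp
  then have "measure lborel I = b - a" using ab by (simp add: measure_def)
  then show thesis using that ab inc sub by blast
qed

text \<open>\<open>C\<close> and \<open>C'\<close> precede the graphs, so they depend only on the
  limit and the fixed parameters. For h = 1 the logarithm vanishes and the length condition would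
  admit even the empty interval, hence \<open>h n \<noteq> 1\<close>. That the subspace is nonzero
  is part of the conclusion because the law on its sphere is meaningful only then.\<close>

theorem theorem1p9:
  fixes q L h0 c0 :: real and D :: nat and P :: "rclass measure" and I1 :: "real set"
  assumes "2 \<le> q"
    and "random_rooted_graph P"
    and "AE c in P. \<forall>g\<in>c. rooted_tree g"
    and "L > 0" and "h0 > 0"
    and "open I1" and "bounded I1"
    and "(SUP (t, \<eta>)\<in>I1 \<times> {0<..<1}. \<integral>\<^sup>+c.
           ennreal (Im (resolvent (representative c) (Complex t \<eta>)) powr (q / 2)
             + (cmod (resolvent (representative c) (Complex t \<eta>)))\<^sup>2) \<partial>P) < \<infinity>"
    and "c0 > 0" and "has_density_ge_on (mean_spectral_measure P) c0 I1"
  shows "\<exists>C>0. \<exists>C'>0. \<forall>(G :: nat \<Rightarrow> 'a graph) (h :: nat \<Rightarrow> nat).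
    (\<forall>n\<ge>1. simple_graph (G n) \<and> finite (verts (G n)) \<and> card (verts (G n)) = n \<and>
            (\<forall>x\<in>verts (G n). card (neighbours (G n) x) \<le> D)) \<and>
    local_weak_limit G P \<and>
    (\<forall>n\<ge>1. real (h n) \<ge> h0 \<and>
            dTV (empirical_ball_law (h n) (G n)) (ball_law (h n) P)
              \<le> L * real (h n) powr (- q / 2)) \<longrightarrow>
    (\<forall>\<Lambda>>0. \<forall>n\<ge>1. \<forall>I \<psi> lam.
       h n \<noteq> 1 \<and> is_interval I \<and> I \<subseteq> I1 \<and>
       measure lborel I \<ge> C * ln (real (h n)) / real (h n) \<and>
       eigenbasis (G n) \<psi> lam \<longrightarrow>
         spectral_subspace (G n) \<psi> lam I \<noteq> {zero_vector (G n)} \<and>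
         measure (random_eigenvector (G n) \<psi> lam I)
           {u \<in> space (random_eigenvector (G n) \<psi> lam I).
              Lq_norm q (verts (G n)) u \<ge> \<Lambda> * C' * real n powr (1 / q - 1 / 2)}
           \<le> \<Lambda> powr (- q))"
proof -
  define p where "p = q / 2"
  have p: "p \<ge> 1" using assms(1) by (simp add: p_def)
  obtain R0 where R0: "\<And>t. t \<in> I1 \<Longrightarrow> \<bar>t\<bar> \<le> R0" using assms(7) unfolding bounded_iff by auto
  define R where "R = max 1 R0"
  have R: "R \<ge> 1" "\<And>t. t \<in> I1 \<Longrightarrow> \<bar>t\<bar> \<le> R" using R0 by (fastforce simp: R_def)+
  \<comment> \<open>Bounds (t - s)^2 + \<eta>^2 for t in the spectral range, s in \<open>I1\<close>
    and \<eta> < 1. The degree bound is raised to \<open>Suc D\<close>, which is at least 1.\<close>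
  define B where "B = (real (Suc D) + R)\<^sup>2 + 1"
  have B: "sqrt B \<ge> 1" by (simp add: B_def)
  define M where "M = (SUP (t, \<eta>)\<in>I1 \<times> {0<..<1}. \<integral>\<^sup>+c.
           ennreal (Im (resolvent (representative c) (Complex t \<eta>)) powr (q / 2)
             + (cmod (resolvent (representative c) (Complex t \<eta>)))\<^sup>2) \<partial>P)"
  define M0 where "M0 = enn2real M"
  have M0: "M0 \<ge> 0" by (simp add: M0_def)
  have res: "(\<integral>\<^sup>+c. ennreal (Im (resolvent (representative c) (Complex t \<eta>)) powr p) \<partial>P) \<le> ennreal M0"
    if "t \<in> I1" "0 < \<eta>" "\<eta> < 1" for t \<eta>
  proof -
    have "(\<integral>\<^sup>+c. ennreal (Im (resolvent (representative c) (Complex t \<eta>)) powr p) \<partial>P)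
       \<le> (\<integral>\<^sup>+c. ennreal (Im (resolvent (representative c) (Complex t \<eta>)) powr (q / 2)
             + (cmod (resolvent (representative c) (Complex t \<eta>)))\<^sup>2) \<partial>P)"
      unfolding p_def by (intro nn_integral_mono ennreal_leI) simp
    also have "\<dots> \<le> M"
      unfolding M_def using that by (intro SUP_upper2[of "(t, \<eta>)"]) auto
    also have "\<dots> = ennreal M0" using assms(8) unfolding M_def[symmetric] M0_def by simp
    finally show ?thesis .
  qed
  define U where "U = 2 powr p * (M0 + L + 1)"
  have U: "U \<ge> 0" using M0 assms(4) by (simp add: U_def)
  \<comment> \<open>\<open>K \<ge> R + 1\<close> forces \<eta> = (b - a)/(2K) \<le> R/K < 1; the
    last summand gives \<open>KU\<close>, since K \<le> K^2.\<close>
  define K where "K = R + 1 + 8 * (1 + U) / c0"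
  have K: "K \<ge> R + 1" "K > 1" using R U assms(9) by (auto simp: K_def add_pos_nonneg)
  have KU: "8 * (1 + U) \<le> K\<^sup>2 * c0"
  proof -
    have "8 * (1 + U) / c0 \<le> K" using R by (simp add: K_def)
    also have "K \<le> K\<^sup>2" using K by (simp add: power2_eq_square)
    finally show ?thesis using assms(9) by (simp add: divide_le_eq)
  qed
  \<comment> \<open>One summand per requirement, in order: the residual of the Poisson approximation
    falls below 2/h; \<theta> \<le> 1/2; the errors of approximation and total variation together
    are at most \<eta> c0.\<close>
  define C where "C = 8 * K * sqrt B + 8 * K / ln 2 + 4 * K * (24 + 14 * L) / (c0 * ln 2)"
  have ln2: "ln 2 > (0::real)" by simp
  have C_parts: "8 * K * sqrt B \<le> C" "8 * K / ln 2 \<le> C" "4 * K * (24 + 14 * L) / (c0 * ln 2) \<le> C"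
    using K B assms(4,9) ln2 by (auto simp: C_def)
  have C: "C > 0" using less_le_trans[OF _ C_parts(2), of 0] K by simp
  \<comment> \<open>Chosen so that 2/h \<le> \<theta> \<eta>, as h \<ge> 2 gives ln h \<ge> ln 2:
    all errors of order 1/h become a fixed fraction of the width.\<close>
  define \<theta> where "\<theta> = 4 * K / (C * ln 2)"
  have \<theta>: "\<theta> > 0" "\<theta> \<le> 1 / 2" "\<theta> * (24 + 14 * L) \<le> c0"
  proof -
    show "\<theta> > 0" using K C by (simp add: \<theta>_def)
    have "8 * K \<le> C * ln 2" using C_parts(2) ln2 by (simp add: divide_le_eq)
    then show "\<theta> \<le> 1 / 2" using C by (simp add: \<theta>_def divide_le_eq)
    have "4 * K * (24 + 14 * L) \<le> C * (c0 * ln 2)" using C_parts(3) ln2 assms(9) by (simp add: divide_le_eq)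
    then show "\<theta> * (24 + 14 * L) \<le> c0" using C ln2 by (simp add: \<theta>_def divide_le_eq mult_ac)
  qed
  define W where "W = normal_abs_moment q * ((8 * (1 + K\<^sup>2) / c0) powr (q / 2) * U)"
  have W: "W \<ge> 0" using U normal_abs_moment_nonneg by (simp add: W_def)
  \<comment> \<open>\<open>W + 1\<close> in place of \<open>W\<close> keeps the constant positive
    when \<open>W\<close> is 0.\<close>
  define C' where "C' = (W + 1) powr (1 / q)"
  have C': "C' > 0" "W \<le> C' powr q" using W assms(1) by (auto simp: C'_def powr_powr)
  show ?thesis
  proof (rule exI[of _ C], rule conjI[OF C], rule exI[of _ C'], rule conjI[OF C'(1)], intro allI impI, elim conjE)
    fix G :: "nat \<Rightarrow> 'a graph" and h :: "nat \<Rightarrow> nat" and \<Lambda> :: real and n :: nat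
      and I :: "real set" and \<psi> :: "nat \<Rightarrow> 'a \<Rightarrow> real" and lam :: "nat \<Rightarrow> real"
    assume graphs: "\<forall>n\<ge>1. simple_graph (G n) \<and> finite (verts (G n)) \<and> card (verts (G n)) = n \<and>
            (\<forall>x\<in>verts (G n). card (neighbours (G n) x) \<le> D)"
      and lim: "local_weak_limit G P"
      and close: "\<forall>n\<ge>1. real (h n) \<ge> h0 \<and>
            dTV (empirical_ball_law (h n) (G n)) (ball_law (h n) P) \<le> L * real (h n) powr (- q / 2)"
      and \<Lambda>: "0 < \<Lambda>" and n: "1 \<le> n" and h1: "h n \<noteq> 1"
      and I: "is_interval I" "I \<subseteq> I1" "C * ln (real (h n)) / real (h n) \<le> measure lborel I"
      and eb: "eigenbasis (G n) \<psi> lam"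
    define H where "H = real (h n)"
    have "h n \<noteq> 0" using close n assms(5) by fastforce
    then have H: "H \<ge> 2" using h1 by (simp add: H_def)
    have Gn: "simple_graph (G n)" "finite (verts (G n))" "card (verts (G n)) = n"
      "\<And>x. x \<in> verts (G n) \<Longrightarrow> card (neighbours (G n) x) \<le> D" using graphs n by auto
    have lnH: "ln H \<ge> ln 2" "ln H > 0" using H by simp_all
    have pos: "measure lborel I > 0"
      using less_le_trans[OF _ I(3), of 0] C H lnH ln2 by (simp add: H_def)
    obtain a b where ab: "a < b" "{a<..<b} \<subseteq> I" "I \<subseteq> {a..b}" "measure lborel I = b - a"
      by (rule interval_endpoints[OF I(1) bounded_subset[OF assms(7) I(2)] pos], rule that)
    define s \<eta> where "s = (a + b) / 2" and "\<eta> = (b - a) / (2 * K)"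
    have K\<eta>: "K * \<eta> = (b - a) / 2" using K by (simp add: \<eta>_def)
    have \<eta>0: "\<eta> > 0" using ab K by (simp add: \<eta>_def)
    have "s \<in> {a<..<b}" using ab(1) by (simp add: s_def)
    then have sI: "s \<in> I1" using ab(2) I(2) by blast
    \<comment> \<open>The endpoints may lie outside \<open>I1\<close>, so they are approached from
      inside the interval.\<close>
    have "b - a \<le> 2 * R"
    proof (rule field_le_epsilon)
      fix e :: real assume e: "e > 0"
      define e' where "e' = min (e / 2) ((b - a) / 3)"
      have "0 < e'" "e' < b - a" using ab(1) e by (auto simp: e'_def min_def)
      then have "a + e' \<in> {a<..<b}" "b - e' \<in> {a<..<b}" by auto
      then have "a + e' \<in> I" "b - e' \<in> I" using ab(2) by blast+
      then have "\<bar>a + e'\<bar> \<le> R" "\<bar>b - e'\<bar> \<le> R" using R(2) I(2) by auto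
      moreover have "2 * e' \<le> e" by (auto simp: e'_def)
      ultimately show "b - a \<le> 2 * R + e" by (auto simp: abs_le_iff)
    qed
    then have "\<eta> \<le> R / K" using K by (simp add: \<eta>_def divide_simps)
    also have "R / K < 1" using K R by simp
    finally have \<eta>1: "\<eta> < 1" .
    have \<eta>H: "C * ln H / (2 * K * H) \<le> \<eta>"
    proof -
      have "C * ln H / H / (2 * K) \<le> (b - a) / (2 * K)"
        using I(3) ab(4) K by (intro divide_right_mono) (auto simp: H_def)
      then show ?thesis by (simp add: \<eta>_def mult_ac)
    qed
    have Hinv: "2 / H \<le> \<theta> * \<eta>"
    proof -
      have "2 / H = \<theta> * (C * ln 2 / (2 * K * H))" using K C ln2 H by (simp add: \<theta>_def)
      also have "C * ln 2 / (2 * K * H) \<le> C * ln H / (2 * K * H)"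
        using lnH C K H by (intro divide_right_mono mult_left_mono) auto
      also note \<eta>H
      finally show ?thesis using \<theta> by simp
    qed
    \<comment> \<open>Then deg Q \<le> 2 (h div 4), so Q^2 still has degree at most h, while m \<ge>
      h/4 keeps the exponential decay.\<close>
    define m where "m = h n div 4 + 1"
    have "\<eta> \<le> sqrt B" using \<eta>1 B by linarith
    then obtain Q where deg: "degree Q \<le> 2 * (m - 1)"
      and Q: "\<And>t. (t - s)\<^sup>2 + \<eta>\<^sup>2 \<le> B \<Longrightarrow> \<bar>\<eta>\<^sup>2 / ((t - s)\<^sup>2 + \<eta>\<^sup>2) - poly Q t\<bar> \<le> 2 * exp (- (real m * \<eta> / sqrt B))"
      using poisson_kernel_approx[OF \<eta>0, of B m s] by (auto simp: m_def)
    define \<epsilon> where "\<epsilon> = 2 * exp (- (real m * \<eta> / sqrt B))"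
    have "\<epsilon> \<le> 2 / H"
    proof -
      have m: "real m \<ge> H / 4"
      proof -
        have "h n \<le> 4 * m" by (simp add: m_def)
        then have "real (h n) \<le> 4 * real m" by linarith
        then show ?thesis by (simp add: H_def)
      qed
      have "ln H \<le> (H / 4) * (C * ln H / (2 * K * H)) / sqrt B"
      proof -
        have "8 * K * sqrt B * ln H \<le> C * ln H" using C_parts(1) lnH by (intro mult_right_mono) auto
        then show ?thesis using K H B by (simp add: field_simps)
      qed
      also have "\<dots> \<le> real m * \<eta> / sqrt B"
        using m \<eta>H B H C K lnH ln2 \<eta>0 by (intro divide_right_mono mult_mono) auto
      finally have "exp (- (real m * \<eta> / sqrt B)) \<le> exp (- ln H)" by simp
      also have "\<dots> = 1 / H" using H by (simp add: exp_minus inverse_eq_divide)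
      finally show ?thesis by (simp add: \<epsilon>_def)
    qed
    then have \<epsilon>: "\<epsilon> \<le> \<theta> * \<eta>" "\<epsilon> \<le> 1" using Hinv H by (auto simp: divide_le_eq elim: order_trans)
    have "\<theta> * \<eta> \<le> 1 / 2 * \<eta>" using \<theta> \<eta>0 by (intro mult_right_mono) auto
    then have \<epsilon>2: "2 * \<epsilon> \<le> \<eta>" using \<epsilon> by simp
    define d where "d = L * H powr (- p)"
    have d0: "d \<ge> 0" using assms(4) by (simp add: d_def)
    \<comment> \<open>Since p \<ge> 1 the rate h^(-p) is at most 1/h, which suffices for the lower
      bound; the full rate is needed only in \<open>d2\<close>.\<close>
    have d1: "d \<le> L * (\<theta> * \<eta> / 2)"
    proof -
      have "H powr (- p) \<le> H powr (- 1)" using p H by (intro powr_mono) auto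
      also have "\<dots> = 1 / H" using H by (simp add: powr_minus inverse_eq_divide)
      also have "\<dots> \<le> \<theta> * \<eta> / 2" using Hinv by simp
      finally show ?thesis using assms(4) by (simp add: d_def)
    qed
    have d2: "(2 / \<eta>) powr p * d \<le> L"
    proof -
      have "2 / H \<le> \<eta>" using Hinv \<open>\<theta> * \<eta> \<le> 1 / 2 * \<eta>\<close> \<eta>0 by linarith
      then have le1: "2 / (\<eta> * H) \<le> 1" using \<eta>0 H by (simp add: divide_le_eq)
      have "(2 / \<eta>) powr p * H powr (- p) = (2 / (\<eta> * H)) powr p"
        using \<eta>0 H by (simp add: powr_divide powr_mult powr_minus divide_simps)
      also have "\<dots> \<le> 1"
        using p \<eta>0 H le1 by (intro powr_le1) auto
      finally have "L * ((2 / \<eta>) powr p * H powr (- p)) \<le> L * 1" using assms(4) by (intro mult_left_mono) auto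
      then show ?thesis by (simp add: d_def mult_ac)
    qed
    have err: "24 * \<epsilon> + 28 * d \<le> \<eta> * c0"
    proof -
      have "24 * \<epsilon> + 28 * d \<le> \<eta> * (\<theta> * (24 + 14 * L))" using \<epsilon>(1) d1 by (simp add: algebra_simps)
      also have "\<dots> \<le> \<eta> * c0" using \<theta>(3) \<eta>0 by (intro mult_left_mono) auto
      finally show ?thesis .
    qed
    have deg': "degree Q \<le> h n" "degree (Q * Q) \<le> h n"
      using deg degree_mult_le[of Q Q] by (auto simp: m_def)
    interpret E: approximate_eigenvectors "G n" \<psi> lam "Suc D" P "h n" d s \<eta> \<epsilon> Q
    proof unfold_locales
      show "verts (G n) \<noteq> {}" using Gn n by auto
      show "card (neighbours (G n) x) \<le> Suc D" if "x \<in> verts (G n)" for x using Gn(4)[OF that] by simp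
      show "AE c in P. \<forall>y\<in>verts (fst (representative c)). card (neighbours (fst (representative c)) y) \<le> Suc D"
        using local_weak_limit_degree_bound[OF lim, of D] graphs by (fastforce elim: eventually_mono)
      show "dTV (empirical_ball_law (h n) (G n)) (ball_law (h n) P) \<le> d"
        using close n by (simp add: d_def H_def p_def)
      fix t assume t: "\<bar>t\<bar> \<le> real (Suc D)"
      have "\<bar>t - s\<bar> \<le> real (Suc D) + R" using t R(2)[OF sI] by linarith
      then have "(t - s)\<^sup>2 \<le> (real (Suc D) + R)\<^sup>2" using R by (simp add: abs_le_square_iff[symmetric])
      moreover have "\<eta>\<^sup>2 \<le> 1" using \<eta>0 \<eta>1 by (simp add: power_le_one)
      ultimately show "\<bar>poisson s \<eta> t - poly Q t\<bar> \<le> \<epsilon>"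
        unfolding poisson_def \<epsilon>_def by (intro Q) (simp add: B_def)
    qed (use Gn eb assms(2) \<eta>0 \<epsilon> \<epsilon>2 deg' in auto)
    have mass: "(\<Sum>x\<in>verts (G n). (E.local_mass x / \<eta>) powr p) \<le> real (card (verts (G n))) * U"
      using E.local_mass_moment[OF p M0 res[OF sI \<eta>0 \<eta>1] d2] assms(4) by (simp add: U_def Gn(3))
    have I_in: "\<bar>t - s\<bar> \<le> K * \<eta>" if "t \<in> I" for t
    proof -
      have "a \<le> t" "t \<le> b" using that ab(3) by auto
      then show ?thesis unfolding K\<eta> s_def by (simp add: abs_le_iff field_simps)
    qed
    have I_out: "\<bar>t - s\<bar> \<ge> K * \<eta>" if "t \<notin> I" for t
    proof -
      have "t \<le> a \<or> b \<le> t" using that ab(2) by force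
      then show ?thesis unfolding K\<eta>
        using abs_ge_self[of "t - s"] abs_ge_minus_self[of "t - s"] by (auto simp: s_def field_simps)
    qed
    have dens: "ennreal (2 * \<eta> * c0) \<le> (\<integral>\<^sup>+c. emeasure (spectral_measure (representative c)) {s - \<eta>..s + \<eta>} \<partial>P)"
    proof -
      \<comment> \<open>K > 1 puts the window of half-width \<eta> strictly inside \<open>I\<close>,
        hence in \<open>I1\<close>, where the density is bounded below.\<close>
      have "\<eta> < K * \<eta>" using K \<eta>0 by simp
      then have "{s - \<eta>..s + \<eta>} \<subseteq> {a<..<b}" unfolding K\<eta> s_def by (auto simp: field_simps)
      then have sub: "{s - \<eta>..s + \<eta>} \<subseteq> I1" using ab(2) I(2) by blast
      have "ennreal c0 * emeasure lborel {s - \<eta>..s + \<eta>} = ennreal (2 * \<eta> * c0)"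
        using \<eta>0 assms(9) by (simp add: ennreal_mult'[symmetric] mult_ac)
      then show ?thesis using mean_spectral_measure_lower[OF assms(10,6) _ sub] by simp
    qed
    have K0: "K > 0" using K by simp
    note cnt = E.eigenvalue_count_lower[OF K0 I_in I_out dens d0 err mass p KU]
    have "real (card (spectral_indices (G n) lam I)) > 0"
      using cnt n \<eta>0 assms(9) by (intro less_le_trans[OF _ cnt]) (simp add: Gn(3))
    then have ne: "spectral_indices (G n) lam I \<noteq> {}" by auto
    have subspace: "spectral_subspace (G n) \<psi> lam I \<noteq> {zero_vector (G n)}"
      by (rule E.spectral_subspace_nontrivial[OF ne])
    have tail: "measure (random_eigenvector (G n) \<psi> lam I)
           {u \<in> space (random_eigenvector (G n) \<psi> lam I).
              Lq_norm q (verts (G n)) u \<ge> \<Lambda> * C' * real n powr (1 / q - 1 / 2)} \<le> \<Lambda> powr (- q)"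
      using E.random_eigenvector_tail_bound[OF K0 I_in I_out cnt mass[unfolded p_def] assms(1,9) C'(1) _ \<Lambda>]
        C'(2) by (simp add: Gn(3) W_def)
    show "spectral_subspace (G n) \<psi> lam I \<noteq> {zero_vector (G n)} \<and>
         measure (random_eigenvector (G n) \<psi> lam I)
           {u \<in> space (random_eigenvector (G n) \<psi> lam I).
              Lq_norm q (verts (G n)) u \<ge> \<Lambda> * C' * real n powr (1 / q - 1 / 2)}
           \<le> \<Lambda> powr (- q)"
      using subspace tail by (rule conjI)
  qed
qed

end
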